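(* Let $\lambda>0$ and $0<\mu<\frac{\lambda}{1+\lambda}$. Then there exist positive constants $C_0,b$ depending on $\mu$ and $\lambda$ such that for all large enough $n$, the process $\mathrm{ARW}(\mu,\lambda)$ on $\mathbb{Z}/n\mathbb{Z}$ satisfies $$\mathbb{P}\left(T_n(\mu,\lambda)>C_0\,n\log^2 n\right)\le \frac{1}{n^b}.$$
   Context: Activated Random Walk (ARW) with sleep rate $\lambda>0$ on the cycle $\mathbb{Z}/n\mathbb{Z}$ (nearest neighbour edges): each particle is either active or asleep. In continuous time each active particle independently performs a simple symmetric random walk at rate one and, at rate $\lambda$, tries to fall asleep; the attempt succeeds (the particle becomes sleepy) if it is the only particle at its site, and has no effect otherwise. A sleepy particle does not move, and becomes active when an active particle occupies the same site. $\mathrm{ARW}(\mu,\lambda)$, for $\mu\in(0,1)$, denotes this process started from the random initial configuration in which each site independently contains a $\mathrm{Bernoulli}(\mu)$ number of particles (one with probability $\mu$, none with probability $1-\mu$), all active. Almost surely the process reaches in finite time a configuration with all particles asleep. $T_n(\mu,\lambda)$ denotes the total number of attempts by any active particle to either jump or try to sleep until that time. Equivalently, $T_n(\mu,\lambda)$ is the absorption time of the discrete-time chain in which at each step an active particle is chosen uniformly at random, and it jumps to each of its two neighbouring sites with probability $\frac{1}{2(1+\lambda)}$ each and tries to fall asleep with probability $\frac{\lambda}{1+\lambda}$. The probability $\mathbb{P}$ is over both the initial configuration and the dynamics. *)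

theory Defs
  imports "HOL-Probability.Probability" "HOL-Library.Extended_Nat"
begin

text \<open>
  A sleepy particle is woken as soon as another particle shares its site, so a site carries either
  \<open>k\<close> active particles (\<open>k = 0\<close> being the empty site) or exactly one sleepy particle.
  The sites of the cycle of length \<open>n\<close> are \<open>0, \<dots>, n - 1\<close>; outside of these every configuration
  that is reached carries the value \<open>Active 0\<close>.
\<close>

datatype site_state = Sleepy | Active nat

type_synonym config = "nat \<Rightarrow> site_state"

fun num_active :: "site_state \<Rightarrow> nat" where
  "num_active Sleepy = 0"
| "num_active (Active k) = k"

fun add_particle :: "site_state \<Rightarrow> site_state" where
  "add_particle Sleepy = Active 2"
| "add_particle (Active k) = Active (Suc k)"

fun remove_active :: "site_state \<Rightarrow> site_state" where
  "remove_active Sleepy = Sleepy"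
| "remove_active (Active k) = Active (k - 1)"

definition jump :: "nat \<Rightarrow> nat \<Rightarrow> config \<Rightarrow> config" where
  "jump x y \<eta> = (let \<eta>' = \<eta>(x := remove_active (\<eta> x)) in \<eta>'(y := add_particle (\<eta>' y)))"

definition try_sleep :: "nat \<Rightarrow> config \<Rightarrow> config" where
  "try_sleep x \<eta> = (if \<eta> x = Active 1 then \<eta>(x := Sleepy) else \<eta>)"

text \<open>The pair \<open>(x, i)\<close> stands for the \<open>i\<close>-th active particle at site \<open>x\<close>.\<close>

definition active_particles :: "nat \<Rightarrow> config \<Rightarrow> (nat \<times> nat) set" where
  "active_particles n \<eta> = {(x, i). x < n \<and> i < num_active (\<eta> x)}"

lemma finite_active_particles: "finite (active_particles n \<eta>)"
proof -
  have "active_particles n \<eta> = (SIGMA x:{..<n}. {..<num_active (\<eta> x)})"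
    by (auto simp: active_particles_def)
  then show ?thesis
    by simp
qed

definition all_asleep :: "nat \<Rightarrow> config \<Rightarrow> bool" where
  "all_asleep n \<eta> \<longleftrightarrow> active_particles n \<eta> = {}"

definition particle_attempt :: "real \<Rightarrow> nat \<Rightarrow> nat \<Rightarrow> config \<Rightarrow> config pmf" where
  "particle_attempt lam n x \<eta> =
     bind_pmf (bernoulli_pmf (lam / (1 + lam))) (\<lambda>sleeps.
       if sleeps then return_pmf (try_sleep x \<eta>)
       else bind_pmf (bernoulli_pmf (1 / 2)) (\<lambda>right.
         return_pmf (jump x (if right then (x + 1) mod n else (x + n - 1) mod n) \<eta>)))"

definition arw_step :: "real \<Rightarrow> nat \<Rightarrow> config \<Rightarrow> config pmf" where
  "arw_step lam n \<eta> =
     (if all_asleep n \<eta> then return_pmf \<eta>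
      else bind_pmf (pmf_of_set (active_particles n \<eta>))
             (\<lambda>(x, i). particle_attempt lam n x \<eta>))"

definition arw_init :: "real \<Rightarrow> nat \<Rightarrow> config pmf" where
  "arw_init \<mu> n =
     Pi_pmf {..<n} (Active 0) (\<lambda>_. map_pmf (\<lambda>b. Active (of_bool b)) (bernoulli_pmf \<mu>))"

text \<open>
  The law of the whole trajectory \<open>\<omega> 0, \<omega> 1, \<dots>\<close> of the chain is obtained from the
  Ionescu-Tulcea theorem, applied to the initial law and to the transition kernel.
\<close>

definition arw_kernel :: "real \<Rightarrow> real \<Rightarrow> nat \<Rightarrow> nat \<Rightarrow> (nat \<Rightarrow> config) \<Rightarrow> config measure" where
  "arw_kernel \<mu> lam n t \<omega> =
     (case t of 0 \<Rightarrow> measure_pmf (arw_init \<mu> n)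
              | Suc s \<Rightarrow> measure_pmf (arw_step lam n (\<omega> s)))"

lemma Ionescu_Tulcea_arw:
  "Ionescu_Tulcea (arw_kernel \<mu> lam n) (\<lambda>_. count_space UNIV)"
proof (rule Ionescu_Tulcea.intro)
  fix i :: nat
  show "arw_kernel \<mu> lam n i \<in> Pi\<^sub>M {0..<i} (\<lambda>_. count_space UNIV) \<rightarrow>\<^sub>M subprob_algebra (count_space UNIV)"
  proof (cases i)
    case 0
    then show ?thesis
      unfolding arw_kernel_def
      by (auto intro!: measurable_const simp: space_subprob_algebra measure_pmf.subprob_space_axioms)
  next
    case (Suc s)
    have *: "(\<lambda>\<omega>. \<omega> s) \<in> Pi\<^sub>M {0..<i} (\<lambda>_. count_space (UNIV :: config set)) \<rightarrow>\<^sub>M count_space UNIV"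
      using Suc by (intro measurable_component_singleton) auto
    have "(\<lambda>\<omega>. measure_pmf (arw_step lam n (\<omega> s)))
        \<in> Pi\<^sub>M {0..<i} (\<lambda>_. count_space UNIV) \<rightarrow>\<^sub>M subprob_algebra (count_space UNIV)"
      by (rule measurable_compose[OF *])
         (auto simp: space_subprob_algebra measure_pmf.subprob_space_axioms)
    moreover have "arw_kernel \<mu> lam n i = (\<lambda>\<omega>. measure_pmf (arw_step lam n (\<omega> s)))"
      using Suc by (simp add: arw_kernel_def fun_eq_iff)
    ultimately show ?thesis
      by simp
  qed
next
  fix i and x :: "nat \<Rightarrow> config"
  show "prob_space (arw_kernel \<mu> lam n i x)"
    by (auto simp: arw_kernel_def measure_pmf.prob_space_axioms split: nat.split)
qed

definition arw_law :: "real \<Rightarrow> real \<Rightarrow> nat \<Rightarrow> (nat \<Rightarrow> config) measure" where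
  "arw_law \<mu> lam n =
     projective_family.lim UNIV (Ionescu_Tulcea.CI (arw_kernel \<mu> lam n) (\<lambda>_. count_space UNIV))
       (\<lambda>_. count_space UNIV)"

text \<open>
  Until absorption, every step of the chain is exactly one attempt by an active particle to jump
  or to sleep (including attempts to sleep that fail), so the absorption time counts the attempts.
\<close>

definition absorption_time :: "nat \<Rightarrow> (nat \<Rightarrow> config) \<Rightarrow> enat" where
  "absorption_time n \<omega> = (INF t \<in> {t. all_asleep n (\<omega> t)}. enat t)"

lemma space_arw_law: "space (arw_law \<mu> lam n) = UNIV"
  and sets_arw_law: "sets (arw_law \<mu> lam n) = sets (Pi\<^sub>M UNIV (\<lambda>_. count_space UNIV))"
proof -
  interpret Ionescu_Tulcea "arw_kernel \<mu> lam n" "\<lambda>_. count_space UNIV"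
    by (rule Ionescu_Tulcea_arw)
  show "space (arw_law \<mu> lam n) = UNIV" "sets (arw_law \<mu> lam n) = sets (Pi\<^sub>M UNIV (\<lambda>_. count_space UNIV))"
    unfolding arw_law_def by (simp_all add: space_PiM)
qed

lemma arw_law_finite_dim:
  "distr (arw_law \<mu> lam n) (Pi\<^sub>M {0..<t} (\<lambda>_. count_space UNIV)) (\<lambda>\<omega>. restrict \<omega> {0..<t}) =
     Ionescu_Tulcea.C (arw_kernel \<mu> lam n) (\<lambda>_. count_space UNIV) 0 t (\<lambda>_. undefined)"
proof -
  interpret Ionescu_Tulcea "arw_kernel \<mu> lam n" "\<lambda>_. count_space UNIV"
    by (rule Ionescu_Tulcea_arw)
  have sp: "(\<lambda>_. undefined) \<in> space (Pi\<^sub>M {0..<0::nat} (\<lambda>_. count_space (UNIV :: config set)))"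
    by (simp add: space_PiM)
  have up: "up_to {0..<t} = t"
    by (metis antisym finite_atLeastLessThan up_to up_to_iff_Ico order_refl
        atLeastLessThan_subset_iff le_zero_eq linorder_not_less not_less_zero nat_le_linear)
  have "distr PF.lim (Pi\<^sub>M {0..<t} (\<lambda>_. count_space UNIV)) (\<lambda>\<omega>. restrict \<omega> {0..<t}) = CI {0..<t}"
    by (rule distr_lim) simp
  also have "\<dots> = C 0 t (\<lambda>_. undefined)"
    unfolding CI_def up
    by (rule trans[OF distr_cong distr_id2])
       (auto simp: sets_C[OF sp] space_C[OF sp] space_PiM PiE_def extensional_restrict)
  finally show ?thesis
    unfolding arw_law_def .
qed

lemma prob_space_arw_law: "prob_space (arw_law \<mu> lam n)"
proof -
  interpret Ionescu_Tulcea "arw_kernel \<mu> lam n" "\<lambda>_. count_space UNIV"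
    by (rule Ionescu_Tulcea_arw)
  have sp: "(\<lambda>_. undefined) \<in> space (Pi\<^sub>M {0..<0::nat} (\<lambda>_. count_space (UNIV :: config set)))"
    by (simp add: space_PiM)
  have "prob_space (distr (arw_law \<mu> lam n) (Pi\<^sub>M {0..<0} (\<lambda>_. count_space UNIV))
          (\<lambda>\<omega>. restrict \<omega> {0..<0}))"
    unfolding arw_law_finite_dim by (rule prob_space_C) (use sp in simp)
  moreover have "(\<lambda>\<omega>. restrict \<omega> {0..<0}) \<in>
      arw_law \<mu> lam n \<rightarrow>\<^sub>M Pi\<^sub>M {0..<0} (\<lambda>_. count_space UNIV)"
    unfolding measurable_cong_sets[OF sets_arw_law refl] by (rule measurable_restrict_subset) simp
  ultimately show ?thesis
    by (rule prob_space_distrD[rotated])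
qed

lemma measurable_absorption_time:
  "absorption_time n \<in> arw_law \<mu> lam n \<rightarrow>\<^sub>M count_space UNIV"
proof -
  have c: "(\<lambda>\<omega>. \<omega> t) \<in> arw_law \<mu> lam n \<rightarrow>\<^sub>M count_space UNIV" for t
    unfolding measurable_cong_sets[OF sets_arw_law refl] by (rule measurable_component_singleton) simp
  have [measurable]: "(\<lambda>\<omega>. if all_asleep n (\<omega> t) then enat t else \<infinity>)
      \<in> arw_law \<mu> lam n \<rightarrow>\<^sub>M count_space UNIV" for t
    by (rule measurable_compose[OF c]) simp
  have "absorption_time n = (\<lambda>\<omega>. INF t. if all_asleep n (\<omega> t) then enat t else \<infinity>)"
  proof (rule ext, rule antisym)
    fix \<omega>
    show "absorption_time n \<omega> \<le> (INF t. if all_asleep n (\<omega> t) then enat t else \<infinity>)"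
      unfolding absorption_time_def by (rule INF_greatest) (auto intro: INF_lower)
    show "(INF t. if all_asleep n (\<omega> t) then enat t else \<infinity>) \<le> absorption_time n \<omega>"
      unfolding absorption_time_def
    proof (rule INF_greatest)
      fix t assume "t \<in> {t. all_asleep n (\<omega> t)}"
      then show "(INF t. if all_asleep n (\<omega> t) then enat t else \<infinity>) \<le> enat t"
        by (intro INF_lower2[of t]) simp_all
    qed
  qed
  moreover have "(\<lambda>\<omega>. INF t. if all_asleep n (\<omega> t) then enat t else \<infinity>)
      \<in> arw_law \<mu> lam n \<rightarrow>\<^sub>M count_space UNIV"
    by (rule measurable_INF) auto
  ultimately show ?thesis
    by simp
qed

end

theory Submission
  imports Defs "HOL-Real_Asymp.Real_Asymp"
begin

text \<open>
  Abelian property: attach to every site a stack of i.i.d. instructions (sleep, jump right, jump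
  left). The number of topplings until stabilisation does not depend on the order of topplings, and
  waking particles can only increase it, so any convenient toppling strategy gives an upper bound.

  The cycle is cut into blocks of length of order \<open>ln n\<close>. First every particle walks, its sleep
  instructions being ignored, until it reaches the centre of a block; by large deviations each centre
  receives fewer than \<open>m L\<close> particles, where \<open>\<mu> < m < lam / (1 + lam)\<close> and \<open>L\<close> is the block length.
  Then, as in the argument of Rolla and Sidoravicius, each particle of a pile is followed until it
  exits past one of the two barriers of its block, and is afterwards taken back to the
  site closest to that barrier whose last exit was preceded by a sleep instruction. It sleeps there,
  and this site becomes the new barrier: the barrier has advanced by a geometric number of
  sites with mean \<open>(1 + lam) / lam\<close>, independently of the side of exit. A gambler's ruin computation
  shows that the difference of the squared distances from the pile to the two barriers is almost a
  martingale, so that up to an event of probability exponentially small in \<open>L\<close> both barriers stay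
  away from the pile until it is used up. As no particle then leaves its block, each
  toppling moves a particle inside an interval of length of order \<open>ln n\<close>, and an exponential
  supermartingale bounds the number of topplings by a multiple of \<open>n ln\<^sup>2 n\<close>.
\<close>

section \<open>Geometric advances of a barrier\<close>

text \<open>Where a particle has to fall asleep is known only after it has left past the barrier,
  when its path has already consumed instructions. The state is therefore a configuration together
  with queues of revealed instructions: a path is revealed while the configuration stays as it was,
  and the place to stop is chosen afterwards. No space of infinite stacks is built; an unrevealed
  instruction is averaged at the moment it is needed, and all estimates are lower bounds for the
  probability of stabilising, with value 0 for whatever goes wrong.

  Squared distances appear because an exit on one side has probability proportional to the distance
  of the other barrier: a barrier at distance u advances with weight v, one at distance v with
  weight u, and the mean changes of the squares, about -2u/q and -2v/q, cancel in the difference.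

  The two logarithms come from the exit time of a walk from an interval of length L, of order L^2.
  The supermartingale has one bounded factor per particle, hence starts at exp(O(n)); of order n L^2
  topplings, each with decay factor 1 - const / L^2, compensate for this.\<close>

locale sleep_rate =
  fixes q :: real
  assumes q01: "0 < q" "q < 1"
begin

text \<open>
  Average of \<open>F\<close> at the distance left when a barrier at distance \<open>k + 1\<close> advances by a geometric
  number of sites with parameter \<open>q\<close>, the advance being cut off at \<open>k + 1\<close>.
\<close>

definition gap_avg :: "nat \<Rightarrow> (nat \<Rightarrow> real) \<Rightarrow> real" where
  "gap_avg k F = (\<Sum>g<k. q * (1 - q) ^ g * F (k - g)) + (1 - q) ^ k * F 0"

lemma gap_avg_0: "gap_avg 0 F = F 0"
  by (simp add: gap_avg_def)

lemma gap_avg_Suc: "gap_avg (Suc k) F = q * F (Suc k) + (1 - q) * gap_avg k F"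
  unfolding gap_avg_def sum.lessThan_Suc_shift
  by (simp add: sum_distrib_left algebra_simps)

lemma sum_geometric_gap: "q * (\<Sum>g<k. (1 - q) ^ g) = 1 - (1 - q) ^ k"
proof (induction k)
  case (Suc k)
  then show ?case by (simp add: algebra_simps)
qed simp

lemma gap_avg_mono:
  assumes "\<And>j. j \<le> k \<Longrightarrow> F j \<le> G j"
  shows "gap_avg k F \<le> gap_avg k G"
  unfolding gap_avg_def using q01 assms
  by (intro add_mono sum_mono mult_left_mono) auto

lemma gap_avg_add: "gap_avg k (\<lambda>j. F j + G j) = gap_avg k F + gap_avg k G"
  by (simp add: gap_avg_def sum.distrib algebra_simps)

lemma gap_avg_mult: "gap_avg k (\<lambda>j. c * F j) = c * gap_avg k F"
  by (simp add: gap_avg_def sum_distrib_left algebra_simps)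

lemma gap_avg_const: "gap_avg k (\<lambda>_. c) = c"
  by (induction k) (auto simp: gap_avg_0 gap_avg_Suc algebra_simps)

text \<open>Moment generating function of the geometric law on 1, 2, ... with success probability
  \<open>q\<close>; the series converges when \<open>(1 - q) * exp \<theta> < 1\<close>.\<close>

definition gap_mgf :: "real \<Rightarrow> real" where
  "gap_mgf \<theta> = q * exp \<theta> / (1 - (1 - q) * exp \<theta>)"

text \<open>Cutting off the advance only decreases its exponential moment. In the induction,
  \<open>gap_mgf\<close> is the fixed point of the recursion that \<open>gap_avg_Suc\<close> gives
  for these moments.\<close>

lemma gap_avg_exp:
  assumes \<theta>: "0 \<le> \<theta>" "(1 - q) * exp \<theta> < 1"
  shows "gap_avg k (\<lambda>u. exp (\<theta> * (real (Suc k) - real u))) \<le> gap_mgf \<theta>"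
proof (induction k)
  case 0
  have "(1 - q) * 1 \<le> (1 - q) * exp \<theta>" using q01 \<theta> by (intro mult_left_mono) auto
  then have "1 - (1 - q) * exp \<theta> \<le> q" by simp
  then have "exp \<theta> * (1 - (1 - q) * exp \<theta>) \<le> exp \<theta> * q" by (intro mult_left_mono) auto
  then show ?case using \<theta> by (simp add: gap_avg_0 gap_mgf_def le_divide_eq mult.commute)
next
  case (Suc k)
  have "(\<lambda>u. exp (\<theta> * (real (Suc (Suc k)) - real u)))
      = (\<lambda>u. exp \<theta> * exp (\<theta> * (real (Suc k) - real u)))"
    by (auto simp: exp_add[symmetric] algebra_simps)
  then have "gap_avg (Suc k) (\<lambda>u. exp (\<theta> * (real (Suc (Suc k)) - real u)))
      = q * exp \<theta> + (1 - q) * exp \<theta> * gap_avg k (\<lambda>u. exp (\<theta> * (real (Suc k) - real u)))"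
    by (simp add: gap_avg_Suc gap_avg_mult algebra_simps)
  also have "\<dots> \<le> q * exp \<theta> + (1 - q) * exp \<theta> * gap_mgf \<theta>"
    using Suc q01 by (intro add_left_mono mult_left_mono) auto
  also have "\<dots> = gap_mgf \<theta>"
  proof -
    define D where "D = 1 - (1 - q) * exp \<theta>"
    define E where "E = q * exp \<theta>"
    have D: "D \<noteq> 0" "(1 - q) * exp \<theta> = 1 - D" using \<theta> by (auto simp: D_def)
    have g: "gap_mgf \<theta> = E / D" by (simp add: gap_mgf_def D_def E_def)
    show ?thesis unfolding E_def[symmetric] D(2) g using D(1) by (simp add: field_simps)
  qed
  finally show ?case .
qed

text \<open>With w = k + 1 the exact value is w^2 - 2 w / q + (1 - (1 - q)^w) (2 - q) / q^2: the
  mean advance is 1 / q, and the cut-off removes a fraction (1 - q)^w of the second moment by lack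
  of memory. Only the linear term matters later; the rest is bounded uniformly in
  \<open>k\<close>.\<close>

lemma gap_avg_square:
  "(real (Suc k))\<^sup>2 - 2 * real (Suc k) / q \<le> gap_avg k (\<lambda>u. (real u)\<^sup>2)"
  "gap_avg k (\<lambda>u. (real u)\<^sup>2) \<le> (real (Suc k))\<^sup>2 - 2 * real (Suc k) / q + 2 / q\<^sup>2"
proof -
  define p where "p = 1 / q"
  have p: "1 \<le> p" and qp: "q * p = 1" using q01 by (auto simp: p_def)
  have sq: "p \<le> p\<^sup>2" using p self_le_power[of p 2] by simp
  have "(real (Suc k))\<^sup>2 - 2 * real (Suc k) * p \<le> gap_avg k (\<lambda>u. (real u)\<^sup>2) \<and>
    gap_avg k (\<lambda>u. (real u)\<^sup>2) \<le> (real (Suc k))\<^sup>2 - 2 * real (Suc k) * p + 2 * p\<^sup>2"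
  proof (induction k)
    case 0
    show ?case using p sq by (simp add: gap_avg_0)
  next
    case (Suc k)
    define w where "w = real (Suc k)"
    have e: "gap_avg (Suc k) (\<lambda>u. (real u)\<^sup>2) = q * w\<^sup>2 + (1 - q) * gap_avg k (\<lambda>u. (real u)\<^sup>2)"
      by (simp add: gap_avg_Suc w_def)
    have qpw: "q * (w * p) = w" "q * p\<^sup>2 = p"
      using qp by (simp_all add: power2_eq_square mult.left_commute[of q w] mult.assoc[symmetric])
    have "(1 - q) * (w\<^sup>2 - 2 * w * p) \<le> (1 - q) * gap_avg k (\<lambda>u. (real u)\<^sup>2)"
      "(1 - q) * gap_avg k (\<lambda>u. (real u)\<^sup>2) \<le> (1 - q) * (w\<^sup>2 - 2 * w * p + 2 * p\<^sup>2)"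
      using Suc q01 unfolding w_def by (auto intro!: mult_left_mono)
    moreover have "q * w\<^sup>2 + (1 - q) * (w\<^sup>2 - 2 * w * p) = w\<^sup>2 - 2 * w * p + 2 * w"
    proof -
      have "q * w\<^sup>2 + (1 - q) * (w\<^sup>2 - 2 * w * p) = w\<^sup>2 - 2 * w * p + 2 * (q * (w * p))"
        by (simp add: algebra_simps)
      then show ?thesis by (simp only: qpw)
    qed
    moreover have "q * w\<^sup>2 + (1 - q) * (w\<^sup>2 - 2 * w * p + 2 * p\<^sup>2) = w\<^sup>2 - 2 * w * p + 2 * w + 2 * p\<^sup>2 - 2 * p"
    proof -
      have "q * w\<^sup>2 + (1 - q) * (w\<^sup>2 - 2 * w * p + 2 * p\<^sup>2)
          = w\<^sup>2 - 2 * w * p + 2 * (q * (w * p)) + 2 * p\<^sup>2 - 2 * (q * p\<^sup>2)"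
        by (simp add: algebra_simps)
      then show ?thesis by (simp only: qpw)
    qed
    moreover have "(real (Suc (Suc k)))\<^sup>2 - 2 * real (Suc (Suc k)) * p = w\<^sup>2 + 2 * w + 1 - 2 * w * p - 2 * p"
      by (simp add: w_def power2_eq_square algebra_simps)
    ultimately show ?case unfolding e using p by linarith
  qed
  then show "(real (Suc k))\<^sup>2 - 2 * real (Suc k) / q \<le> gap_avg k (\<lambda>u. (real u)\<^sup>2)"
  "gap_avg k (\<lambda>u. (real u)\<^sup>2) \<le> (real (Suc k))\<^sup>2 - 2 * real (Suc k) / q + 2 / q\<^sup>2"
    by (auto simp: p_def power_divide)
qed

section \<open>Exponential moments of squared distances\<close>

lemma exp_quadratic_bounds:
  fixes y :: real
  assumes "0 \<le> y"
  shows "exp y \<le> 1 + y + y\<^sup>2 * exp y" "exp (- y) \<le> 1 - y + y\<^sup>2 * exp y"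
proof -
  have "(1 - y) * exp y \<le> exp (- y) * exp y"
    using exp_ge_add_one_self[of "- y"] by (intro mult_right_mono) auto
  also have "\<dots> = 1" by (simp add: exp_minus)
  finally have "(1 + y) * ((1 - y) * exp y) \<le> (1 + y) * 1" using assms by (intro mult_left_mono) auto
  then show "exp y \<le> 1 + y + y\<^sup>2 * exp y" by (simp add: algebra_simps power2_eq_square)
  have y: "1 + y \<le> exp y" by (rule exp_ge_add_one_self)
  have "exp (- y) \<le> 1 / (1 + y)"
    using y assms by (simp add: exp_minus inverse_eq_divide frac_le)
  also have "\<dots> \<le> 1 - y + y\<^sup>2"
  proof -
    have "(1 - y + y\<^sup>2) * (1 + y) = 1 + y ^ 3"
      by (simp add: algebra_simps power2_eq_square power3_eq_cube)
    with assms show ?thesis by (simp add: pos_divide_le_eq)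
  qed
  also have "\<dots> \<le> 1 - y + y\<^sup>2 * exp y"
    using mult_left_mono[of 1 "exp y" "y\<^sup>2"] assms by simp
  finally show "exp (- y) \<le> 1 - y + y\<^sup>2 * exp y" .
qed

text \<open>Since both distances are at most \<open>2 * L\<close> and \<epsilon> is \<theta> / L,
  the exponent is at most 4 \<theta> times the advance. The advance has exponential moments, so the
  second order remainder is a multiple of \<theta>^2 independent of \<open>L\<close>, while the
  first order term keeps the exact mean \<open>A\<close>.\<close>

lemma gap_avg_exp_square:
  assumes \<theta>: "0 < \<theta>" "4 * \<theta> \<le> s" "(1 - q) * exp (2 * s) < 1"
    and L: "0 < L" "real (Suc k) \<le> 2 * L"
  defines "\<epsilon> \<equiv> \<theta> / L" and "A \<equiv> (real (Suc k))\<^sup>2 - gap_avg k (\<lambda>u. (real u)\<^sup>2)"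
    and "D \<equiv> 32 * gap_mgf (2 * s) / s\<^sup>2"
  shows "gap_avg k (\<lambda>u. exp (\<epsilon> * ((real u)\<^sup>2 - (real (Suc k))\<^sup>2))) \<le> 1 - \<epsilon> * A + D * \<theta>\<^sup>2"
    and "gap_avg k (\<lambda>u. exp (\<epsilon> * ((real (Suc k))\<^sup>2 - (real u)\<^sup>2))) \<le> 1 + \<epsilon> * A + D * \<theta>\<^sup>2"
proof -
  define w where "w = real (Suc k)"
  define E where "E u = exp (2 * s * (real (Suc k) - real u))" for u
  define c where "c = 32 * \<theta>\<^sup>2 / s\<^sup>2"
  have s: "0 < s" using \<theta> by linarith
  have \<epsilon>: "0 \<le> \<epsilon>" using \<theta> L by (simp add: \<epsilon>_def)
  have c: "0 \<le> c" by (simp add: c_def)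
  have bound: "y\<^sup>2 * exp y \<le> c * E j \<and> 0 \<le> y" if "j \<le> k" and y_def: "y = \<epsilon> * (w\<^sup>2 - (real j)\<^sup>2)" for j y
  proof -
    define g where "g = w - real j"
    have g: "0 \<le> g" and j: "real j \<le> w" using that(1) by (auto simp: g_def w_def)
    have "w\<^sup>2 - (real j)\<^sup>2 = g * (w + real j)" by (simp add: g_def power2_eq_square algebra_simps)
    also have "\<dots> \<le> g * (4 * L)" using g L j by (intro mult_left_mono) (auto simp: w_def)
    finally have "y \<le> \<epsilon> * (g * (4 * L))" unfolding y_def by (intro mult_left_mono \<epsilon>)
    also have "\<dots> = 4 * \<theta> * g" using L by (simp add: \<epsilon>_def)
    finally have y4: "y \<le> 4 * \<theta> * g" .
    have y0: "0 \<le> y" unfolding y_def using \<epsilon> j by (intro mult_nonneg_nonneg) auto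
    have "(s * g)\<^sup>2 / 2 \<le> exp (s * g)"
    proof -
      have "0 \<le> s * g" using s g by simp
      then show ?thesis using exp_lower_Taylor_quadratic[of "s * g"] by linarith
    qed
    then have gsq: "g\<^sup>2 \<le> 2 / s\<^sup>2 * exp (s * g)" using s by (simp add: field_simps power_mult_distrib)
    have "y\<^sup>2 * exp y \<le> (4 * \<theta> * g)\<^sup>2 * exp (s * g)"
    proof (intro mult_mono power_mono y4 y0)
      have "y \<le> s * g" using y4 mult_right_mono[OF \<theta>(2) g] by linarith
      then show "exp y \<le> exp (s * g)" by simp
    qed auto
    also have "\<dots> = 16 * \<theta>\<^sup>2 * g\<^sup>2 * exp (s * g)" by (simp add: power_mult_distrib)
    also have "\<dots> \<le> 16 * \<theta>\<^sup>2 * (2 / s\<^sup>2 * exp (s * g)) * exp (s * g)"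
      by (intro mult_right_mono mult_left_mono gsq) auto
    also have "\<dots> = c * E j"
      by (simp add: c_def E_def g_def w_def mult.assoc exp_add[symmetric] algebra_simps)
    finally show ?thesis using y0 by simp
  qed
  have EE: "gap_avg k E \<le> gap_mgf (2 * s)"
    unfolding E_def using \<theta> by (intro gap_avg_exp) auto
  have cE: "c * gap_avg k E \<le> D * \<theta>\<^sup>2"
    using mult_left_mono[OF EE c] by (simp add: c_def D_def field_simps)
  have "gap_avg k (\<lambda>u. exp (\<epsilon> * ((real u)\<^sup>2 - w\<^sup>2)))
      \<le> gap_avg k (\<lambda>u. (1 + (- \<epsilon> * w\<^sup>2)) + (\<epsilon> * (real u)\<^sup>2 + c * E u))"
  proof (rule gap_avg_mono)
    fix j assume j: "j \<le> k"
    define y where "y = \<epsilon> * (w\<^sup>2 - (real j)\<^sup>2)"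
    have "exp (\<epsilon> * ((real j)\<^sup>2 - w\<^sup>2)) = exp (- y)" by (simp add: y_def algebra_simps)
    also have "\<dots> \<le> 1 - y + c * E j" using exp_quadratic_bounds(2)[of y] bound[OF j y_def] by linarith
    finally show "exp (\<epsilon> * ((real j)\<^sup>2 - w\<^sup>2)) \<le> (1 + (- \<epsilon> * w\<^sup>2)) + (\<epsilon> * (real j)\<^sup>2 + c * E j)"
      by (simp add: y_def algebra_simps)
  qed
  also have "\<dots> = 1 - \<epsilon> * A + c * gap_avg k E"
    unfolding gap_avg_add gap_avg_mult gap_avg_const by (simp add: A_def w_def algebra_simps)
  finally show "gap_avg k (\<lambda>u. exp (\<epsilon> * ((real u)\<^sup>2 - (real (Suc k))\<^sup>2))) \<le> 1 - \<epsilon> * A + D * \<theta>\<^sup>2"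
    using cE unfolding w_def by linarith
  have "gap_avg k (\<lambda>u. exp (\<epsilon> * (w\<^sup>2 - (real u)\<^sup>2)))
      \<le> gap_avg k (\<lambda>u. (1 + \<epsilon> * w\<^sup>2) + (- \<epsilon> * (real u)\<^sup>2 + c * E u))"
  proof (rule gap_avg_mono)
    fix j assume j: "j \<le> k"
    define y where "y = \<epsilon> * (w\<^sup>2 - (real j)\<^sup>2)"
    have "exp (\<epsilon> * (w\<^sup>2 - (real j)\<^sup>2)) = exp y" by (simp add: y_def)
    also have "\<dots> \<le> 1 + y + c * E j" using exp_quadratic_bounds(1)[of y] bound[OF j y_def] by linarith
    finally show "exp (\<epsilon> * (w\<^sup>2 - (real j)\<^sup>2)) \<le> (1 + \<epsilon> * w\<^sup>2) + (- \<epsilon> * (real j)\<^sup>2 + c * E j)"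
      by (simp add: y_def algebra_simps)
  qed
  also have "\<dots> = 1 + \<epsilon> * A + c * gap_avg k E"
    unfolding gap_avg_add gap_avg_mult gap_avg_const by (simp add: A_def w_def algebra_simps)
  finally show "gap_avg k (\<lambda>u. exp (\<epsilon> * ((real (Suc k))\<^sup>2 - (real u)\<^sup>2))) \<le> 1 + \<epsilon> * A + D * \<theta>\<^sup>2"
    using cE unfolding w_def by linarith
qed

text \<open>
  The difference of the squared distances from the pile to its two barriers is almost a martingale;
  together with the total free room it controls the risk that one barrier reaches the pile.
\<close>

lemma square_difference_step:
  assumes \<theta>: "0 < \<theta>" "4 * \<theta> \<le> s" "(1 - q) * exp (2 * s) < 1"
    and L: "0 < L" "real (Suc k) \<le> 2 * L" "real (Suc l) \<le> 2 * L"
  defines "\<epsilon> \<equiv> \<theta> / L" and "D \<equiv> 32 * gap_mgf (2 * s) / s\<^sup>2"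
  shows "(real l + 1) * gap_avg k (\<lambda>u. exp (\<epsilon> * ((real u)\<^sup>2 - (real (Suc k))\<^sup>2)))
       + (real k + 1) * gap_avg l (\<lambda>v. exp (\<epsilon> * ((real (Suc l))\<^sup>2 - (real v)\<^sup>2)))
     \<le> (real k + real l + 2) * exp (D * \<theta>\<^sup>2 + \<epsilon> * (2 / q\<^sup>2))"
proof -
  define A where "A k = (real (Suc k))\<^sup>2 - gap_avg k (\<lambda>u. (real u)\<^sup>2)" for k
  define u where "u = real k + 1"
  define v where "v = real l + 1"
  have uv: "0 < u" "0 < v" by (auto simp: u_def v_def)
  have \<epsilon>: "0 \<le> \<epsilon>" using \<theta> L by (simp add: \<epsilon>_def)
  have "v * gap_avg k (\<lambda>u. exp (\<epsilon> * ((real u)\<^sup>2 - (real (Suc k))\<^sup>2))) \<le> v * (1 - \<epsilon> * A k + D * \<theta>\<^sup>2)"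
    unfolding \<epsilon>_def D_def A_def using uv by (intro mult_left_mono gap_avg_exp_square(1) \<theta> L) auto
  moreover have "u * gap_avg l (\<lambda>v. exp (\<epsilon> * ((real (Suc l))\<^sup>2 - (real v)\<^sup>2))) \<le> u * (1 + \<epsilon> * A l + D * \<theta>\<^sup>2)"
    unfolding \<epsilon>_def D_def A_def using uv by (intro mult_left_mono gap_avg_exp_square(2) \<theta> L) auto
  moreover have "v * (1 - \<epsilon> * A k + D * \<theta>\<^sup>2) \<le> v * (1 - \<epsilon> * (2 * u / q - 2 / q\<^sup>2) + D * \<theta>\<^sup>2)"
    using gap_avg_square(2)[of k] \<epsilon> uv
    by (intro mult_left_mono add_right_mono diff_left_mono) (auto simp: A_def u_def add.commute)
  moreover have "u * (1 + \<epsilon> * A l + D * \<theta>\<^sup>2) \<le> u * (1 + \<epsilon> * (2 * v / q) + D * \<theta>\<^sup>2)"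
    using gap_avg_square(1)[of l] \<epsilon> uv
    by (intro mult_left_mono add_right_mono add_left_mono) (auto simp: A_def v_def add.commute)
  \<comment> \<open>The cancellation: \<open>v * (2 * u / q)\<close> and
    \<open>u * (2 * v / q)\<close> enter with opposite signs, so no drift of first order in the
    distances is left.\<close>
  moreover have "v * (1 - \<epsilon> * (2 * u / q - 2 / q\<^sup>2) + D * \<theta>\<^sup>2) + u * (1 + \<epsilon> * (2 * v / q) + D * \<theta>\<^sup>2)
      = (u + v) * (1 + D * \<theta>\<^sup>2) + v * (\<epsilon> * (2 / q\<^sup>2))"
    by (simp add: algebra_simps)
  moreover have "v * (\<epsilon> * (2 / q\<^sup>2)) \<le> (u + v) * (\<epsilon> * (2 / q\<^sup>2))"
    using uv \<epsilon> by (intro mult_right_mono) auto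
  moreover have "(u + v) * (1 + D * \<theta>\<^sup>2) + (u + v) * (\<epsilon> * (2 / q\<^sup>2))
      = (u + v) * (1 + (D * \<theta>\<^sup>2 + \<epsilon> * (2 / q\<^sup>2)))"
    by (simp add: algebra_simps)
  moreover have "(u + v) * (1 + (D * \<theta>\<^sup>2 + \<epsilon> * (2 / q\<^sup>2))) \<le> (u + v) * exp (D * \<theta>\<^sup>2 + \<epsilon> * (2 / q\<^sup>2))"
    using uv by (intro mult_left_mono exp_ge_add_one_self) auto
  ultimately have "v * gap_avg k (\<lambda>u. exp (\<epsilon> * ((real u)\<^sup>2 - (real (Suc k))\<^sup>2)))
       + u * gap_avg l (\<lambda>v. exp (\<epsilon> * ((real (Suc l))\<^sup>2 - (real v)\<^sup>2)))
     \<le> (u + v) * exp (D * \<theta>\<^sup>2 + \<epsilon> * (2 / q\<^sup>2))"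
    by linarith
  moreover have "real k + real l + 2 = u + v" by (simp add: u_def v_def)
  ultimately show ?thesis by (simp only: u_def[symmetric] v_def[symmetric])
qed

text \<open>The mean advance 1 / q lies below \<kappa>, so near 0 the logarithm of
  \<open>gap_mgf\<close> grows with slope less than \<kappa>.\<close>

lemma gap_mgf_small:
  assumes \<kappa>: "1 < \<kappa> * q"
  shows "\<exists>\<theta>>0. (1 - q) * exp \<theta> < 1 \<and> gap_mgf \<theta> \<le> exp (\<theta> * \<kappa>)"
proof -
  \<comment> \<open>Chosen so that the second order terms, at most \<theta>^2 (1 + 2 \<kappa>), are
    covered by the first order gain \<theta> (\<kappa> q - 1).\<close>
  define \<theta> where "\<theta> = min 1 ((\<kappa> * q - 1) / (1 + 2 * \<kappa>))"
  have \<kappa>0: "0 < \<kappa>" using \<kappa> q01 by (metis less_trans zero_less_one zero_less_mult_pos2)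
  have \<theta>: "0 < \<theta>" "\<theta> \<le> 1" using \<kappa> \<kappa>0 by (auto simp: \<theta>_def)
  have "\<theta> \<le> (\<kappa> * q - 1) / (1 + 2 * \<kappa>)" by (simp add: \<theta>_def)
  then have "\<theta> * (1 + 2 * \<kappa>) \<le> \<kappa> * q - 1"
    using \<kappa>0 by (simp add: le_divide_eq)
  then have "\<theta> * (\<theta> * (1 + 2 * \<kappa>)) \<le> \<theta> * (\<kappa> * q - 1)" using \<theta> by (intro mult_left_mono) auto
  moreover have "(1 - q) * \<kappa> \<le> \<kappa>" "(1 - q) * \<kappa> * \<theta> \<le> \<kappa>"
    using q01 \<kappa>0 \<theta> mult_le_one[of "1 - q" \<theta>] by (auto simp: mult.commute mult.left_commute)
  then have "\<theta>\<^sup>2 * (1 + (1 - q) * \<kappa> + (1 - q) * \<kappa> * \<theta>) \<le> \<theta>\<^sup>2 * (1 + 2 * \<kappa>)"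
    by (intro mult_left_mono) auto
  moreover have "(1 + \<theta> + \<theta>\<^sup>2) * (1 + (1 - q) * \<kappa> * \<theta>)
      = 1 + \<theta> * (1 + (1 - q) * \<kappa>) + \<theta>\<^sup>2 * (1 + (1 - q) * \<kappa> + (1 - q) * \<kappa> * \<theta>)"
    by (simp add: algebra_simps power2_eq_square)
  moreover have "\<theta> * (1 + (1 - q) * \<kappa>) + \<theta> * (\<kappa> * q - 1) = \<kappa> * \<theta>"
    by (simp add: algebra_simps)
  moreover have "\<theta>\<^sup>2 * (1 + 2 * \<kappa>) = \<theta> * (\<theta> * (1 + 2 * \<kappa>))" by (simp add: power2_eq_square)
  ultimately have "(1 + \<theta> + \<theta>\<^sup>2) * (1 + (1 - q) * \<kappa> * \<theta>) \<le> 1 + \<kappa> * \<theta>" by linarith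
  moreover have "exp \<theta> * (1 + (1 - q) * \<kappa> * \<theta>) \<le> (1 + \<theta> + \<theta>\<^sup>2) * (1 + (1 - q) * \<kappa> * \<theta>)"
    using exp_bound[of \<theta>] \<theta> \<kappa>0 q01 by (intro mult_right_mono) auto
  ultimately have main: "exp \<theta> * (1 + (1 - q) * \<kappa> * \<theta>) \<le> 1 + \<kappa> * \<theta>" by linarith
  define z where "z = 1 + (1 - q) * \<kappa> * \<theta>"
  have z: "0 < z" unfolding z_def using q01 \<kappa>0 \<theta> by (intro add_pos_nonneg) auto
  have "(1 - q) * (exp \<theta> * z) \<le> (1 - q) * (1 + \<kappa> * \<theta>)"
    using main q01 unfolding z_def by (intro mult_left_mono) auto
  also have "\<dots> < z" using q01 by (simp add: z_def algebra_simps)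
  finally have "((1 - q) * exp \<theta>) * z < 1 * z" by (simp add: mult.assoc)
  then have r: "(1 - q) * exp \<theta> < 1" using z by (simp only: mult_less_cancel_right_pos)
  have "q * exp \<theta> \<le> (1 + \<kappa> * \<theta>) * (1 - (1 - q) * exp \<theta>)"
    using main by (simp add: algebra_simps)
  also have "\<dots> \<le> exp (\<theta> * \<kappa>) * (1 - (1 - q) * exp \<theta>)"
    using r exp_ge_add_one_self[of "\<theta> * \<kappa>"] by (intro mult_right_mono) (auto simp: mult.commute)
  finally have "gap_mgf \<theta> \<le> exp (\<theta> * \<kappa>)"
    using r by (simp add: gap_mgf_def divide_le_eq)
  with r \<theta> show ?thesis by blast
qed

text \<open>\<open>\<Psi> N u v\<close> bounds the probability that a barrier reaches a pile of
  \<open>N\<close> particles, with barriers at distances \<open>u\<close> and \<open>v\<close>,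
  before the pile is used up. It is at least 1 at ruin, it is a supermartingale for exits with
  gambler's ruin weights followed by a geometric advance, and it is exponentially small for a pile
  of density at most \<open>m\<close> at the middle of its block.\<close>

theorem block_potential_exists:
  assumes m: "0 < m" "m < q"
  shows "\<exists>K c. 0 < K \<and> 0 < c \<and> (\<forall>L::nat. 1 \<le> L \<longrightarrow> (\<exists>\<Psi> :: nat \<Rightarrow> nat \<Rightarrow> nat \<Rightarrow> real.
     (\<forall>N u v. 0 \<le> \<Psi> N u v) \<and>
     (\<forall>N u. 0 < u \<longrightarrow> 1 \<le> \<Psi> N 0 u \<and> 1 \<le> \<Psi> N u 0) \<and>
     (\<forall>N k l. k + l < L + 1 \<longrightarrow>
        (real l + 1) * gap_avg k (\<lambda>u. \<Psi> N u (Suc l)) + (real k + 1) * gap_avg l (\<lambda>v. \<Psi> N (Suc k) v)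
          \<le> (real k + real l + 2) * \<Psi> (Suc N) (Suc k) (Suc l)) \<and>
     (\<forall>N k l. real N \<le> m * real L \<longrightarrow> L \<le> k + l + 1 \<longrightarrow> k + l + 1 \<le> L + 1 \<longrightarrow> \<bar>real k - real l\<bar> \<le> 1 \<longrightarrow>
        \<Psi> N (Suc k) (Suc l) \<le> K * exp (- c * real L))))"
proof -
  \<comment> \<open>One particle advances a barrier by 1 / q on average, and a pile of m L particles
    can afford 1 / m each; \<kappa> lies halfway.\<close>
  define \<kappa> where "\<kappa> = (1 / q + 1 / m) / 2"
  have inv: "1 / q < 1 / m" using m by (simp add: frac_less2)
  have "1 / q < \<kappa>" "\<kappa> < 1 / m" using inv by (auto simp: \<kappa>_def)
  then have \<kappa>: "1 < \<kappa> * q" "\<kappa> * m < 1" using m q01 by (auto simp: field_simps)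
  have \<kappa>0: "0 < \<kappa>" using m q01 by (simp add: \<kappa>_def add_pos_pos)
  \<comment> \<open>A pile of at most m L particles spends at most \<kappa> m L of the room on its
    budget, so 2 \<delta> L of the initial L should remain.\<close>
  define \<delta> where "\<delta> = (1 - \<kappa> * m) / 2"
  have \<delta>: "0 < \<delta>" using \<kappa> by (simp add: \<delta>_def)
  obtain \<theta>1 where \<theta>1: "0 < \<theta>1" "(1 - q) * exp \<theta>1 < 1" "gap_mgf \<theta>1 \<le> exp (\<theta>1 * \<kappa>)"
    using gap_mgf_small[OF \<kappa>(1)] by blast
  define s where "s = \<theta>1 / 2"
  have s: "0 < s" "(1 - q) * exp (2 * s) < 1" using \<theta>1 by (auto simp: s_def)
  define D where "D = 32 * gap_mgf (2 * s) / s\<^sup>2"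
  have D: "0 < D" unfolding D_def gap_mgf_def using s q01 by auto
  \<comment> \<open>The first bound meets the requirement \<open>4 * \<theta> \<le> s\<close>. The
    second keeps the error D \<theta>^2 per particle, summed over at most L particles, below half of
    the exponent \<theta> \<delta>^2 L available at the start.\<close>
  define \<theta> where "\<theta> = min (s / 4) (\<delta>\<^sup>2 / (2 * D))"
  have \<theta>: "0 < \<theta>" "4 * \<theta> \<le> s" using s \<delta> D by (auto simp: \<theta>_def)
  have "\<theta> \<le> \<delta>\<^sup>2 / (2 * D)" by (simp add: \<theta>_def)
  then have "D * \<theta> \<le> \<delta>\<^sup>2 / 2" using D by (simp add: field_simps)
  then have D\<theta>: "D * \<theta>\<^sup>2 \<le> \<theta> * \<delta>\<^sup>2 / 2"
    using mult_left_mono[of "D * \<theta>" "\<delta>\<^sup>2 / 2" \<theta>] \<theta> by (simp add: power2_eq_square mult_ac)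
  define c1 where "c1 = 2 / q\<^sup>2"
  have c1: "0 \<le> c1" by (simp add: c1_def)
  define K where "K = 1 + 2 * exp (\<theta> * (3 + c1))"
  define c where "c = min (\<theta>1 * \<delta>) (\<theta> * \<delta>\<^sup>2 / 2)"
  have "0 < K" by (simp add: K_def add_pos_pos)
  moreover have "0 < c" using \<theta>1 \<theta> \<delta> by (simp add: c_def)
  moreover have "\<exists>\<Psi> :: nat \<Rightarrow> nat \<Rightarrow> nat \<Rightarrow> real.
     (\<forall>N u v. 0 \<le> \<Psi> N u v) \<and>
     (\<forall>N u. 0 < u \<longrightarrow> 1 \<le> \<Psi> N 0 u \<and> 1 \<le> \<Psi> N u 0) \<and>
     (\<forall>N k l. k + l < L + 1 \<longrightarrow>
        (real l + 1) * gap_avg k (\<lambda>u. \<Psi> N u (Suc l)) + (real k + 1) * gap_avg l (\<lambda>v. \<Psi> N (Suc k) v)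
          \<le> (real k + real l + 2) * \<Psi> (Suc N) (Suc k) (Suc l)) \<and>
     (\<forall>N k l. real N \<le> m * real L \<longrightarrow> L \<le> k + l + 1 \<longrightarrow> k + l + 1 \<le> L + 1 \<longrightarrow> \<bar>real k - real l\<bar> \<le> 1 \<longrightarrow>
        \<Psi> N (Suc k) (Suc l) \<le> K * exp (- c * real L))" if L: "1 \<le> L" for L :: nat
  proof -
    define \<epsilon> where "\<epsilon> = \<theta> / real L"
    have \<epsilon>: "0 < \<epsilon>" using \<theta> L by (simp add: \<epsilon>_def)
    define \<tau> where "\<tau> = D * \<theta>\<^sup>2 + \<epsilon> * c1"
    have \<tau>: "0 \<le> \<tau>" using D \<epsilon> c1 by (simp add: \<tau>_def)
    \<comment> \<open>\<open>\<Psi>1\<close> is large when the total room u + v falls short of the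
      budget; \<open>\<Psi>2\<close>, used in both orders of \<open>u\<close> and \<open>v\<close>,
      is large when the squared distances have become unequal.\<close>
    define \<Psi>1 :: "nat \<Rightarrow> nat \<Rightarrow> nat \<Rightarrow> real" where
      "\<Psi>1 N u v = exp (\<theta>1 * (\<kappa> * real N + \<delta> * real L - real u - real v))" for N u v
    define \<Psi>2 :: "nat \<Rightarrow> nat \<Rightarrow> nat \<Rightarrow> real" where
      "\<Psi>2 N u v = exp (\<epsilon> * ((real u)\<^sup>2 - (real v)\<^sup>2) + \<tau> * real N - \<theta> * \<delta>\<^sup>2 * real L)" for N u v
    define \<Psi> where "\<Psi> N u v = \<Psi>1 N u v + (\<Psi>2 N u v + \<Psi>2 N v u)" for N u v
    have b1: "1 \<le> \<Psi> N 0 u" if "0 < u" for N u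
    \<comment> \<open>Ruin on one side leaves two possibilities: the other barrier is within
      \<delta> L, so too much room was spent, or it is farther away, so the squares differ by more
      than (\<delta> L)^2.\<close>
    proof (cases "real u \<le> \<delta> * real L")
      case True
      moreover have "0 \<le> \<kappa> * real N" using \<kappa>0 by simp
      ultimately have "0 \<le> \<kappa> * real N + \<delta> * real L - real u" by linarith
      then have "1 \<le> \<Psi>1 N 0 u" using \<theta>1 by (simp add: \<Psi>1_def)
      then show ?thesis unfolding \<Psi>_def by (intro add_increasing2) (auto simp: \<Psi>2_def)
    next
      case False
      have "\<theta> * \<delta>\<^sup>2 * real L = \<epsilon> * (\<delta> * real L)\<^sup>2"
        using L by (simp add: \<epsilon>_def power2_eq_square)
      also have "\<dots> \<le> \<epsilon> * (real u)\<^sup>2"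
        using False \<epsilon> \<delta> by (intro mult_left_mono power_mono) auto
      finally have "1 \<le> \<Psi>2 N u 0" using \<tau> by (simp add: \<Psi>2_def add_increasing2)
      then show ?thesis unfolding \<Psi>_def by (intro add_increasing) (auto simp: \<Psi>2_def \<Psi>1_def)
    qed
    have sym: "\<Psi> N u v = \<Psi> N v u" for N u v
      by (simp add: \<Psi>_def \<Psi>1_def algebra_simps)
    have e1: "gap_avg k (\<lambda>u. \<Psi>1 N u (Suc l)) \<le> \<Psi>1 (Suc N) (Suc k) (Suc l)" for N k l
    proof -
      define a where "a = exp (\<theta>1 * (\<kappa> * real N + \<delta> * real L - real (Suc k) - real (Suc l)))"
      have "(\<lambda>u. \<Psi>1 N u (Suc l)) = (\<lambda>u. a * exp (\<theta>1 * (real (Suc k) - real u)))"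
        by (auto simp: \<Psi>1_def a_def exp_add[symmetric] algebra_simps)
      then have "gap_avg k (\<lambda>u. \<Psi>1 N u (Suc l)) = a * gap_avg k (\<lambda>u. exp (\<theta>1 * (real (Suc k) - real u)))"
        by (simp only: gap_avg_mult)
      also have "\<dots> \<le> a * exp (\<theta>1 * \<kappa>)"
        using gap_avg_exp[of \<theta>1 k] \<theta>1 by (intro mult_left_mono) (auto simp: a_def)
      also have "\<dots> = \<Psi>1 (Suc N) (Suc k) (Suc l)"
        by (simp add: \<Psi>1_def a_def exp_add[symmetric] algebra_simps)
      finally show ?thesis .
    qed
    have e1': "gap_avg l (\<lambda>v. \<Psi>1 N (Suc k) v) \<le> \<Psi>1 (Suc N) (Suc k) (Suc l)" for N k l
      using e1[of l N k] by (simp add: \<Psi>1_def algebra_simps)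
    have step1: "(real l + 1) * gap_avg k (\<lambda>u. \<Psi>1 N u (Suc l)) + (real k + 1) * gap_avg l (\<lambda>v. \<Psi>1 N (Suc k) v)
          \<le> (real k + real l + 2) * \<Psi>1 (Suc N) (Suc k) (Suc l)" for N k l
    proof -
      have "(real l + 1) * gap_avg k (\<lambda>u. \<Psi>1 N u (Suc l)) \<le> (real l + 1) * \<Psi>1 (Suc N) (Suc k) (Suc l)"
        "(real k + 1) * gap_avg l (\<lambda>v. \<Psi>1 N (Suc k) v) \<le> (real k + 1) * \<Psi>1 (Suc N) (Suc k) (Suc l)"
        by (auto intro!: mult_left_mono e1 e1')
      then show ?thesis by (simp add: algebra_simps)
    qed
    have step2: "(real l + 1) * gap_avg k (\<lambda>u. \<Psi>2 N u (Suc l)) + (real k + 1) * gap_avg l (\<lambda>v. \<Psi>2 N (Suc k) v)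
          \<le> (real k + real l + 2) * \<Psi>2 (Suc N) (Suc k) (Suc l)" if kl: "k + l < L + 1" for N k l
    proof -
      define a where "a = exp (\<epsilon> * ((real (Suc k))\<^sup>2 - (real (Suc l))\<^sup>2) + \<tau> * real N - \<theta> * \<delta>\<^sup>2 * real L)"
      have "(\<lambda>u. \<Psi>2 N u (Suc l)) = (\<lambda>u. a * exp (\<epsilon> * ((real u)\<^sup>2 - (real (Suc k))\<^sup>2)))"
        "(\<lambda>v. \<Psi>2 N (Suc k) v) = (\<lambda>v. a * exp (\<epsilon> * ((real (Suc l))\<^sup>2 - (real v)\<^sup>2)))"
        by (auto simp: \<Psi>2_def a_def exp_add[symmetric] algebra_simps)
      then have "(real l + 1) * gap_avg k (\<lambda>u. \<Psi>2 N u (Suc l)) + (real k + 1) * gap_avg l (\<lambda>v. \<Psi>2 N (Suc k) v)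
         = a * ((real l + 1) * gap_avg k (\<lambda>u. exp (\<epsilon> * ((real u)\<^sup>2 - (real (Suc k))\<^sup>2)))
            + (real k + 1) * gap_avg l (\<lambda>v. exp (\<epsilon> * ((real (Suc l))\<^sup>2 - (real v)\<^sup>2))))"
        by (simp only: gap_avg_mult) (simp only: distrib_left mult.left_commute)
      also have "\<dots> \<le> a * ((real k + real l + 2) * exp \<tau>)"
        unfolding \<epsilon>_def \<tau>_def D_def c1_def
        using kl L by (intro mult_left_mono square_difference_step \<theta> s) (auto simp: a_def)
      also have "\<dots> = (real k + real l + 2) * \<Psi>2 (Suc N) (Suc k) (Suc l)"
        by (simp add: \<Psi>2_def a_def exp_add[symmetric] algebra_simps)
      finally show ?thesis .
    qed
    have step: "(real l + 1) * gap_avg k (\<lambda>u. \<Psi> N u (Suc l)) + (real k + 1) * gap_avg l (\<lambda>v. \<Psi> N (Suc k) v)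
          \<le> (real k + real l + 2) * \<Psi> (Suc N) (Suc k) (Suc l)" if kl: "k + l < L + 1" for N k l
    proof -
      have "l + k < L + 1" using kl by simp
      from step1[of l k N] step2[OF kl, of N] step2[OF this, of N] show ?thesis
        unfolding \<Psi>_def gap_avg_add by (simp add: algebra_simps)
    qed
    have start: "\<Psi> N (Suc k) (Suc l) \<le> K * exp (- c * real L)"
      if N: "real N \<le> m * real L" and kl: "L \<le> k + l + 1" "k + l + 1 \<le> L + 1" "\<bar>real k - real l\<bar> \<le> 1" for N k l
    proof -
      have "real L \<le> real k + real l + 1" using kl(1) by linarith
      moreover have "\<kappa> * real N \<le> \<kappa> * (m * real L)" using N \<kappa>0 by (intro mult_left_mono) auto
      moreover have "\<kappa> * (m * real L) + \<delta> * real L - real L = - \<delta> * real L"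
        by (simp add: \<delta>_def field_simps)
      ultimately have "\<kappa> * real N + \<delta> * real L - real (Suc k) - real (Suc l) \<le> - \<delta> * real L" by simp
      then have "\<theta>1 * (\<kappa> * real N + \<delta> * real L - real (Suc k) - real (Suc l)) \<le> \<theta>1 * (- \<delta> * real L)"
        using \<theta>1 by (intro mult_left_mono) auto
      also have "\<dots> \<le> - c * real L"
        using mult_right_mono[of c "\<theta>1 * \<delta>" "real L"] by (simp add: c_def)
      finally have p1: "\<Psi>1 N (Suc k) (Suc l) \<le> exp (- c * real L)" by (simp add: \<Psi>1_def)
      have p2: "\<Psi>2 N (Suc a) (Suc b) \<le> exp (\<theta> * (3 + c1)) * exp (- c * real L)"
        if ab: "a + b + 1 \<le> L + 1" "\<bar>real a - real b\<bar> \<le> 1" for a b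
      proof -
        have "(real (Suc a))\<^sup>2 - (real (Suc b))\<^sup>2 = (real a - real b) * (real a + real b + 2)"
          by (simp add: power2_eq_square algebra_simps)
        also have "\<dots> \<le> 1 * (real a + real b + 2)" using ab(2) by (intro mult_right_mono) auto
        also have "\<dots> \<le> 3 * real L" using ab(1) L by simp
        finally have "\<epsilon> * ((real (Suc a))\<^sup>2 - (real (Suc b))\<^sup>2) \<le> \<epsilon> * (3 * real L)"
          using \<epsilon> by (intro mult_left_mono) auto
        also have "\<dots> = 3 * \<theta>" using L by (simp add: \<epsilon>_def)
        finally have 1: "\<epsilon> * ((real (Suc a))\<^sup>2 - (real (Suc b))\<^sup>2) \<le> 3 * \<theta>" .
        have "m * real L \<le> 1 * real L" using m q01 by (intro mult_right_mono) auto
        then have "real N \<le> real L" using N by linarith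
        then have "\<tau> * real N \<le> \<tau> * real L" using \<tau> by (intro mult_left_mono)
        also have "\<dots> = D * \<theta>\<^sup>2 * real L + \<theta> * c1" using L by (simp add: \<tau>_def \<epsilon>_def field_simps)
        also have "\<dots> \<le> \<theta> * \<delta>\<^sup>2 / 2 * real L + \<theta> * c1"
          by (intro add_right_mono mult_right_mono D\<theta>) auto
        finally have 2: "\<tau> * real N \<le> \<theta> * \<delta>\<^sup>2 / 2 * real L + \<theta> * c1" .
        have 3: "c * real L \<le> \<theta> * \<delta>\<^sup>2 / 2 * real L" by (intro mult_right_mono) (auto simp: c_def)
        have 4: "\<theta> * \<delta>\<^sup>2 * real L = 2 * (\<theta> * \<delta>\<^sup>2 / 2 * real L)" by simp
        have 5: "\<theta> * (3 + c1) = 3 * \<theta> + \<theta> * c1" by (simp add: algebra_simps)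
        have "\<epsilon> * ((real (Suc a))\<^sup>2 - (real (Suc b))\<^sup>2) + \<tau> * real N - \<theta> * \<delta>\<^sup>2 * real L
            \<le> \<theta> * (3 + c1) + (- c * real L)"
          unfolding 4 5 using 1 2 3 by simp
        then show ?thesis unfolding \<Psi>2_def exp_add[symmetric] by simp
      qed
      have "\<Psi> N (Suc k) (Suc l) \<le> exp (- c * real L) + (exp (\<theta> * (3 + c1)) * exp (- c * real L)
          + exp (\<theta> * (3 + c1)) * exp (- c * real L))"
        unfolding \<Psi>_def using kl by (intro add_mono p1 p2) (auto simp: abs_minus_commute)
      then show ?thesis by (simp add: K_def algebra_simps)
    qed
    have "0 \<le> \<Psi> N u v" for N u v by (simp add: \<Psi>_def \<Psi>1_def \<Psi>2_def)
    with b1 sym step start show ?thesis by (intro exI[of _ \<Psi>]) metis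
  qed
  ultimately show ?thesis by blast
qed

end

section \<open>The Abelian property\<close>

datatype instr = Slp | Rgt | Lft

type_synonym queue = "nat \<Rightarrow> instr list"

definition active :: "nat \<Rightarrow> nat \<Rightarrow> config \<Rightarrow> bool" where
  "active n x \<eta> \<longleftrightarrow> x < n \<and> 0 < num_active (\<eta> x)"

lemma all_asleep_iff: "all_asleep n \<eta> \<longleftrightarrow> (\<forall>x. \<not> active n x \<eta>)"
  unfolding all_asleep_def active_particles_def active_def by auto

lemma activeD: "active n x \<eta> \<Longrightarrow> \<exists>k. \<eta> x = Active (Suc k)"
  unfolding active_def by (cases "\<eta> x") (auto simp: gr0_conv_Suc)

text \<open>Setting the destination of a sleep instruction to \<open>x\<close> itself lets one
  average over all three instructions describe a lazy walk.\<close>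

fun dest :: "nat \<Rightarrow> nat \<Rightarrow> instr \<Rightarrow> nat" where
  "dest n x Rgt = (x + 1) mod n"
| "dest n x Lft = (x + n - 1) mod n"
| "dest n x Slp = x"

definition exec :: "nat \<Rightarrow> instr \<Rightarrow> nat \<Rightarrow> config \<Rightarrow> config" where
  "exec n i x \<eta> = (if i = Slp then try_sleep x \<eta> else jump x (dest n x i) \<eta>)"

locale arw_cycle = sleep_rate +
  fixes n :: nat
  assumes n2: "2 \<le> n"
begin

definition avg :: "(instr \<Rightarrow> real) \<Rightarrow> real" where
  "avg F = q * F Slp + (1 - q) / 2 * F Rgt + (1 - q) / 2 * F Lft"

text \<open>An instruction is averaged only if none is revealed at the site; otherwise the oldest
  revealed one is used up. The continuation \<open>F\<close> sees the remaining queues, so that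
  instructions revealed ahead of time are remembered.\<close>

definition topple :: "(nat \<Rightarrow> instr \<Rightarrow> bool) \<Rightarrow> nat \<Rightarrow> (config \<Rightarrow> queue \<Rightarrow> real) \<Rightarrow> config \<Rightarrow> queue \<Rightarrow> real" where
  "topple forb x F \<eta> Q =
     (let G = (\<lambda>i Q'. if forb x i then 0 else F (exec n i x \<eta>) Q')
      in case Q x of [] \<Rightarrow> avg (\<lambda>i. G i Q) | i # is \<Rightarrow> G i (Q(x := is)))"

text \<open>
  \<open>val forb m \<eta> Q\<close> is the probability that \<open>\<eta>\<close> stabilises within \<open>m\<close> topplings, when \<open>Q x\<close> lists the
  instructions at \<open>x\<close> that are already revealed. Executing a forbidden instruction counts as failure.
\<close>

primrec val :: "(nat \<Rightarrow> instr \<Rightarrow> bool) \<Rightarrow> nat \<Rightarrow> config \<Rightarrow> queue \<Rightarrow> real" where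
  "val forb 0 \<eta> Q = of_bool (all_asleep n \<eta>)"
| "val forb (Suc m) \<eta> Q =
     (if all_asleep n \<eta> then 1 else topple forb (SOME x. active n x \<eta>) (val forb m) \<eta> Q)"

lemma avg_mono: "(\<And>i. F i \<le> G i) \<Longrightarrow> avg F \<le> avg G"
  unfolding avg_def using q01 by (intro add_mono mult_left_mono) auto

lemma avg_const [simp]: "avg (\<lambda>_. c) = c"
  unfolding avg_def by (simp add: field_simps)

lemma avg_swap: "avg (\<lambda>i. avg (\<lambda>j. F i j)) = avg (\<lambda>j. avg (\<lambda>i. F i j))"
  unfolding avg_def by (simp add: algebra_simps)

lemma avg_add: "avg (\<lambda>i. F i + G i) = avg F + avg G"
  unfolding avg_def by (simp add: field_simps)

lemma avg_mult: "avg (\<lambda>i. c * F i) = c * avg F"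
  unfolding avg_def by (simp add: algebra_simps)

lemma dest_neq: "x < n \<Longrightarrow> i \<noteq> Slp \<Longrightarrow> dest n x i \<noteq> x"
proof (cases i)
  case Rgt
  assume "x < n"
  with n2 show ?thesis unfolding Rgt by (cases "Suc x = n") auto
next
  case Lft
  assume x: "x < n"
  show ?thesis
  proof (cases "x = 0")
    case True
    with n2 Lft show ?thesis by simp
  next
    case False
    then have "x + n - 1 = (x - 1) + n" by simp
    then have "(x + n - 1) mod n = x - 1"
      using x by (metis mod_add_self2 mod_less less_imp_diff_less)
    with False Lft show ?thesis by simp
  qed
qed simp

lemma dest_less: "x < n \<Longrightarrow> dest n x i < n"
  using n2 by (cases i) auto

lemma exec_other_active:
  assumes "active n y \<eta>" "x \<noteq> y"
  shows "active n y (exec n i x \<eta>)"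
  using assms activeD[OF assms(1)]
  by (auto simp: active_def exec_def try_sleep_def jump_def Let_def)

text \<open>The delicate case is a jump onto a site with a single particle that has a sleep
  instruction. Either the particle falls asleep and is woken by the newcomer, or its attempt fails
  because of the newcomer; both orders end in \<open>Active 2\<close>.\<close>

lemma exec_commute:
  assumes x: "active n x \<eta>" and y: "active n y \<eta>" and xy: "x \<noteq> y"
  shows "exec n i x (exec n j y \<eta>) = exec n j y (exec n i x \<eta>)"
proof -
  obtain k where k: "\<eta> x = Active (Suc k)" using activeD[OF x] by auto
  obtain l where l: "\<eta> y = Active (Suc l)" using activeD[OF y] by auto
  have xn: "x < n" "y < n" using x y by (auto simp: active_def)
  have di: "i \<noteq> Slp \<Longrightarrow> dest n x i \<noteq> x" and dj: "j \<noteq> Slp \<Longrightarrow> dest n y j \<noteq> y"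
    using xn dest_neq by auto
  define a where "a = dest n x i"
  define b where "b = dest n y j"
  consider "i = Slp" "j = Slp" | "i = Slp" "j \<noteq> Slp" | "i \<noteq> Slp" "j = Slp" | "i \<noteq> Slp" "j \<noteq> Slp"
    by blast
  then show ?thesis
  proof cases
    case 1
    then show ?thesis using xy by (auto simp: exec_def try_sleep_def fun_upd_twist)
  next
    case 2
    then show ?thesis using xy k l dj unfolding exec_def jump_def try_sleep_def
      by (auto simp: Let_def fun_eq_iff)
  next
    case 3
    then show ?thesis using xy k l di unfolding exec_def jump_def try_sleep_def
      by (auto simp: Let_def fun_eq_iff)
  next
    case 4
    then have "a \<noteq> x" "b \<noteq> y" using di dj by (auto simp: a_def b_def)
    then show ?thesis using 4 xy k l unfolding exec_def jump_def a_def[symmetric] b_def[symmetric]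
      by (auto simp: Let_def fun_eq_iff)
  qed
qed

lemma topple_Nil:
  "Q x = [] \<Longrightarrow> topple f x F \<eta> Q = avg (\<lambda>i. if f x i then 0 else F (exec n i x \<eta>) Q)"
  by (simp add: topple_def)

lemma topple_Cons:
  "Q x = i # is \<Longrightarrow> topple f x F \<eta> Q = (if f x i then 0 else F (exec n i x \<eta>) (Q(x := is)))"
  by (simp add: topple_def)

lemma if_avg: "(if b then 0 else avg g) = avg (\<lambda>j. if b then 0 else g j)"
  by simp

lemma topple_commute:
  assumes x: "active n x \<eta>" and y: "active n y \<eta>" and xy: "x \<noteq> y"
  shows "topple f x (topple f y F) \<eta> Q = topple f y (topple f x F) \<eta> Q"
proof (cases "Q x")
  case Nil
  note Qx = Nil
  show ?thesis
  proof (cases "Q y")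
    case Nil
    have 1: "topple f x (topple f y F) \<eta> Q
        = avg (\<lambda>i. avg (\<lambda>j. if f x i then 0 else if f y j then 0 else F (exec n j y (exec n i x \<eta>)) Q))"
      unfolding topple_Nil[where x = x and Q = Q, OF Qx] topple_Nil[where x = y and Q = Q, OF Nil] if_avg ..
    have 2: "topple f y (topple f x F) \<eta> Q
        = avg (\<lambda>j. avg (\<lambda>i. if f y j then 0 else if f x i then 0 else F (exec n i x (exec n j y \<eta>)) Q))"
      unfolding topple_Nil[where x = x and Q = Q, OF Qx] topple_Nil[where x = y and Q = Q, OF Nil] if_avg ..
    have "(if f x i then 0 else if f y j then 0 else F (exec n j y (exec n i x \<eta>)) Q)
        = (if f y j then 0 else if f x i then 0 else F (exec n i x (exec n j y \<eta>)) Q)" for i j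
      by (simp add: exec_commute[OF x y xy])
    then show ?thesis unfolding 1 2 using avg_swap by simp
  next
    case (Cons j js)
    have Q': "(Q(y := js)) x = []" using Qx xy by simp
    have 1: "topple f x (topple f y F) \<eta> Q
        = avg (\<lambda>i. if f x i then 0 else if f y j then 0 else F (exec n j y (exec n i x \<eta>)) (Q(y := js)))"
      unfolding topple_Nil[where x = x and Q = Q, OF Qx] topple_Cons[where x = y and Q = Q, OF Cons] ..
    have 2: "topple f y (topple f x F) \<eta> Q
        = avg (\<lambda>i. if f y j then 0 else if f x i then 0 else F (exec n i x (exec n j y \<eta>)) (Q(y := js)))"
      unfolding topple_Cons[where x = y and Q = Q, OF Cons] topple_Nil[where x = x and Q = "Q(y := js)", OF Q'] if_avg ..
    show ?thesis unfolding 1 2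
      by (rule arg_cong[of _ _ avg], rule ext) (simp add: exec_commute[OF x y xy])
  qed
next
  case (Cons i "is")
  note Qx = Cons
  show ?thesis
  proof (cases "Q y")
    case Nil
    have Q': "(Q(x := is)) y = []" using Nil xy by simp
    have 1: "topple f y (topple f x F) \<eta> Q
        = avg (\<lambda>j. if f y j then 0 else if f x i then 0 else F (exec n i x (exec n j y \<eta>)) (Q(x := is)))"
      unfolding topple_Nil[where x = y and Q = Q, OF Nil] topple_Cons[where x = x and Q = Q, OF Qx] ..
    have 2: "topple f x (topple f y F) \<eta> Q
        = avg (\<lambda>j. if f x i then 0 else if f y j then 0 else F (exec n j y (exec n i x \<eta>)) (Q(x := is)))"
      unfolding topple_Cons[where x = x and Q = Q, OF Qx] topple_Nil[where x = y and Q = "Q(x := is)", OF Q'] if_avg ..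
    show ?thesis unfolding 1 2
      by (rule arg_cong[of _ _ avg], rule ext) (simp add: exec_commute[OF x y xy])
  next
    case (Cons j js)
    have Q': "(Q(x := is)) y = j # js" "(Q(y := js)) x = i # is" using Cons Qx xy by auto
    show ?thesis
      unfolding topple_Cons[where x = x and Q = Q, OF Qx] topple_Cons[where x = y and Q = Q, OF Cons]
        topple_Cons[where x = y and Q = "Q(x := is)", OF Q'(1)] topple_Cons[where x = x and Q = "Q(y := js)", OF Q'(2)]
      using xy by (simp add: exec_commute[OF x y xy] fun_upd_twist[of x y])
  qed
qed

lemma topple_cong:
  assumes "\<And>i Q'. F (exec n i x \<eta>) Q' = G (exec n i x \<eta>) Q'"
  shows "topple f x F \<eta> Q = topple f x G \<eta> Q"
  unfolding topple_def Let_def by (auto split: list.split simp: avg_def assms)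

lemma topple_mono:
  assumes "\<And>i Q'. F (exec n i x \<eta>) Q' \<le> G (exec n i x \<eta>) Q'"
  shows "topple f x F \<eta> Q \<le> topple f x G \<eta> Q"
  unfolding topple_def Let_def using assms by (auto split: list.split intro!: avg_mono)

lemma topple_const0: "topple f x (\<lambda>_ _. 0) \<eta> Q = 0"
  unfolding topple_def Let_def by (auto split: list.split)

lemma some_active: "\<not> all_asleep n \<eta> \<Longrightarrow> active n (SOME x. active n x \<eta>) \<eta>"
  unfolding all_asleep_iff by (auto intro: someI)

text \<open>An active site stays active when another one is toppled. By induction the second
  toppling may therefore be placed at the competing site, and then the two orders agree by
  \<open>topple_commute\<close>. With no toppling left afterwards both sides vanish, for the other
  site is still active.\<close>

theorem val_topple:
  assumes "active n x \<eta>"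
  shows "val f (Suc m) \<eta> Q = topple f x (val f m) \<eta> Q"
proof -
  have eq: "topple f x (val f m) \<eta> Q = topple f y (val f m) \<eta> Q"
    if "active n x \<eta>" "active n y \<eta>" for x y
    using that
  proof (induction m arbitrary: x y \<eta> Q)
    case 0
    show ?case
    proof (cases "x = y")
      case False
      have "topple f x (val f 0) \<eta> Q = topple f x (\<lambda>_ _. 0) \<eta> Q"
        using exec_other_active[OF 0(2) False] by (intro topple_cong) (auto simp: all_asleep_iff)
      moreover have "topple f y (val f 0) \<eta> Q = topple f y (\<lambda>_ _. 0) \<eta> Q"
        using exec_other_active[OF 0(1) False[symmetric]] by (intro topple_cong) (auto simp: all_asleep_iff)
      ultimately show ?thesis by (simp only: topple_const0)
    qed simp
  next
    case (Suc m)
    show ?case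
    proof (cases "x = y")
      case False
      have step: "val f (Suc m) \<xi> Q' = topple f z (val f m) \<xi> Q'" if "active n z \<xi>" for z \<xi> Q'
      proof -
        have "\<not> all_asleep n \<xi>" using that by (auto simp: all_asleep_iff)
        then show ?thesis using Suc.IH[OF some_active that] by simp
      qed
      have "topple f x (val f (Suc m)) \<eta> Q = topple f x (topple f y (val f m)) \<eta> Q"
        by (intro topple_cong step exec_other_active Suc.prems False)
      also have "\<dots> = topple f y (topple f x (val f m)) \<eta> Q"
        by (rule topple_commute[OF Suc.prems False])
      also have "\<dots> = topple f y (val f (Suc m)) \<eta> Q"
        using False by (intro topple_cong step[symmetric] exec_other_active Suc.prems) auto
      finally show ?thesis .
    qed simp
  qed
  have "\<not> all_asleep n \<eta>" using assms by (auto simp: all_asleep_iff)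
  with eq[OF some_active assms] show ?thesis by simp
qed

lemma val_stable [simp]: "all_asleep n \<eta> \<Longrightarrow> val f m \<eta> Q = 1"
  by (cases m) auto

lemma val_bounds: "0 \<le> val f m \<eta> Q" "val f m \<eta> Q \<le> 1"
proof -
  have "0 \<le> val f m \<eta> Q \<and> val f m \<eta> Q \<le> 1"
  proof (induction m arbitrary: \<eta> Q)
    case (Suc m)
    show ?case
    proof (cases "all_asleep n \<eta>")
      case False
      define x where "x = (SOME x. active n x \<eta>)"
      have "topple f x (\<lambda>_ _. 0) \<eta> Q \<le> topple f x (val f m) \<eta> Q"
        using Suc by (intro topple_mono) auto
      moreover have "topple f x (val f m) \<eta> Q \<le> topple f x (\<lambda>_ _. 1) \<eta> Q"
        using Suc by (intro topple_mono) auto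
      moreover have "avg (\<lambda>i. if f x i then 0 else 1) \<le> avg (\<lambda>_. 1)"
        by (rule avg_mono) auto
      then have "topple f x (\<lambda>_ _. 1) \<eta> Q \<le> 1"
        by (auto simp: topple_def Let_def split: list.split)
      ultimately show ?thesis using False by (simp add: x_def[symmetric] topple_const0)
    qed simp
  qed auto
  then show "0 \<le> val f m \<eta> Q" "val f m \<eta> Q \<le> 1" by auto
qed

lemma val_mono: "val f m \<eta> Q \<le> val f (Suc m) \<eta> Q"
proof (induction m arbitrary: \<eta> Q)
  case 0
  show ?case using val_bounds[of f "Suc 0" \<eta> Q] by (cases "all_asleep n \<eta>") (auto simp del: val.simps(2))
next
  case (Suc m)
  show ?case
  proof (cases "all_asleep n \<eta>")
    case False
    then obtain x where x: "active n x \<eta>" by (auto simp: all_asleep_iff)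
    show ?thesis unfolding val_topple[OF x] by (rule topple_mono) (rule Suc.IH)
  qed simp
qed

lemma val_forb_mono:
  assumes "\<And>x i. f x i \<Longrightarrow> g x i"
  shows "val g m \<eta> Q \<le> val f m \<eta> Q"
proof (induction m arbitrary: \<eta> Q)
  case (Suc m)
  have "topple g x (val g m) \<eta> Q \<le> topple f x (val f m) \<eta> Q" for x
    unfolding topple_def Let_def using Suc assms val_bounds
    by (auto split: list.split intro!: avg_mono)
  then show ?case by simp
qed auto

text \<open>Looking at the next unrevealed instruction of a site without executing it is harmless on
  average: it is either used later, in the same position of the stack, or never. This is what allows
  stopping rules that look into the future.\<close>

theorem val_tower: "val f m \<eta> Q = avg (\<lambda>i. val f m \<eta> (Q(x := Q x @ [i])))"
proof (induction m arbitrary: \<eta> Q)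
  case (Suc m)
  show ?case
  proof (cases "all_asleep n \<eta>")
    case False
    define z where "z = (SOME x. active n x \<eta>)"
    have 1: "val f (Suc m) \<eta> Q' = topple f z (val f m) \<eta> Q'" for Q'
      using False by (simp add: z_def)
    show ?thesis
    proof (cases "z = x")
      case True
      show ?thesis
      proof (cases "Q x")
        case Nil
        then show ?thesis unfolding 1 True by (simp add: topple_def Let_def fun_upd_idem)
      next
        case (Cons j js)
        have "topple f x (val f m) \<eta> (Q(x := Q x @ [i]))
            = (if f x j then 0 else val f m (exec n j x \<eta>) (Q(x := js @ [i])))" for i
          using topple_Cons[of "Q(x := Q x @ [i])" x j "js @ [i]"] Cons by simp
        moreover have "topple f x (val f m) \<eta> Q
            = (if f x j then 0 else avg (\<lambda>i. val f m (exec n j x \<eta>) (Q(x := js @ [i]))))"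
          unfolding topple_Cons[where x = x and Q = Q, OF Cons]
          by (subst Suc[of "exec n j x \<eta>" "Q(x := js)"]) (simp only: fun_upd_upd fun_upd_same)
        ultimately show ?thesis unfolding 1 True by simp
      qed
    next
      case False
      have "topple f z (val f m) \<eta> Q
          = topple f z (\<lambda>\<eta> Q. avg (\<lambda>i. val f m \<eta> (Q(x := Q x @ [i])))) \<eta> Q"
        by (intro topple_cong Suc)
      also have "\<dots> = avg (\<lambda>i. topple f z (val f m) \<eta> (Q(x := Q x @ [i])))"
      proof (cases "Q z")
        case Nil
        have 2: "topple f z (val f m) \<eta> (Q(x := Q x @ [i]))
            = avg (\<lambda>j. if f z j then 0 else val f m (exec n j z \<eta>) (Q(x := Q x @ [i])))" for i
          by (rule topple_Nil) (use Nil False in simp)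
        show ?thesis
          unfolding topple_Nil[where x = z and Q = Q, OF Nil] 2 if_avg by (rule avg_swap)
      next
        case (Cons j js)
        have 2: "topple f z (val f m) \<eta> (Q(x := Q x @ [i]))
            = (if f z j then 0 else val f m (exec n j z \<eta>) ((Q(x := Q x @ [i]))(z := js)))" for i
          by (rule topple_Cons) (use Cons False in simp)
        show ?thesis
          unfolding topple_Cons[where x = z and Q = Q, OF Cons] 2 if_avg
          using False by (cases "f z j") (simp_all add: fun_upd_twist[of x z])
      qed
      finally show ?thesis unfolding 1 .
    qed
  qed simp
qed simp

text \<open>Toppling the same site \<open>y\<close> in both configurations keeps them equal up to
  the sleeper at \<open>x\<close>. If a particle jumps onto \<open>x\<close> the sleeper wakes up
  and they coincide; if everything else is asleep, the configuration with the sleeper is already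
  stable.\<close>

theorem val_wake:
  assumes "\<eta> x = Sleepy"
  shows "val f m (\<eta>(x := Active 1)) Q \<le> val f m \<eta> Q"
  using assms
proof (induction m arbitrary: \<eta> Q)
  case 0
  show ?case
  proof (cases "all_asleep n \<eta>")
    case False
    then obtain y where "active n y \<eta>" by (auto simp: all_asleep_iff)
    with 0 have "active n y (\<eta>(x := Active 1))" by (auto simp: active_def)
    then have "\<not> all_asleep n (\<eta>(x := Active 1))" unfolding all_asleep_iff by blast
    then have "val f 0 (\<eta>(x := Active 1)) Q = 0" by (simp only: val.simps of_bool_def if_False)
    then show ?thesis using val_bounds(1)[of f 0 \<eta> Q] by linarith
  qed simp
next
  case (Suc m)
  show ?case
  proof (cases "all_asleep n \<eta>")
    case True
    then show ?thesis using val_bounds by (simp del: val.simps)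
  next
    case False
    then obtain y where y: "active n y \<eta>" by (auto simp: all_asleep_iff)
    with Suc.prems have yx: "y \<noteq> x" by (auto simp: active_def)
    with y have y': "active n y (\<eta>(x := Active 1))" by (auto simp: active_def)
    have le: "val f m (exec n i y (\<eta>(x := Active 1))) Q' \<le> val f m (exec n i y \<eta>) Q'" for i Q'
    proof (cases "i \<noteq> Slp \<and> dest n y i = x")
      case True
      then have "exec n i y (\<eta>(x := Active 1)) = exec n i y \<eta>"
        using yx Suc.prems by (auto simp: exec_def jump_def Let_def fun_eq_iff numeral_2_eq_2)
      then show ?thesis by simp
    next
      case False
      then have "exec n i y (\<eta>(x := Active 1)) = (exec n i y \<eta>)(x := Active 1)"
        "exec n i y \<eta> x = Sleepy"
        using yx Suc.prems
        by (auto simp: exec_def try_sleep_def jump_def Let_def fun_eq_iff)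
      with Suc.IH[of "exec n i y \<eta>" Q'] show ?thesis by (simp only:)
    qed
    show ?thesis unfolding val_topple[OF y] val_topple[OF y']
      unfolding topple_def Let_def using le by (auto split: list.split intro!: avg_mono)
  qed
qed

end

section \<open>Following one particle to a barrier\<close>

definition qadd :: "queue \<Rightarrow> queue \<Rightarrow> queue" (infixl "\<oplus>\<^sub>q" 65) where
  "qadd Q A = (\<lambda>x. Q x @ A x)"

definition qsing :: "nat \<Rightarrow> instr \<Rightarrow> queue" where
  "qsing x i = (\<lambda>z. if z = x then [i] else [])"

lemma qadd_assoc: "Q \<oplus>\<^sub>q A \<oplus>\<^sub>q B = Q \<oplus>\<^sub>q (A \<oplus>\<^sub>q B)"
  by (simp add: qadd_def)

lemma qadd_Nil [simp]: "Q \<oplus>\<^sub>q (\<lambda>_. []) = Q"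
  by (simp add: qadd_def)

lemma qadd_qsing: "Q(x := Q x @ [i]) = Q \<oplus>\<^sub>q qsing x i"
  by (auto simp: qadd_def qsing_def)

definition put :: "nat \<Rightarrow> config \<Rightarrow> config" where
  "put x \<rho> = \<rho>(x := add_particle (\<rho> x))"

context arw_cycle
begin

section \<open>Probability of ever stabilising, and carrying out revealed instructions\<close>

definition sval :: "(nat \<Rightarrow> instr \<Rightarrow> bool) \<Rightarrow> config \<Rightarrow> queue \<Rightarrow> real" where
  "sval f \<eta> Q = (SUP m. val f m \<eta> Q)"

lemma val_tendsto: "(\<lambda>m. val f m \<eta> Q) \<longlonglongrightarrow> sval f \<eta> Q"
  unfolding sval_def
proof (rule LIMSEQ_incseq_SUP)
  show "bdd_above (range (\<lambda>m. val f m \<eta> Q))"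
    using val_bounds by (intro bdd_aboveI[of _ 1]) auto
  show "incseq (\<lambda>m. val f m \<eta> Q)"
    by (rule incseq_SucI) (rule val_mono)
qed

lemma val_le_sval: "val f m \<eta> Q \<le> sval f \<eta> Q"
  unfolding sval_def using val_bounds by (intro cSUP_upper bdd_aboveI[of _ 1]) auto

lemma sval_bounds: "0 \<le> sval f \<eta> Q" "sval f \<eta> Q \<le> 1"
proof -
  show "0 \<le> sval f \<eta> Q" using val_le_sval[of f 0 \<eta> Q] val_bounds[of f 0 \<eta> Q] by linarith
  show "sval f \<eta> Q \<le> 1" unfolding sval_def using val_bounds by (intro cSUP_least) auto
qed

lemma sval_stable: "all_asleep n \<eta> \<Longrightarrow> sval f \<eta> Q = 1"
  by (simp add: sval_def)

lemma sval_topple: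
  assumes "active n x \<eta>"
  shows "sval f \<eta> Q = topple f x (sval f) \<eta> Q"
proof (rule LIMSEQ_unique)
  show "(\<lambda>m. val f (Suc m) \<eta> Q) \<longlonglongrightarrow> sval f \<eta> Q"
    by (rule LIMSEQ_Suc) (rule val_tendsto)
  show "(\<lambda>m. val f (Suc m) \<eta> Q) \<longlonglongrightarrow> topple f x (sval f) \<eta> Q"
    unfolding val_topple[OF assms] topple_def Let_def avg_def
    by (cases "Q x") (auto intro!: tendsto_intros val_tendsto)
qed

lemma sval_tower: "sval f \<eta> Q = avg (\<lambda>i. sval f \<eta> (Q \<oplus>\<^sub>q qsing x i))"
proof (rule LIMSEQ_unique[OF val_tendsto])
  show "(\<lambda>m. val f m \<eta> Q) \<longlonglongrightarrow> avg (\<lambda>i. sval f \<eta> (Q \<oplus>\<^sub>q qsing x i))"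
    by (subst val_tower[where x = x]) (auto simp: qadd_qsing avg_def intro!: tendsto_intros val_tendsto)
qed

lemma sval_wake:
  assumes "\<eta> x = Sleepy"
  shows "sval f (\<eta>(x := Active 1)) Q \<le> sval f \<eta> Q"
  by (rule LIMSEQ_le[OF val_tendsto val_tendsto]) (use val_wake[of \<eta> x f, OF assms] in auto)

text \<open>
  \<open>dominates f \<eta> Q \<eta>' Q'\<close> holds when \<open>(\<eta>', Q')\<close> can be reached from \<open>(\<eta>, Q)\<close> by carrying out
  instructions that are already revealed; it persists when further instructions are revealed.
\<close>

definition dominates :: "(nat \<Rightarrow> instr \<Rightarrow> bool) \<Rightarrow> config \<Rightarrow> queue \<Rightarrow> config \<Rightarrow> queue \<Rightarrow> bool" where
  "dominates f \<eta> Q \<eta>' Q' \<longleftrightarrow> (\<forall>A. sval f \<eta>' (Q' \<oplus>\<^sub>q A) \<le> sval f \<eta> (Q \<oplus>\<^sub>q A))"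

lemma dominates_refl: "dominates f \<eta> Q \<eta> Q"
  by (simp add: dominates_def)

lemma dominates_trans:
  "dominates f a A b B \<Longrightarrow> dominates f b B c C \<Longrightarrow> dominates f a A c C"
  unfolding dominates_def using order_trans by blast

lemma dominates_qadd:
  "dominates f \<eta> Q \<eta>' Q' \<Longrightarrow> dominates f \<eta> (Q \<oplus>\<^sub>q A) \<eta>' (Q' \<oplus>\<^sub>q A)"
  by (simp add: dominates_def qadd_assoc)

lemma dominates_sval: "dominates f \<eta> Q \<eta>' Q' \<Longrightarrow> sval f \<eta>' Q' \<le> sval f \<eta> Q"
  unfolding dominates_def by (metis qadd_Nil)

text \<open>The queue at \<open>x\<close> has to be empty so that the revealed instruction is the
  one used first; whatever is revealed later in \<open>A\<close> stands behind it.\<close>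

lemma dominates_exec:
  assumes "active n x \<eta>" "Q x = []" "\<not> f x i"
  shows "dominates f \<eta> (Q \<oplus>\<^sub>q qsing x i) (exec n i x \<eta>) Q"
  unfolding dominates_def
proof
  fix A
  have "(Q \<oplus>\<^sub>q qsing x i \<oplus>\<^sub>q A)(x := A x) = Q \<oplus>\<^sub>q A"
    "(Q \<oplus>\<^sub>q qsing x i \<oplus>\<^sub>q A) x = i # A x"
    using assms by (auto simp: qadd_def qsing_def)
  then show "sval f (exec n i x \<eta>) (Q \<oplus>\<^sub>q A) \<le> sval f \<eta> (Q \<oplus>\<^sub>q qsing x i \<oplus>\<^sub>q A)"
    using sval_topple[OF assms(1), of f "Q \<oplus>\<^sub>q qsing x i \<oplus>\<^sub>q A"] assms(3)
    by (simp add: topple_Cons[of "Q \<oplus>\<^sub>q qsing x i \<oplus>\<^sub>q A" x])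
qed

lemma dominates_wake:
  assumes "\<eta> x = Sleepy"
  shows "dominates f \<eta> Q (\<eta>(x := Active 1)) Q"
  unfolding dominates_def using sval_wake[of \<eta> x f, OF assms] by blast

end

text \<open>
  The sites \<open>s 0, s 1, \<dots>\<close> lead away from a barrier that lies just before \<open>s 0\<close>; \<open>tob\<close> and \<open>fro\<close>
  are the jumps towards and away from it.
\<close>

locale arw_ray = arw_cycle +
  fixes f :: "nat \<Rightarrow> instr \<Rightarrow> bool" and s :: "nat \<Rightarrow> nat" and D :: nat
    and \<rho> :: config and Q :: queue and tob fro :: instr and S :: "nat \<Rightarrow> real"
  assumes s_inj: "inj_on s {..Suc D}"
    and s_less: "\<And>k. k \<le> D \<Longrightarrow> s k < n"
    and dirs: "tob \<noteq> Slp" "fro \<noteq> Slp" "tob \<noteq> fro"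
    and tob: "\<And>k. k < D \<Longrightarrow> dest n (s (Suc k)) tob = s k" "\<And>k. k < D \<Longrightarrow> \<not> f (s (Suc k)) tob"
    and fro: "\<And>k. k \<le> D \<Longrightarrow> dest n (s k) fro = s (Suc k)" "\<And>k. k \<le> D \<Longrightarrow> \<not> f (s k) fro"
    and slp: "\<And>k. k \<le> D \<Longrightarrow> \<not> f (s k) Slp"
    and vacant: "\<And>k. k \<le> D \<Longrightarrow> \<rho> (s k) = Active 0" "\<And>k. k \<le> D \<Longrightarrow> Q (s k) = []"
    and trap: "\<And>g A. g \<le> D \<Longrightarrow> (\<And>z. z \<notin> s ` {..g} \<Longrightarrow> A z = []) \<Longrightarrow>
                S g \<le> sval f (\<rho>(s g := Sleepy)) (Q \<oplus>\<^sub>q A)"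
begin

lemma avg_dirs: "avg F = q * F Slp + (1 - q) / 2 * (F tob + F fro)"
  using dirs by (cases tob; cases fro) (auto simp: avg_def field_simps)

definition supp :: "nat \<Rightarrow> queue \<Rightarrow> bool" where
  "supp d A \<longleftrightarrow> (\<forall>z. z \<notin> s ` {..d} \<longrightarrow> A z = [])"

lemma supp_qadd: "supp d A \<Longrightarrow> supp d B \<Longrightarrow> supp d (A \<oplus>\<^sub>q B)"
  by (auto simp: supp_def qadd_def)

lemma supp_mono: "supp d A \<Longrightarrow> d \<le> d' \<Longrightarrow> supp d' A"
  unfolding supp_def by (metis atMost_subset_iff image_mono subsetD)

lemma supp_qsing: "k \<le> d \<Longrightarrow> supp d (qsing (s k) i)"
  by (auto simp: supp_def qsing_def)

text \<open>
  \<open>ancestor d e P Z X\<close>: the state \<open>(e, P)\<close> can be carried forward until a particle stands at \<open>s d\<close>.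
  \<open>Z\<close> is a value that remains available when that particle ends up beyond the barrier without a
  trap on its way, and \<open>X\<close> is the value when it reaches \<open>s (d + 1)\<close>.
\<close>

definition ancestor :: "nat \<Rightarrow> config \<Rightarrow> queue \<Rightarrow> real \<Rightarrow> real \<Rightarrow> bool" where
  "ancestor d e P Z X \<longleftrightarrow> dominates f e P (put (s d) \<rho>) Q \<and>
     (\<forall>A. supp d A \<longrightarrow> Z \<le> sval f e (P \<oplus>\<^sub>q A)) \<and>
     (\<forall>A. supp d A \<longrightarrow> dominates f e (P \<oplus>\<^sub>q A) (put (s (Suc d)) \<rho>) Q \<longrightarrow> X \<le> sval f e (P \<oplus>\<^sub>q A))"

lemma ancestor_qadd:
  assumes "ancestor d e P Z X" "supp d A" "dominates f e (P \<oplus>\<^sub>q A) (put (s d) \<rho>) Q"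
  shows "ancestor d e (P \<oplus>\<^sub>q A) Z X"
  using assms unfolding ancestor_def by (simp add: qadd_assoc supp_qadd)

lemma put_vacant: "k \<le> D \<Longrightarrow> put (s k) \<rho> = \<rho>(s k := Active 1)"
  by (simp add: put_def vacant)

lemma active_put: "k \<le> D \<Longrightarrow> active n (s k) (put (s k) \<rho>)"
  by (simp add: put_vacant active_def s_less)

lemma s_neq: "k \<le> D \<Longrightarrow> s k \<noteq> s (Suc k)"
  using inj_onD[OF s_inj, of k "Suc k"] by auto

lemma exec_fro: "k \<le> D \<Longrightarrow> exec n fro (s k) (put (s k) \<rho>) = put (s (Suc k)) \<rho>"
  using s_neq[of k] dirs vacant(1)[of k]
  by (auto simp: exec_def jump_def put_def fro fun_eq_iff Let_def)

lemma exec_tob: "k < D \<Longrightarrow> exec n tob (s (Suc k)) (put (s (Suc k)) \<rho>) = put (s k) \<rho>"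
  using s_neq[of k] dirs vacant(1)[of k] vacant(1)[of "Suc k"]
  by (auto simp: exec_def jump_def put_def tob fun_eq_iff Let_def)

lemma exec_slp: "k \<le> D \<Longrightarrow> exec n Slp (s k) (put (s k) \<rho>) = \<rho>(s k := Sleepy)"
  by (auto simp: exec_def try_sleep_def put_vacant)

lemma dominates_step:
  assumes "dominates f e P (put (s k) \<rho>) Q" "k \<le> D" "\<not> f (s k) i"
  shows "dominates f e (P \<oplus>\<^sub>q qsing (s k) i) (exec n i (s k) (put (s k) \<rho>)) Q"
  using dominates_trans[OF dominates_qadd[OF assms(1)] dominates_exec] active_put vacant(2) assms(2,3)
  by blast

lemma dominates_sleeping:
  assumes "k \<le> D"
  shows "dominates f (\<rho>(s k := Sleepy)) Q (put (s k) \<rho>) Q"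
  using dominates_wake[of "\<rho>(s k := Sleepy)" "s k" f Q] by (simp add: put_vacant assms)

theorem ray_lower_bound:
  assumes "d \<le> D" "ancestor d e P Z X"
  shows "((real d + 1) * X + (\<Sum>g\<le>d. q * (1 - q) ^ g * S g) + (1 - q) ^ Suc d * Z) / (real d + 2)
           \<le> sval f e P"
  using assms
proof (induction d arbitrary: e P Z X rule: less_induct)
  case (less d)
  note d = \<open>d \<le> D\<close>
  define y where "y = s d"
  \<comment> \<open>The walk may come back to \<open>s d\<close> any number of times, so no
    recursion on its path terminates. Instead the infimum over all states that lead to
    \<open>s d\<close> is shown to satisfy a linear inequality.\<close>
  define K where "K = {(e, P). ancestor d e P Z X}"
  \<comment> \<open>States in which the particle may also be left asleep at \<open>y\<close>, as
    right after a sleep instruction revealed there.\<close>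
  define K1 where "K1 = {(e, P) \<in> K. dominates f e P (\<rho>(y := Sleepy)) Q}"
  define I where "I = (INF (e, P)\<in>K. sval f e P)"
  define J where "J = (INF (e, P)\<in>K1. sval f e P)"
  define \<Sigma> where "\<Sigma> = (\<Sum>g<d. q * (1 - q) ^ g * S g)"
  \<comment> \<open>The bound of the induction hypothesis one site closer to the barrier: a return
    to \<open>s d\<close> counts as \<open>I\<close>, and \<open>W\<close> is what remains if no
    trap occurs closer to the barrier.\<close>
  define lv where "lv W = (real d * I + \<Sigma> + (1 - q) ^ d * W) / (real d + 1)" for W
  have bdd: "bdd_below ((\<lambda>(e, P). sval f e P) ` A)" for A
    using sval_bounds by (intro bdd_belowI[of _ 0]) auto
  have I_le: "I \<le> sval f e P" if "ancestor d e P Z X" for e P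
    unfolding I_def using that cINF_lower[OF bdd, of "(e, P)" K] by (simp add: K_def)
  have J_le: "J \<le> sval f e P" if "(e, P) \<in> K1" for e P
    unfolding J_def using that cINF_lower[OF bdd, of "(e, P)" K1] by simp
  have fro_val: "X \<le> sval f e (P \<oplus>\<^sub>q qsing y fro)" if "ancestor d e P Z X" for e P
  proof -
    have "dominates f e (P \<oplus>\<^sub>q qsing y fro) (put (s (Suc d)) \<rho>) Q"
      using dominates_step[of e P d fro] that d fro exec_fro[OF d] by (simp add: ancestor_def y_def)
    then show ?thesis
      using that supp_qsing[of d d fro] by (simp add: ancestor_def y_def)
  qed
  have slp_K1: "(e, P \<oplus>\<^sub>q qsing y Slp) \<in> K1" if "ancestor d e P Z X" for e P
  proof -
    have 1: "dominates f e (P \<oplus>\<^sub>q qsing y Slp) (\<rho>(y := Sleepy)) Q"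
      using dominates_step[of e P d Slp] that d slp exec_slp[OF d] by (simp add: ancestor_def y_def)
    then have "dominates f e (P \<oplus>\<^sub>q qsing y Slp) (put (s d) \<rho>) Q"
      using dominates_sleeping[OF d] dominates_trans unfolding y_def by blast
    then show ?thesis
      using 1 that ancestor_qadd supp_qsing[of d d Slp] by (simp add: K1_def K_def y_def)
  qed
  have tob_val: "lv W \<le> sval f e (P \<oplus>\<^sub>q qsing y tob)"
    if anc: "ancestor d e P Z X"
      and W: "\<And>A. supp d A \<Longrightarrow> W \<le> sval f e (P \<oplus>\<^sub>q qsing y tob \<oplus>\<^sub>q A)" for e P W
  proof (cases d)
    case 0
    have "supp d (\<lambda>_. [])" by (simp add: supp_def)
    then show ?thesis using W[of "\<lambda>_. []"] 0 by (simp add: lv_def \<Sigma>_def)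
  next
    case (Suc k)
    then have k: "k < D" "k < d" using d by auto
    have "ancestor k e (P \<oplus>\<^sub>q qsing y tob) W I"
      unfolding ancestor_def
    proof (intro conjI allI impI)
      show "dominates f e (P \<oplus>\<^sub>q qsing y tob) (put (s k) \<rho>) Q"
        using dominates_step[of e P d tob] anc d tob k exec_tob[OF k(1)]
        by (simp add: ancestor_def y_def Suc)
      show "W \<le> sval f e (P \<oplus>\<^sub>q qsing y tob \<oplus>\<^sub>q A)" if "supp k A" for A
        using W supp_mono[OF that] Suc by simp
      fix A assume A: "supp k A"
        and "dominates f e (P \<oplus>\<^sub>q qsing y tob \<oplus>\<^sub>q A) (put (s (Suc k)) \<rho>) Q"
      then have "dominates f e (P \<oplus>\<^sub>q (qsing y tob \<oplus>\<^sub>q A)) (put (s d) \<rho>) Q"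
        by (simp add: Suc qadd_assoc)
      moreover have "supp d (qsing y tob \<oplus>\<^sub>q A)"
        using supp_mono[OF A] supp_qsing[of d d tob] Suc by (intro supp_qadd) (auto simp: y_def)
      ultimately show "I \<le> sval f e (P \<oplus>\<^sub>q qsing y tob \<oplus>\<^sub>q A)"
        using I_le ancestor_qadd[OF anc] by (simp add: qadd_assoc)
    qed
    from less.IH[OF k(2) _ this] k show ?thesis
      by (simp add: lv_def \<Sigma>_def Suc lessThan_Suc_atMost add.commute)
  qed
  have tob_Z: "lv Z \<le> sval f e (P \<oplus>\<^sub>q qsing y tob)" if anc: "ancestor d e P Z X" for e P
  proof (rule tob_val[OF anc])
    fix A assume "supp d A"
    then have "supp d (qsing y tob \<oplus>\<^sub>q A)"
      using supp_qsing[of d d tob] by (intro supp_qadd) (auto simp: y_def)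
    then show "Z \<le> sval f e (P \<oplus>\<^sub>q qsing y tob \<oplus>\<^sub>q A)"
      using anc by (simp add: ancestor_def qadd_assoc)
  qed
  \<comment> \<open>If the departure towards the barrier follows a sleep instruction,
    \<open>y\<close> itself serves as a trap whenever no site closer to the barrier does, so
    \<open>Z\<close> is replaced by \<open>S d\<close>.\<close>
  have tob_S: "lv (S d) \<le> sval f e (P \<oplus>\<^sub>q qsing y tob)" if K1: "(e, P) \<in> K1" for e P
  proof (rule tob_val)
    show "ancestor d e P Z X" using K1 by (simp add: K1_def K_def)
    fix A assume "supp d A"
    then have "supp d (qsing y tob \<oplus>\<^sub>q A)"
      using supp_qsing[of d d tob] by (intro supp_qadd) (auto simp: y_def)
    then have "S d \<le> sval f (\<rho>(s d := Sleepy)) (Q \<oplus>\<^sub>q (qsing y tob \<oplus>\<^sub>q A))"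
      by (intro trap d) (auto simp: supp_def)
    also have "\<dots> \<le> sval f e (P \<oplus>\<^sub>q (qsing y tob \<oplus>\<^sub>q A))"
      using K1 by (auto simp: K1_def dominates_def y_def)
    finally show "S d \<le> sval f e (P \<oplus>\<^sub>q qsing y tob \<oplus>\<^sub>q A)" by (simp add: qadd_assoc)
  qed
  have anc: "ancestor d e P Z X" by fact
  have r: "0 \<le> (1 - q) / 2" using q01 by simp
  \<comment> \<open>Revealing the next instruction at \<open>y\<close>: another sleep stays in
    \<open>K1\<close>, the two jumps give \<open>lv (S d)\<close> and \<open>X\<close>. The
    inequality is then solved for \<open>J\<close>.\<close>
  have "q * J + (1 - q) / 2 * (lv (S d) + X) \<le> J"
    unfolding J_def
  proof (rule cINF_greatest)
    show "K1 \<noteq> {}" using slp_K1[OF anc] by auto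
    fix eP assume "eP \<in> K1"
    then obtain e P where eP: "eP = (e, P)" "(e, P) \<in> K1" by (cases eP) auto
    then have anc': "ancestor d e P Z X" by (simp add: K1_def K_def)
    have "q * J + (1 - q) / 2 * (lv (S d) + X) \<le> sval f e P"
      unfolding sval_tower[of f e P y] avg_dirs
      using q01 r by (intro add_mono mult_left_mono J_le slp_K1 tob_S eP fro_val anc') auto
    then show "q * (INF (e, P)\<in>K1. sval f e P) + (1 - q) / 2 * (lv (S d) + X) \<le> (case eP of (e, P) \<Rightarrow> sval f e P)"
      by (simp add: eP J_def)
  qed
  then have "(1 - q) * ((lv (S d) + X) / 2) \<le> (1 - q) * J" by (simp add: algebra_simps)
  then have J: "(lv (S d) + X) / 2 \<le> J"
    using q01 by (subst (asm) mult_le_cancel_left_pos) auto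
  have "q * J + (1 - q) / 2 * (lv Z + X) \<le> I"
    unfolding I_def
  proof (rule cINF_greatest)
    show "K \<noteq> {}" using anc by (auto simp: K_def)
    fix eP assume "eP \<in> K"
    then obtain e P where eP: "eP = (e, P)" "ancestor d e P Z X" by (cases eP) (auto simp: K_def)
    have "q * J + (1 - q) / 2 * (lv Z + X) \<le> sval f e P"
      unfolding sval_tower[of f e P y] avg_dirs
      using q01 r by (intro add_mono mult_left_mono J_le slp_K1 tob_Z eP fro_val) auto
    then show "q * J + (1 - q) / 2 * (lv Z + X) \<le> (case eP of (e, P) \<Rightarrow> sval f e P)"
      by (simp add: eP)
  qed
  moreover have "q * ((lv (S d) + X) / 2) \<le> q * J" using J q01 by (intro mult_left_mono) auto
  ultimately have "X / 2 + (q * lv (S d) + (1 - q) * lv Z) / 2 \<le> I" by (simp add: field_simps)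
  moreover have "q * lv (S d) + (1 - q) * lv Z
      = (real d * I + (\<Sigma> + q * (1 - q) ^ d * S d) + (1 - q) ^ Suc d * Z) / (real d + 1)"
    unfolding lv_def times_divide_eq_right add_divide_distrib[symmetric]
    by (rule arg_cong[of _ _ "\<lambda>x. x / _"]) (simp add: algebra_simps)
  moreover have "\<Sigma> + q * (1 - q) ^ d * S d = (\<Sum>g\<le>d. q * (1 - q) ^ g * S g)"
    by (simp add: \<Sigma>_def lessThan_Suc_atMost[symmetric])
  \<comment> \<open>Both values of \<open>lv\<close> contain \<open>I\<close> with coefficient d /
    (d + 1); half of this is moved to the left, which leaves the factor (d + 2) / (2 (d + 1)) to
    divide by.\<close>
  ultimately have "((real d + 1) * X + (\<Sum>g\<le>d. q * (1 - q) ^ g * S g) + (1 - q) ^ Suc d * Z) / (real d + 2) \<le> I"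
    by (simp add: divide_simps) (simp add: algebra_simps)
  also have "I \<le> sval f e P" by (rule I_le[OF anc])
  finally show ?case .
qed

end

section \<open>Emptying a pile inside a block\<close>

context arw_cycle
begin

lemma dest_Rgt: "Suc x < n \<Longrightarrow> dest n x Rgt = Suc x"
  by simp

lemma dest_Lft: "Suc x < n \<Longrightarrow> dest n (Suc x) Lft = x"
  by simp

text \<open>The jump off the pile puts the particle on a ray of \<open>k\<close> sites whose far end
  is the pile itself. Coming back restores the state of value \<open>X\<close>; leaving past the
  barrier without any trap is given the value 0.\<close>

lemma pile_side:
  fixes k :: nat and s :: "nat \<Rightarrow> nat" and f :: "nat \<Rightarrow> instr \<Rightarrow> bool" and \<rho> :: config and Q :: queue
  defines "X \<equiv> sval f (put (s k) \<rho>) Q"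
  assumes "inj_on s {..k}" "\<And>j. j \<le> k \<Longrightarrow> s j < n"
    and "tob \<noteq> Slp" "fro \<noteq> Slp" "tob \<noteq> fro"
    and tob: "\<And>j. j < k \<Longrightarrow> dest n (s (Suc j)) tob = s j" "\<And>j. j < k \<Longrightarrow> \<not> f (s (Suc j)) tob"
    and "\<And>j. j < k \<Longrightarrow> dest n (s j) fro = s (Suc j)" "\<And>j. j < k \<Longrightarrow> \<not> f (s j) fro"
    and "\<And>j. j < k \<Longrightarrow> \<not> f (s j) Slp"
    and vac: "\<And>j. j < k \<Longrightarrow> \<rho> (s j) = Active 0" "\<And>j. j < k \<Longrightarrow> Q (s j) = []"
    and pile: "\<rho> (s k) = Active N"
    and "\<And>g A. g < k \<Longrightarrow> (\<And>z. z \<notin> s ` {..g} \<Longrightarrow> A z = []) \<Longrightarrow>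
           S g \<le> sval f (\<rho>(s g := Sleepy)) (Q \<oplus>\<^sub>q A)"
  shows "(real k * X + (\<Sum>g<k. q * (1 - q) ^ g * S g)) / (real k + 1)
           \<le> (if f (s k) tob then 0 else sval f (exec n tob (s k) (put (s k) \<rho>)) Q)"
proof (cases k)
  case 0
  then show ?thesis using sval_bounds by simp
next
  case (Suc D)
  interpret ray: arw_ray q n f s D \<rho> Q tob fro S
    using assms n2 q01 by unfold_locales (auto simp: Suc)
  have "ray.ancestor D (put (s D) \<rho>) Q 0 X"
    unfolding ray.ancestor_def using sval_bounds dominates_sval[of f _ _ "put (s (Suc D)) \<rho>" Q]
    by (auto simp: dominates_refl X_def Suc)
  from ray.ray_lower_bound[OF _ this]
  have *: "((real D + 1) * X + (\<Sum>g\<le>D. q * (1 - q) ^ g * S g)) / (real D + 2) \<le> sval f (put (s D) \<rho>) Q"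
    by simp
  have "s D \<noteq> s k" using inj_onD[OF assms(2), of D k] Suc by auto
  then have "exec n tob (s k) (put (s k) \<rho>) = put (s D) \<rho>"
    using assms(4) tob(1)[of D] vac(1)[of D] pile Suc
    by (auto simp: exec_def jump_def put_def fun_eq_iff Let_def)
  with * tob(2)[of D] Suc show ?thesis
    by (simp add: lessThan_Suc_atMost add.commute)
qed

text \<open>Both sides contain \<open>X\<close> through returns to the pile. Solving the averaged
  inequality turns the one-sided escape weights 1 / (k + 1) and 1 / (l + 1) into the gambler's ruin
  probabilities (l + 1) / (k + l + 2) and (k + 1) / (k + l + 2).\<close>

theorem pile_lower_bound:
  fixes k l M :: nat and f :: "nat \<Rightarrow> instr \<Rightarrow> bool" and \<rho> :: config and Q :: queue
  defines "X \<equiv> sval f (put M \<rho>) Q"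
  assumes M: "k \<le> M" "M + l < n"
    and slp: "\<And>z. M - k \<le> z \<Longrightarrow> z \<le> M + l \<Longrightarrow> \<not> f z Slp"
    and rgt: "\<And>z. M - k \<le> z \<Longrightarrow> z < M + l \<Longrightarrow> \<not> f z Rgt"
    and lft: "\<And>z. M - k < z \<Longrightarrow> z \<le> M + l \<Longrightarrow> \<not> f z Lft"
    and vac: "\<And>z. M - k \<le> z \<Longrightarrow> z \<le> M + l \<Longrightarrow> z \<noteq> M \<Longrightarrow> \<rho> z = Active 0"
      "\<And>z. M - k \<le> z \<Longrightarrow> z \<le> M + l \<Longrightarrow> Q z = []"
    and pile: "\<rho> M = Active N"
    and L: "\<And>g A. g < k \<Longrightarrow> (\<And>z. z < M - k \<or> M - k + g < z \<Longrightarrow> A z = []) \<Longrightarrow>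
           SL g \<le> sval f (\<rho>(M - k + g := Sleepy)) (Q \<oplus>\<^sub>q A)"
    and R: "\<And>g A. g < l \<Longrightarrow> (\<And>z. z < M + l - g \<or> M + l < z \<Longrightarrow> A z = []) \<Longrightarrow>
           SR g \<le> sval f (\<rho>(M + l - g := Sleepy)) (Q \<oplus>\<^sub>q A)"
  shows "((real l + 1) * (\<Sum>g<k. q * (1 - q) ^ g * SL g) + (real k + 1) * (\<Sum>g<l. q * (1 - q) ^ g * SR g))
           / (real k + real l + 2) \<le> X"
proof -
  define A where "A = (\<Sum>g<k. q * (1 - q) ^ g * SL g)"
  define B where "B = (\<Sum>g<l. q * (1 - q) ^ g * SR g)"
  define a where "a = (if f M Lft then 0 else sval f (exec n Lft M (put M \<rho>)) Q)"
  define b where "b = (if f M Rgt then 0 else sval f (exec n Rgt M (put M \<rho>)) Q)"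
  have a: "(real k * X + A) / (real k + 1) \<le> a"
  proof -
    define s where "s j = M - k + j" for j
    have sk: "s k = M" using M by (simp add: s_def)
    have im: "s ` {..g} = {M - k..M - k + g}" for g
      unfolding s_def by (simp add: image_add_atMost atMost_atLeast0)
    have "(real k * sval f (put (s k) \<rho>) Q + (\<Sum>g<k. q * (1 - q) ^ g * SL g)) / (real k + 1)
           \<le> (if f (s k) Lft then 0 else sval f (exec n Lft (s k) (put (s k) \<rho>)) Q)"
    proof (rule pile_side[where fro = Rgt and N = N])
      show "dest n (s (Suc j)) Lft = s j" if "j < k" for j
        using dest_Lft[of "s j"] that M by (simp add: s_def)
      show "dest n (s j) Rgt = s (Suc j)" if "j < k" for j
        using dest_Rgt[of "s j"] that M by (simp add: s_def)
      show "SL g \<le> sval f (\<rho>(s g := Sleepy)) (Q \<oplus>\<^sub>q A)"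
        if "g < k" "\<And>z. z \<notin> s ` {..g} \<Longrightarrow> A z = []" for g A
        unfolding s_def using that(2) by (intro L that(1)) (auto simp: im)
      show "\<rho> (s k) = Active N" by (simp add: sk pile)
    qed (use M slp rgt lft vac in \<open>auto simp: s_def inj_on_def\<close>)
    then show ?thesis unfolding sk X_def A_def a_def .
  qed
  have b: "(real l * X + B) / (real l + 1) \<le> b"
  proof -
    define s where "s j = M + l - j" for j
    have sk: "s l = M" using M by (simp add: s_def)
    have im: "z \<notin> s ` {..g}" if "z < M + l - g \<or> M + l < z" for g z
      using that by (auto simp: s_def)
    have "(real l * sval f (put (s l) \<rho>) Q + (\<Sum>g<l. q * (1 - q) ^ g * SR g)) / (real l + 1)
           \<le> (if f (s l) Rgt then 0 else sval f (exec n Rgt (s l) (put (s l) \<rho>)) Q)"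
    proof (rule pile_side[where fro = Lft and N = N])
      show "dest n (s (Suc j)) Rgt = s j" if "j < l" for j
        using dest_Rgt[of "s (Suc j)"] that M by (simp add: s_def)
      show "dest n (s j) Lft = s (Suc j)" if "j < l" for j
      proof -
        have "s j = Suc (s (Suc j))" using that M by (simp add: s_def)
        then show ?thesis using dest_Lft[of "s (Suc j)"] M by (simp add: s_def)
      qed
      show "SR g \<le> sval f (\<rho>(s g := Sleepy)) (Q \<oplus>\<^sub>q A)"
        if "g < l" "\<And>z. z \<notin> s ` {..g} \<Longrightarrow> A z = []" for g A
        unfolding s_def using that(2) im by (intro R that(1)) blast
      show "\<rho> (s l) = Active N" by (simp add: sk pile)
    qed (use M slp rgt lft vac in \<open>auto simp: s_def inj_on_def\<close>)
    then show ?thesis unfolding sk X_def B_def b_def .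
  qed
  have act: "active n M (put M \<rho>)" using M pile by (simp add: active_def put_def)
  \<comment> \<open>A sleep instruction on the pile does no harm: with company it has no effect, and
    a lone particle that falls asleep may be woken again for a lower bound.\<close>
  have s: "X \<le> sval f (exec n Slp M (put M \<rho>)) Q"
  proof (cases N)
    case 0
    then have "exec n Slp M (put M \<rho>) = \<rho>(M := Sleepy)" "put M \<rho> = \<rho>(M := Sleepy, M := Active 1)"
      using pile by (auto simp: exec_def try_sleep_def put_def)
    then show ?thesis using sval_wake[of "\<rho>(M := Sleepy)" M f Q] by (simp add: X_def)
  next
    case (Suc N')
    then have "exec n Slp M (put M \<rho>) = put M \<rho>"
      using pile by (auto simp: exec_def try_sleep_def put_def)
    then show ?thesis by (simp add: X_def)
  qed
  have "Q M = []" "\<not> f M Slp" using M vac(2)[of M] slp[of M] by auto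
  then have "X = q * sval f (exec n Slp M (put M \<rho>)) Q + (1 - q) / 2 * b + (1 - q) / 2 * a"
    unfolding X_def a_def b_def
    by (subst sval_topple[OF act]) (simp add: topple_Nil avg_def)
  moreover have "q * X \<le> q * sval f (exec n Slp M (put M \<rho>)) Q"
    using s q01 by (intro mult_left_mono) auto
  moreover have "(1 - q) * ((a + b) / 2) = (1 - q) / 2 * b + (1 - q) / 2 * a" "(1 - q) * X = X - q * X"
    by (auto simp: field_simps)
  ultimately have "(1 - q) * ((a + b) / 2) \<le> (1 - q) * X" by linarith
  then have "(a + b) / 2 \<le> X" using q01 by (subst (asm) mult_le_cancel_left_pos) auto
  then have "a + b \<le> 2 * X" by simp
  with add_mono[OF a b] have "(real k * X + A) / (real k + 1) + (real l * X + B) / (real l + 1) \<le> 2 * X"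
    by (rule order_trans)
  then have "((real l + 1) * A + (real k + 1) * B) \<le> (real k + real l + 2) * X"
  proof -
    assume le: "(real k * X + A) / (real k + 1) + (real l * X + B) / (real l + 1) \<le> 2 * X"
    have "(real k * X + A) / (real k + 1) + (real l * X + B) / (real l + 1)
        = ((real k * X + A) * (real l + 1) + (real l * X + B) * (real k + 1)) / ((real k + 1) * (real l + 1))"
      by (rule add_frac_eq) auto
    with le have "((real k * X + A) * (real l + 1) + (real l * X + B) * (real k + 1))
        / ((real k + 1) * (real l + 1)) \<le> 2 * X" by (simp only:)
    moreover have "0 < (real k + 1) * (real l + 1)" by simp
    ultimately have "(real k * X + A) * (real l + 1) + (real l * X + B) * (real k + 1)
        \<le> 2 * X * ((real k + 1) * (real l + 1))"
      by (metis pos_divide_le_eq)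
    then show ?thesis by (simp add: algebra_simps)
  qed
  then show ?thesis unfolding A_def B_def by (simp add: divide_le_eq mult.commute)
qed

text \<open>Induction on the size of the pile: each particle taken off it is trapped at a site that
  becomes the new barrier. The value \<open>c\<close> is what is guaranteed once the block has no
  active particle, whatever sleepers and leftover instructions it contains, so everything behind the
  barriers may be forgotten.\<close>

theorem block_lower_bound:
  fixes \<Psi> :: "nat \<Rightarrow> nat \<Rightarrow> nat \<Rightarrow> real" and a b M :: nat
  assumes b: "b \<le> n"
    and slp: "\<And>z. a \<le> z \<Longrightarrow> z < b \<Longrightarrow> \<not> f z Slp"
    and rgt: "\<And>z. a \<le> z \<Longrightarrow> Suc z < b \<Longrightarrow> \<not> f z Rgt"
    and lft: "\<And>z. a < z \<Longrightarrow> z < b \<Longrightarrow> \<not> f z Lft"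
    and nonneg: "\<And>N u v. 0 \<le> \<Psi> N u v"
    and bdry: "\<And>N v. 0 < v \<Longrightarrow> v \<le> b - a \<Longrightarrow> 1 \<le> \<Psi> N 0 v" "\<And>N u. 0 < u \<Longrightarrow> u \<le> b - a \<Longrightarrow> 1 \<le> \<Psi> N u 0"
    and step: "\<And>N k l. k + l < b - a \<Longrightarrow>
        (real l + 1) * gap_avg k (\<lambda>u. \<Psi> N u (Suc l)) + (real k + 1) * gap_avg l (\<lambda>v. \<Psi> N (Suc k) v)
          \<le> (real k + real l + 2) * \<Psi> (Suc N) (Suc k) (Suc l)"
    and c: "c \<le> 1"
    and fin: "\<And>\<eta>' Q'. (\<And>z. z < a \<or> b \<le> z \<Longrightarrow> \<eta>' z = \<eta>\<^sub>0 z \<and> Q' z = Q\<^sub>0 z) \<Longrightarrow>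
        (\<And>z. a \<le> z \<Longrightarrow> z < b \<Longrightarrow> num_active (\<eta>' z) = 0) \<Longrightarrow> c \<le> sval f \<eta>' Q'"
    and "k \<le> M" "a \<le> M - k" "M + l < b"
    and "\<eta> M = Active N"
    and "\<And>z. M - k \<le> z \<Longrightarrow> z \<le> M + l \<Longrightarrow> z \<noteq> M \<Longrightarrow> \<eta> z = Active 0"
    and "\<And>z. M - k \<le> z \<Longrightarrow> z \<le> M + l \<Longrightarrow> Q z = []"
    and "\<And>z. a \<le> z \<Longrightarrow> z < b \<Longrightarrow> z < M - k \<or> M + l < z \<Longrightarrow> num_active (\<eta> z) = 0"
    and "\<And>z. z < a \<or> b \<le> z \<Longrightarrow> \<eta> z = \<eta>\<^sub>0 z \<and> Q z = Q\<^sub>0 z"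
  shows "c - \<Psi> N (Suc k) (Suc l) \<le> sval f \<eta> Q"
  using assms(11-)
proof (induction N arbitrary: k l \<eta> Q)
  case 0
  have "num_active (\<eta> z) = 0" if "a \<le> z" "z < b" for z
    using 0(4) 0(5)[of z] 0(7)[of z] that by (cases "z = M"; cases "z < M - k \<or> M + l < z") auto
  then have "c \<le> sval f \<eta> Q" by (intro fin 0(8))
  then show ?case using nonneg[of 0 "Suc k" "Suc l"] by linarith
next
  case (Suc N)
  note M = Suc.prems(1-3)
  note vac = Suc.prems(5,6)
  note asleep = Suc.prems(7) and outside = Suc.prems(8)
  define \<rho> where "\<rho> = \<eta>(M := Active N)"
  have \<eta>: "\<eta> = put M \<rho>" using Suc.prems(4) by (auto simp: put_def \<rho>_def fun_eq_iff)
  \<comment> \<open>A trap at \<open>M - k + g\<close> has distance k - g from the pile. This is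
    positive for g < k; the case that the barrier reaches the pile is left out of the sum.\<close>
  define SL where "SL g = c - \<Psi> N (k - g) (Suc l)" for g
  define SR where "SR g = c - \<Psi> N (Suc k) (l - g)" for g
  have L: "SL g \<le> sval f (\<rho>(M - k + g := Sleepy)) (Q \<oplus>\<^sub>q A)"
    if g: "g < k" and A: "\<And>z. z < M - k \<or> M - k + g < z \<Longrightarrow> A z = []" for g A
  proof -
    have "c - \<Psi> N (Suc (k - Suc g)) (Suc l) \<le> sval f (\<rho>(M - k + g := Sleepy)) (Q \<oplus>\<^sub>q A)"
    proof (rule Suc.IH)
      show "k - Suc g \<le> M" "a \<le> M - (k - Suc g)" "M + l < b" using M by auto
      show "(\<rho>(M - k + g := Sleepy)) M = Active N" using M g by (simp add: \<rho>_def)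
      show "(\<rho>(M - k + g := Sleepy)) z = Active 0"
        if "M - (k - Suc g) \<le> z" "z \<le> M + l" "z \<noteq> M" for z
        using that M g vac(1)[of z] by (auto simp: \<rho>_def)
      show "(Q \<oplus>\<^sub>q A) z = []" if "M - (k - Suc g) \<le> z" "z \<le> M + l" for z
      proof -
        have "M - k + g < z" "M - k \<le> z" using that M g by linarith+
        then show ?thesis using that vac(2)[of z] A[of z] by (simp add: qadd_def)
      qed
      show "num_active ((\<rho>(M - k + g := Sleepy)) z) = 0"
        if "a \<le> z" "z < b" "z < M - (k - Suc g) \<or> M + l < z" for z
        using that M g vac(1)[of z] asleep[of z] by (cases "z < M - k \<or> M + l < z") (auto simp: \<rho>_def)
      show "(\<rho>(M - k + g := Sleepy)) z = \<eta>\<^sub>0 z \<and> (Q \<oplus>\<^sub>q A) z = Q\<^sub>0 z" if "z < a \<or> b \<le> z" for z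
      proof -
        have "z < M - k \<or> M - k + g < z" "z \<noteq> M" using that M g by linarith+
        then show ?thesis using outside[OF that] A[of z] by (auto simp: \<rho>_def qadd_def)
      qed
    qed
    then show ?thesis using g by (simp add: SL_def Suc_diff_Suc)
  qed
  have R: "SR g \<le> sval f (\<rho>(M + l - g := Sleepy)) (Q \<oplus>\<^sub>q A)"
    if g: "g < l" and A: "\<And>z. z < M + l - g \<or> M + l < z \<Longrightarrow> A z = []" for g A
  proof -
    have "c - \<Psi> N (Suc k) (Suc (l - Suc g)) \<le> sval f (\<rho>(M + l - g := Sleepy)) (Q \<oplus>\<^sub>q A)"
    proof (rule Suc.IH)
      show "k \<le> M" "a \<le> M - k" "M + (l - Suc g) < b" using M by auto
      show "(\<rho>(M + l - g := Sleepy)) M = Active N" using M g by (simp add: \<rho>_def)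
      show "(\<rho>(M + l - g := Sleepy)) z = Active 0"
        if "M - k \<le> z" "z \<le> M + (l - Suc g)" "z \<noteq> M" for z
        using that M g vac(1)[of z] by (auto simp: \<rho>_def)
      show "(Q \<oplus>\<^sub>q A) z = []" if "M - k \<le> z" "z \<le> M + (l - Suc g)" for z
      proof -
        have "z < M + l - g" "z \<le> M + l" using that M g by linarith+
        then show ?thesis using that vac(2)[of z] A[of z] by (simp add: qadd_def)
      qed
      show "num_active ((\<rho>(M + l - g := Sleepy)) z) = 0"
        if "a \<le> z" "z < b" "z < M - k \<or> M + (l - Suc g) < z" for z
        using that M g vac(1)[of z] asleep[of z] by (cases "z < M - k \<or> M + l < z") (auto simp: \<rho>_def)
      show "(\<rho>(M + l - g := Sleepy)) z = \<eta>\<^sub>0 z \<and> (Q \<oplus>\<^sub>q A) z = Q\<^sub>0 z" if "z < a \<or> b \<le> z" for z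
      proof -
        have "z < M + l - g \<or> M + l < z" "z \<noteq> M" "z \<noteq> M + l - g" using that M g by linarith+
        then show ?thesis using outside[OF that] A[of z] by (auto simp: \<rho>_def qadd_def)
      qed
    qed
    then show ?thesis using g by (simp add: SR_def Suc_diff_Suc)
  qed
  have pile: "((real l + 1) * (\<Sum>g<k. q * (1 - q) ^ g * SL g) + (real k + 1) * (\<Sum>g<l. q * (1 - q) ^ g * SR g))
           / (real k + real l + 2) \<le> sval f (put M \<rho>) Q"
  proof (rule pile_lower_bound[where N = N])
    show "\<rho> M = Active N" by (simp add: \<rho>_def)
    show "\<And>z. M - k \<le> z \<Longrightarrow> z \<le> M + l \<Longrightarrow> z \<noteq> M \<Longrightarrow> \<rho> z = Active 0" using vac by (simp add: \<rho>_def)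
  qed (use L R vac M b slp rgt lft in auto)
  have r: "0 \<le> (1 - q) ^ j" for j using q01 by simp
  have SL_sum: "c - gap_avg k (\<lambda>u. \<Psi> N u (Suc l)) \<le> (\<Sum>g<k. q * (1 - q) ^ g * SL g)"
  proof -
    have "(\<Sum>g<k. q * (1 - q) ^ g * SL g)
        = (\<Sum>g<k. c * (q * (1 - q) ^ g) - q * (1 - q) ^ g * \<Psi> N (k - g) (Suc l))"
      by (intro sum.cong) (auto simp: SL_def algebra_simps)
    also have "\<dots> = c * (1 - (1 - q) ^ k) - (gap_avg k (\<lambda>u. \<Psi> N u (Suc l)) - (1 - q) ^ k * \<Psi> N 0 (Suc l))"
      by (simp add: sum_subtractf sum_distrib_left[symmetric] sum_geometric_gap gap_avg_def)
    also have "\<dots> = c - gap_avg k (\<lambda>u. \<Psi> N u (Suc l)) + (1 - q) ^ k * (\<Psi> N 0 (Suc l) - c)"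
      by (simp add: algebra_simps)
    finally have *: "(\<Sum>g<k. q * (1 - q) ^ g * SL g)
        = c - gap_avg k (\<lambda>u. \<Psi> N u (Suc l)) + (1 - q) ^ k * (\<Psi> N 0 (Suc l) - c)" .
    \<comment> \<open>The omitted mass \<open>(1 - q) ^ k\<close> enters \<open>gap_avg\<close> with
      the value of \<Psi> at ruin. As this is at least 1, the corresponding term
      \<open>c - \<Psi> N 0 (Suc l)\<close> is not positive and may be dropped.\<close>
    have "1 \<le> \<Psi> N 0 (Suc l)" by (rule bdry(1)) (use M in linarith)+
    then have "0 \<le> (1 - q) ^ k * (\<Psi> N 0 (Suc l) - c)" using c by (intro mult_nonneg_nonneg r) simp
    then show ?thesis unfolding * by linarith
  qed
  have SR_sum: "c - gap_avg l (\<lambda>v. \<Psi> N (Suc k) v) \<le> (\<Sum>g<l. q * (1 - q) ^ g * SR g)"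
  proof -
    have "(\<Sum>g<l. q * (1 - q) ^ g * SR g)
        = (\<Sum>g<l. c * (q * (1 - q) ^ g) - q * (1 - q) ^ g * \<Psi> N (Suc k) (l - g))"
      by (intro sum.cong) (auto simp: SR_def algebra_simps)
    also have "\<dots> = c * (1 - (1 - q) ^ l) - (gap_avg l (\<lambda>v. \<Psi> N (Suc k) v) - (1 - q) ^ l * \<Psi> N (Suc k) 0)"
      by (simp add: sum_subtractf sum_distrib_left[symmetric] sum_geometric_gap gap_avg_def)
    also have "\<dots> = c - gap_avg l (\<lambda>v. \<Psi> N (Suc k) v) + (1 - q) ^ l * (\<Psi> N (Suc k) 0 - c)"
      by (simp add: algebra_simps)
    finally have *: "(\<Sum>g<l. q * (1 - q) ^ g * SR g)
        = c - gap_avg l (\<lambda>v. \<Psi> N (Suc k) v) + (1 - q) ^ l * (\<Psi> N (Suc k) 0 - c)" .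
    have "1 \<le> \<Psi> N (Suc k) 0" by (rule bdry(2)) (use M in linarith)+
    then have "0 \<le> (1 - q) ^ l * (\<Psi> N (Suc k) 0 - c)" using c by (intro mult_nonneg_nonneg r) simp
    then show ?thesis unfolding * by linarith
  qed
  have "(real k + real l + 2) * (c - \<Psi> (Suc N) (Suc k) (Suc l))
      \<le> (real l + 1) * (c - gap_avg k (\<lambda>u. \<Psi> N u (Suc l))) + (real k + 1) * (c - gap_avg l (\<lambda>v. \<Psi> N (Suc k) v))"
    using step[of k l N] M by (auto simp: algebra_simps)
  also have "\<dots> \<le> (real l + 1) * (\<Sum>g<k. q * (1 - q) ^ g * SL g) + (real k + 1) * (\<Sum>g<l. q * (1 - q) ^ g * SR g)"
    by (intro add_mono mult_left_mono SL_sum SR_sum) auto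
  finally have "c - \<Psi> (Suc N) (Suc k) (Suc l)
      \<le> ((real l + 1) * (\<Sum>g<k. q * (1 - q) ^ g * SL g) + (real k + 1) * (\<Sum>g<l. q * (1 - q) ^ g * SR g))
           / (real k + real l + 2)"
    by (simp add: le_divide_eq mult.commute)
  also note pile
  finally show ?case by (simp add: \<eta>[symmetric])
qed

end

section \<open>Product potentials\<close>

fun num_particles :: "site_state \<Rightarrow> nat" where
  "num_particles Sleepy = 1"
| "num_particles (Active k) = k"

context arw_cycle
begin

text \<open>A jump from \<open>x\<close> to \<open>y\<close> multiplies the weight by h y / h x, so
  a drift inequality for a single walker at the toppled site carries over to the whole
  configuration. Sleepers keep their factor, which makes falling asleep neutral.\<close>

definition weight :: "(nat \<Rightarrow> real) \<Rightarrow> config \<Rightarrow> real" where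
  "weight h \<eta> = (\<Prod>x<n. h x ^ num_particles (\<eta> x))"

lemma weight_upd:
  assumes "x < n" "h x \<noteq> 0"
  shows "weight h (\<eta>(x := a)) = weight h \<eta> * h x ^ num_particles a / h x ^ num_particles (\<eta> x)"
proof -
  have "weight h \<xi> = h x ^ num_particles (\<xi> x) * (\<Prod>y\<in>{..<n} - {x}. h y ^ num_particles (\<xi> y))" for \<xi>
    unfolding weight_def using assms by (intro prod.remove) auto
  note 1 = this[of \<eta>] and 2 = this[of "\<eta>(x := a)"]
  have "(\<Prod>y\<in>{..<n} - {x}. h y ^ num_particles ((\<eta>(x := a)) y))
      = (\<Prod>y\<in>{..<n} - {x}. h y ^ num_particles (\<eta> y))"
    by (intro prod.cong) auto
  then show ?thesis using assms unfolding 1 2 by simp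
qed

lemma weight_try_sleep: "weight h (try_sleep x \<eta>) = weight h \<eta>"
  unfolding weight_def try_sleep_def by (intro prod.cong) auto

lemma weight_jump:
  assumes x: "active n x \<eta>" and y: "y < n" "y \<noteq> x" and h: "\<And>z. 0 < h z"
  shows "weight h (jump x y \<eta>) = weight h \<eta> * h y / h x"
proof -
  obtain k where k: "\<eta> x = Active (Suc k)" using activeD[OF x] by auto
  have nz: "h z \<noteq> 0" for z using h[of z] by simp
  have add: "num_particles (add_particle s) = Suc (num_particles s)" for s by (cases s) auto
  have "jump x y \<eta> = (\<eta>(x := Active k))(y := add_particle (\<eta> y))"
    using k y by (simp add: jump_def)
  then have "weight h (jump x y \<eta>) = weight h (\<eta>(x := Active k)) * h y"
    using y nz by (simp add: weight_upd add)
  also have "weight h (\<eta>(x := Active k)) = weight h \<eta> / h x"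
    using x nz k by (simp add: weight_upd active_def)
  finally show ?thesis by simp
qed

lemma weight_exec:
  assumes "active n x \<eta>" "i \<noteq> Slp" "\<And>z. 0 < h z"
  shows "weight h (exec n i x \<eta>) = weight h \<eta> * h (dest n x i) / h x"
proof -
  have "x < n" using assms by (simp add: active_def)
  then show ?thesis
    using assms weight_jump[of x \<eta> "dest n x i" h] dest_less dest_neq by (simp add: exec_def)
qed

lemma weight_pos: "(\<And>z. 0 < h z) \<Longrightarrow> 0 < weight h \<eta>"
  unfolding weight_def by (intro prod_pos) auto

lemma weight_ge_1: "(\<And>z. 1 \<le> h z) \<Longrightarrow> 1 \<le> weight h \<eta>"
  unfolding weight_def by (intro prod_ge_1) auto

lemma weight_mono: "(\<And>z. 0 \<le> h z) \<Longrightarrow> (\<And>z. h z \<le> h' z) \<Longrightarrow> weight h \<eta> \<le> weight h' \<eta>"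
  unfolding weight_def by (intro prod_mono) (auto intro: power_mono)

lemma val_try_sleep: "val f m \<eta> Q \<le> val f m (try_sleep x \<eta>) Q"
proof (cases "\<eta> x = Active 1")
  case True
  then have "\<eta> = (try_sleep x \<eta>)(x := Active 1)" "try_sleep x \<eta> x = Sleepy"
    by (auto simp: try_sleep_def)
  then show ?thesis using val_wake[of "try_sleep x \<eta>" x f m Q] by simp
qed (simp add: try_sleep_def)

text \<open>
  Only sites in \<open>A\<close> are toppled. A sleep instruction may be ignored, by waking the particle
  again, in which case \<open>sl\<close> is the identity.
\<close>

theorem run_lower_bound:
  fixes \<Phi> :: "config \<Rightarrow> real"
  assumes h: "\<And>z. 1 \<le> h z" and \<rho>: "0 \<le> \<rho>"
    and decay: "\<And>x. x < n \<Longrightarrow> x \<in> A \<Longrightarrow>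
      avg (\<lambda>i. if f x i then 0 else h (dest n x i)) \<le> \<rho> * h x"
    and slp: "\<And>x. x \<in> A \<Longrightarrow> \<not> f x Slp"
    and sl: "sl = (\<lambda>x \<eta>. \<eta>) \<or> sl = try_sleep"
    and inv: "\<And>x \<eta>. Inv \<eta> \<Longrightarrow> active n x \<eta> \<Longrightarrow> x \<in> A \<Longrightarrow> Inv (sl x \<eta>)"
      "\<And>x \<eta> i. Inv \<eta> \<Longrightarrow> active n x \<eta> \<Longrightarrow> x \<in> A \<Longrightarrow> i \<noteq> Slp \<Longrightarrow> Inv (exec n i x \<eta>)"
    and \<Phi>1: "\<And>\<eta>. Inv \<eta> \<Longrightarrow> \<Phi> \<eta> \<le> 1"
    and \<Phi>: "\<And>x \<eta>. Inv \<eta> \<Longrightarrow> active n x \<eta> \<Longrightarrow> x \<in> A \<Longrightarrow>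
      \<Phi> \<eta> \<le> avg (\<lambda>i. if f x i then 0 else \<Phi> (if i = Slp then sl x \<eta> else exec n i x \<eta>))"
    and fin: "\<And>\<eta>. Inv \<eta> \<Longrightarrow> (\<And>x. active n x \<eta> \<Longrightarrow> x \<notin> A) \<Longrightarrow> \<Phi> \<eta> \<le> val f m' \<eta> (\<lambda>_. [])"
    and "Inv \<eta>"
  shows "\<Phi> \<eta> - \<rho> ^ m * weight h \<eta> \<le> val f (m + m') \<eta> (\<lambda>_. [])"
proof -
  have mono: "val f m' \<eta> Q \<le> val f (m + m') \<eta> Q" for m \<eta> Q
  proof (induction m)
    case (Suc m)
    then show ?case using val_mono[of f "m + m'" \<eta> Q] by (simp del: val.simps)
  qed simp
  have h0: "0 < h z" for z using h[of z] by simp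
  have quiet: "\<Phi> \<eta> - \<rho> ^ m * weight h \<eta> \<le> val f (m + m') \<eta> (\<lambda>_. [])"
    if "Inv \<eta>" "\<And>x. active n x \<eta> \<Longrightarrow> x \<notin> A" for m \<eta>
  proof -
    have "0 \<le> \<rho> ^ m * weight h \<eta>"
      by (intro mult_nonneg_nonneg zero_le_power \<rho> less_imp_le weight_pos h0)
    then show ?thesis using fin[OF that] mono[of \<eta> "\<lambda>_. []" m] by linarith
  qed
  show ?thesis
    using \<open>Inv \<eta>\<close>
  proof (induction m arbitrary: \<eta>)
    case 0
    show ?case
    proof (cases "\<exists>x. active n x \<eta> \<and> x \<in> A")
      case True
      \<comment> \<open>As long as a site of \<open>A\<close> is active, the weight is at least 1
        and \<Phi> at most 1, so the left-hand side is not positive.\<close>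
      then show ?thesis
        using \<Phi>1[OF 0] weight_ge_1[of h \<eta>, OF h] val_bounds(1)[of f "0 + m'" \<eta> "\<lambda>_. []"]
        by (simp del: val.simps)
    qed (use quiet[OF 0, of 0] in auto)
  next
    case (Suc m)
    show ?case
    proof (cases "\<exists>x. active n x \<eta> \<and> x \<in> A")
      case True
      then obtain x where x: "active n x \<eta>" "x \<in> A" by auto
      then have xn: "x < n" by (simp add: active_def)
      \<comment> \<open>The weight without the factor of the moving particle: executing
        \<open>i\<close> turns the error term into \<open>w * h (dest n x i)\<close>, whose average
        is then bounded by \<open>decay\<close>.\<close>
      define w where "w = \<rho> ^ m * weight h \<eta> / h x"
      have w: "0 \<le> w" using \<rho> weight_pos[of h \<eta>, OF h0] h0[of x] by (simp add: w_def)
      have term_le: "(if f x i then 0 else \<Phi> (if i = Slp then sl x \<eta> else exec n i x \<eta>))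
          + - w * (if f x i then 0 else h (dest n x i))
          \<le> (if f x i then 0 else val f (m + m') (exec n i x \<eta>) (\<lambda>_. []))" for i
      proof (cases "i = Slp")
        case True
        have "weight h (sl x \<eta>) = weight h \<eta>" using sl by (auto simp: weight_try_sleep)
        then have "\<Phi> (sl x \<eta>) - w * h x \<le> val f (m + m') (sl x \<eta>) (\<lambda>_. [])"
          using Suc.IH[OF inv(1)[OF Suc.prems x]] h0[of x] by (simp add: w_def)
        also have "\<dots> \<le> val f (m + m') (try_sleep x \<eta>) (\<lambda>_. [])"
          using sl val_try_sleep by auto
        finally show ?thesis using True by (simp add: exec_def)
      next
        case False
        then show ?thesis
          using Suc.IH[OF inv(2)[OF Suc.prems x False]] weight_exec[OF x(1) False, of h] h0
          by (simp add: w_def)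
      qed
      have "\<Phi> \<eta> - \<rho> ^ Suc m * weight h \<eta> = \<Phi> \<eta> + - w * (\<rho> * h x)"
        using h0[of x] by (simp add: w_def)
      also have "\<dots> \<le> avg (\<lambda>i. if f x i then 0 else \<Phi> (if i = Slp then sl x \<eta> else exec n i x \<eta>))
          + - w * avg (\<lambda>i. if f x i then 0 else h (dest n x i))"
        using \<Phi>[OF Suc.prems x] mult_left_mono[OF decay[OF xn x(2)] w] by simp
      also have "\<dots> \<le> avg (\<lambda>i. if f x i then 0 else val f (m + m') (exec n i x \<eta>) (\<lambda>_. []))"
        unfolding avg_mult[symmetric] avg_add[symmetric] by (intro avg_mono term_le)
      also have "\<dots> = val f (Suc (m + m')) \<eta> (\<lambda>_. [])"
        by (simp only: val_topple[OF x(1)] topple_Nil)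
      finally show ?thesis by simp
    qed (use quiet[OF Suc.prems, of "Suc m"] in auto)
  qed
qed

text \<open>Makes eventual stabilisation quantitative: the probability of still toppling after
  \<open>m\<close> steps, without a forbidden instruction so far, is at most
  \<open>\<rho> ^ m * weight h \<eta>\<close>.\<close>

corollary val_ge_sval:
  assumes "\<And>z. 1 \<le> h z" "0 \<le> \<rho>"
    and "\<And>x. x < n \<Longrightarrow> avg (\<lambda>i. if f x i then 0 else h (dest n x i)) \<le> \<rho> * h x"
    and "\<And>x. \<not> f x Slp"
  shows "sval f \<eta> (\<lambda>_. []) - \<rho> ^ m * weight h \<eta> \<le> val f m \<eta> (\<lambda>_. [])"
proof -
  have "sval f \<eta> (\<lambda>_. []) - \<rho> ^ m * weight h \<eta> \<le> val f (m + 0) \<eta> (\<lambda>_. [])"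
  proof (rule run_lower_bound[where A = UNIV and sl = try_sleep and Inv = "\<lambda>_. True"])
    fix x \<eta> assume x: "active n x \<eta>"
    have "(if i = Slp then try_sleep x \<eta> else exec n i x \<eta>) = exec n i x \<eta>" for i
      by (simp add: exec_def)
    then show "sval f \<eta> (\<lambda>_. []) \<le> avg (\<lambda>i. if f x i then 0
        else sval f (if i = Slp then try_sleep x \<eta> else exec n i x \<eta>) (\<lambda>_. []))"
      by (simp only: sval_topple[OF x] topple_Nil)
  next
    fix \<eta> assume "\<And>x. active n x \<eta> \<Longrightarrow> x \<notin> UNIV"
    then show "sval f \<eta> (\<lambda>_. []) \<le> val f 0 \<eta> (\<lambda>_. [])"
      using sval_bounds by (auto simp: all_asleep_iff)
  qed (use assms sval_bounds in auto)
  then show ?thesis by simp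
qed

end

section \<open>Division of the cycle into blocks\<close>

locale arw_blocks = arw_cycle +
  fixes s :: "nat \<Rightarrow> nat" and B L :: nat
  assumes s_0: "s 0 = 0" and s_B: "s B = n"
    and gap: "\<And>j. j < B \<Longrightarrow> s (Suc j) = s j + L \<or> s (Suc j) = s j + L + 1"
    and L2: "2 \<le> L"
begin

lemma B_pos: "0 < B"
  using s_0 s_B n2 by (cases B) auto

lemma s_Suc: "j < B \<Longrightarrow> s j < s (Suc j)"
  using gap[of j] L2 by auto

lemma s_mono: "i \<le> j \<Longrightarrow> j \<le> B \<Longrightarrow> s i \<le> s j"
proof (induction j)
  case (Suc j)
  then show ?case using s_Suc[of j] by (cases "i = Suc j") auto
qed simp

lemma s_le_n: "j \<le> B \<Longrightarrow> s j \<le> n"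
  using s_mono[of j B] s_B by simp

definition blk :: "nat \<Rightarrow> nat" where
  "blk t = (SOME j. j < B \<and> s j \<le> t \<and> t < s (Suc j))"

lemma blk_eq:
  assumes "j < B" "s j \<le> t" "t < s (Suc j)"
  shows "blk t = j"
proof -
  have "i = j" if "i < B" "s i \<le> t" "t < s (Suc i)" for i
  proof (rule ccontr)
    assume "i \<noteq> j"
    then consider "Suc i \<le> j" | "Suc j \<le> i" by linarith
    then show False
    proof cases
      case 1
      then show ?thesis using s_mono[of "Suc i" j] assms that by simp
    next
      case 2
      then show ?thesis using s_mono[of "Suc j" i] assms that by simp
    qed
  qed
  with assms show ?thesis unfolding blk_def by (intro some_equality) blast+
qed

lemma blk_exists:
  assumes "t < n"
  obtains j where "j < B" "s j \<le> t" "t < s (Suc j)" "blk t = j"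
proof -
  have "\<exists>j<k. s j \<le> t \<and> t < s (Suc j)" if "k \<le> B" "t < s k" for k
    using that
  proof (induction k)
    case 0
    then show ?case using s_0 by simp
  next
    case (Suc k)
    show ?case
    proof (cases "t < s k")
      case True
      with Suc.IH Suc.prems obtain j where "j < k" "s j \<le> t \<and> t < s (Suc j)" by auto
      then show ?thesis by (intro exI[of _ j]) auto
    next
      case False
      then show ?thesis using Suc by (intro exI[of _ k]) auto
    qed
  qed
  from this[of B] assms s_B obtain j where "j < B" "s j \<le> t" "t < s (Suc j)" by auto
  then show ?thesis using that blk_eq by blast
qed

definition half :: nat where
  "half = L div 2"

lemma half_less: "half < L"
  using L2 by (simp add: half_def)

lemma L_le_n: "L \<le> n"
  using gap[of 0] B_pos s_le_n[of "Suc 0"] s_0 by auto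

definition centre :: "nat \<Rightarrow> nat" where
  "centre j = s j + half"

lemma centre_block: "j < B \<Longrightarrow> s j \<le> centre j \<and> centre j < s (Suc j)"
  using gap[of j] half_less by (auto simp: centre_def)

lemma centre_less: "j < B \<Longrightarrow> centre j < n"
  using centre_block[of j] s_le_n[of "Suc j"] by simp

text \<open>The coordinate in which the centres are the block boundaries \<open>s j\<close>.\<close>

definition shift :: "nat \<Rightarrow> nat" where
  "shift x = (x + (n - half)) mod n"

lemma shift_less: "shift x < n"
  using n2 by (simp add: shift_def)

lemma shift_Rgt: "shift (dest n x Rgt) = (shift x + 1) mod n"
proof -
  have "((x + 1) mod n + (n - half)) mod n = (x + 1 + (n - half)) mod n" by (rule mod_add_left_eq)
  also have "\<dots> = (x + (n - half) + 1) mod n" by (simp only: ac_simps)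
  also have "\<dots> = ((x + (n - half)) mod n + 1) mod n" by (rule mod_add_left_eq[symmetric])
  finally show ?thesis by (simp add: shift_def)
qed

lemma shift_Lft:
  assumes "0 < shift x"
  shows "shift (dest n x Lft) = shift x - 1"
proof -
  have "((x + (n - 1)) mod n + (n - half)) mod n = (x + (n - 1) + (n - half)) mod n" by (rule mod_add_left_eq)
  also have "\<dots> = (x + (n - half) + (n - 1)) mod n" by (simp only: ac_simps)
  also have "\<dots> = ((x + (n - half)) mod n + (n - 1)) mod n" by (rule mod_add_left_eq[symmetric])
  also have "\<dots> = (shift x + (n - 1)) mod n" by (simp add: shift_def)
  also have "shift x + (n - 1) = (shift x - 1) + n" using assms n2 by simp
  also have "((shift x - 1) + n) mod n = shift x - 1" using shift_less[of x] by simp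
  finally show ?thesis using n2 by (simp add: shift_def)
qed

lemma shift_centre: "j < B \<Longrightarrow> shift (centre j) = s j"
proof -
  assume j: "j < B"
  have "centre j + (n - half) = s j + n" using half_less L_le_n by (simp add: centre_def)
  moreover have "s j < n" using s_Suc[OF j] s_le_n[of "Suc j"] j by simp
  ultimately show ?thesis by (simp add: shift_def)
qed

lemma shift_bij: "bij_betw shift {..<n} {..<n}"
proof -
  have "inj_on shift {..<n}"
  proof (rule inj_onI)
    fix x y assume "x \<in> {..<n}" "y \<in> {..<n}" and eq: "shift x = shift y"
    moreover have "(shift z + half) mod n = z" if "z < n" for z
    proof -
      have "((z + (n - half)) mod n + half) mod n = (z + (n - half) + half) mod n" by (rule mod_add_left_eq)
      also have "z + (n - half) + half = z + n" using half_less L_le_n by simp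
      finally show ?thesis using that by (simp add: shift_def)
    qed
    ultimately show "x = y" by (metis lessThan_iff)
  qed
  moreover have "shift ` {..<n} \<subseteq> {..<n}" using shift_less by auto
  ultimately show ?thesis by (simp add: bij_betw_def endo_inj_surj)
qed

section \<open>Functions given by one formula between consecutive centres\<close>

definition profile :: "(nat \<Rightarrow> nat \<Rightarrow> real) \<Rightarrow> nat \<Rightarrow> real" where
  "profile G t = G (blk (t mod n)) (t mod n)"

text \<open>The formulas of neighbouring blocks agree at their common boundary, cyclically. The
  formula of block \<open>j\<close> is therefore valid at its right end too, even for the last
  block, whose right end n is identified with 0.\<close>

lemma profile_eq:
  assumes comp: "\<And>j. j < B \<Longrightarrow> G j (s (Suc j)) = G (Suc j mod B) (s (Suc j mod B))"
    and j: "j < B" "s j \<le> t" "t \<le> s (Suc j)"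
  shows "profile G t = G j t"
proof (cases "t < s (Suc j)")
  case True
  then have "t < n" using s_le_n[of "Suc j"] j by simp
  then show ?thesis using blk_eq[of j t] j True by (simp add: profile_def)
next
  case False
  then have t: "t = s (Suc j)" using j by simp
  define j' where "j' = Suc j mod B"
  have j': "j' < B" using B_pos by (simp add: j'_def)
  have "t mod n = s j'"
  proof (cases "Suc j = B")
    case True
    then show ?thesis using t s_B s_0 by (simp add: j'_def)
  next
    case False
    then have "j' = Suc j" "Suc j < B" using j by (auto simp: j'_def)
    moreover have "s (Suc j) < n" using s_Suc[of "Suc j"] s_le_n[of "Suc (Suc j)"] \<open>Suc j < B\<close> by simp
    ultimately show ?thesis using t by simp
  qed
  moreover have "blk (s j') = j'" using j' s_Suc by (intro blk_eq) auto
  ultimately show ?thesis using comp[OF j(1)] t by (simp add: profile_def j'_def)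
qed

definition sites_off_centre :: "nat set" where
  "sites_off_centre = {x. x < n \<and> (\<forall>j<B. shift x \<noteq> s j)}"

lemma off_centre_nbrs:
  assumes x: "x \<in> sites_off_centre"
    and comp: "\<And>j. j < B \<Longrightarrow> G j (s (Suc j)) = G (Suc j mod B) (s (Suc j mod B))"
  obtains j t where "j < B" "s j < t" "t < s (Suc j)"
    "profile G (shift x) = G j t" "profile G (shift (dest n x Rgt)) = G j (Suc t)"
    "profile G (shift (dest n x Lft)) = G j (t - 1)"
proof -
  obtain j where j: "j < B" "s j \<le> shift x" "shift x < s (Suc j)" by (rule blk_exists[OF shift_less])
  with x have lt: "s j < shift x" by (auto simp: sites_off_centre_def order_less_le)
  note pe = profile_eq[of G, OF comp j(1)]
  have "profile G ((shift x + 1) mod n) = profile G (Suc (shift x))" by (simp add: profile_def)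
  then have "profile G (shift (dest n x Rgt)) = G j (Suc (shift x))"
    unfolding shift_Rgt using pe[of "Suc (shift x)"] j by simp
  moreover have "profile G (shift (dest n x Lft)) = G j (shift x - 1)"
    using lt j pe[of "shift x - 1"] by (subst shift_Lft) auto
  moreover have "profile G (shift x) = G j (shift x)" using pe[of "shift x"] j by simp
  ultimately show ?thesis using that j(1,3) lt by blast
qed

section \<open>Parabolic functions that decay along the walk\<close>

definition width :: real where
  "width = real L + 2"

definition rate :: real where
  "rate = 1 - (1 - q) / (2 * width\<^sup>2)"

lemma width_ge: "4 \<le> width"
  using L2 by (simp add: width_def)

lemma rate_nonneg: "0 \<le> rate"
proof -
  have "1 \<le> width\<^sup>2" using width_ge by (intro one_le_power) auto
  then have "(1 - q) \<le> 2 * width\<^sup>2" using q01 by linarith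
  then show ?thesis using \<open>1 \<le> width\<^sup>2\<close> by (simp add: rate_def divide_le_eq)
qed

text \<open>A lazy step lowers the mean by at least (1 - q) / width^2, and since
  \<open>c \<le> 2\<close> this is at least the fraction (1 - q) / (2 width^2) of
  \<open>c\<close>.\<close>

lemma decay_if_second_difference:
  assumes "a + b \<le> 2 * c - 2 / width\<^sup>2" "c \<le> 2"
  shows "q * c + (1 - q) / 2 * a + (1 - q) / 2 * b \<le> rate * c"
proof -
  have "(1 - q) / 2 * (a + b) \<le> (1 - q) / 2 * (2 * c - 2 / width\<^sup>2)"
    using assms q01 by (intro mult_left_mono) auto
  moreover have "(1 - q) / 2 * (2 * c - 2 / width\<^sup>2) = (1 - q) * c - (1 - q) / width\<^sup>2"
  proof -
    have "(1 - q) / 2 * (2 * c - 2 * z) = (1 - q) * c - (1 - q) * z" for z :: real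
      by (simp add: field_simps)
    from this[of "1 / width\<^sup>2"] show ?thesis by simp
  qed
  moreover have "(1 - q) / (2 * width\<^sup>2) * c \<le> (1 - q) / (2 * width\<^sup>2) * 2"
    using assms q01 by (intro mult_left_mono) auto
  moreover have "a / (2 * z) * 2 = a / z" for a z :: real by simp
  then have "(1 - q) / (2 * width\<^sup>2) * 2 = (1 - q) / width\<^sup>2" .
  moreover have "rate * c = c - (1 - q) / (2 * width\<^sup>2) * c" by (simp add: rate_def algebra_simps)
  moreover have "(1 - q) / 2 * (a + b) = (1 - q) / 2 * a + (1 - q) / 2 * b" by (simp add: field_simps)
  moreover have "q * c + (1 - q) * c = c" by (simp add: algebra_simps)
  ultimately show ?thesis by linarith
qed

text \<open>The product is the expected exit time of a simple walk from the interval between two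
  centres, here scaled into [0, 1] and raised by 1 so that the weight stays at least 1.\<close>

definition G1 :: "nat \<Rightarrow> nat \<Rightarrow> real" where
  "G1 j t = 1 + (real t - real (s j)) * (real (s (Suc j)) - real t) / width\<^sup>2"

definition h1 :: "nat \<Rightarrow> real" where
  "h1 x = profile G1 (shift x)"

lemma G1_comp: "j < B \<Longrightarrow> G1 j (s (Suc j)) = G1 (Suc j mod B) (s (Suc j mod B))"
  by (simp add: G1_def)

lemma h1_bounds: "1 \<le> h1 x" "h1 x \<le> 2"
proof -
  define t where "t = shift x"
  obtain j where j: "j < B" "s j \<le> t" "t < s (Suc j)" "blk t = j"
    unfolding t_def by (rule blk_exists[OF shift_less])
  have h: "h1 x = G1 j t" using j shift_less[of x] by (simp add: h1_def profile_def t_def)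
  have "real t - real (s j) \<le> width" "real (s (Suc j)) - real t \<le> width"
    using gap[OF j(1)] j by (auto simp: width_def)
  then have "(real t - real (s j)) * (real (s (Suc j)) - real t) \<le> width * width"
    using j width_ge by (intro mult_mono) auto
  then show "1 \<le> h1 x" "h1 x \<le> 2"
    using j width_ge unfolding h G1_def by (auto simp: power2_eq_square divide_le_eq)
qed

lemma h1_decay:
  assumes "x \<in> sites_off_centre"
  shows "avg (\<lambda>i. h1 (dest n x i)) \<le> rate * h1 x"
proof -
  obtain j t where j: "j < B" "s j < t" "t < s (Suc j)"
    and v: "h1 x = G1 j t" "h1 (dest n x Rgt) = G1 j (Suc t)" "h1 (dest n x Lft) = G1 j (t - 1)"
    using off_centre_nbrs[OF assms, of G1] G1_comp unfolding h1_def by metis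
  have t1: "real (t - 1) = real t - 1" using j by simp
  have "(real t + 1 - a) * (b - (real t + 1)) + (real t - 1 - a) * (b - (real t - 1))
      = 2 * ((real t - a) * (b - real t)) - 2" for a b :: real
    by (simp add: algebra_simps)
  note e = this[of "real (s j)" "real (s (Suc j))"]
  have "G1 j (Suc t) + G1 j (t - 1) = 2 * G1 j t - 2 / width\<^sup>2"
    using e unfolding G1_def t1
    by (simp add: add_divide_distrib[symmetric] diff_divide_distrib[symmetric] add.commute)
  then have "q * h1 x + (1 - q) / 2 * h1 (dest n x Rgt) + (1 - q) / 2 * h1 (dest n x Lft) \<le> rate * h1 x"
    using h1_bounds[of x] unfolding v by (intro decay_if_second_difference) auto
  then show ?thesis by (simp add: avg_def)
qed

section \<open>Hitting probabilities of the centres\<close>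

definition tent :: "nat \<Rightarrow> nat \<Rightarrow> nat \<Rightarrow> real" where
  "tent i j t = (of_bool (j = i) * (real (s (Suc j)) - real t)
     + of_bool (Suc j mod B = i) * (real t - real (s j))) / (real (s (Suc j)) - real (s j))"

text \<open>\<open>tent i\<close> interpolates linearly between 1 at centre \<open>i\<close> and 0
  at the other centres, hence is the probability of first reaching a centre at \<open>i\<close>. So
  \<open>pile_mgf\<close> is the exponential moment of the indicator of this event for one walker,
  and its \<open>weight\<close> that of the number of particles which gather at centre
  \<open>i\<close>. For \<open>B = 1\<close> both ramps belong to the same block and add up to
  1.\<close>

definition pile_mgf :: "real \<Rightarrow> nat \<Rightarrow> nat \<Rightarrow> real" where
  "pile_mgf \<theta> i x = 1 + (exp \<theta> - 1) * profile (tent i) (shift x)"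

lemma tent_comp: "j < B \<Longrightarrow> tent i j (s (Suc j)) = tent i (Suc j mod B) (s (Suc j mod B))"
proof -
  assume j: "j < B"
  define j' where "j' = Suc j mod B"
  have "j' < B" using B_pos by (simp add: j'_def)
  then show ?thesis
    using s_Suc[OF j] s_Suc[of j'] unfolding tent_def j'_def[symmetric] by auto
qed

lemma tent_nonneg: "j < B \<Longrightarrow> s j \<le> t \<Longrightarrow> t \<le> s (Suc j) \<Longrightarrow> 0 \<le> tent i j t"
  unfolding tent_def by (intro divide_nonneg_nonneg add_nonneg_nonneg mult_nonneg_nonneg) auto

lemma profile_tent_nonneg: "0 \<le> profile (tent i) (shift x)"
proof -
  obtain j where j: "j < B" "s j \<le> shift x" "shift x < s (Suc j)" by (rule blk_exists[OF shift_less])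
  then show ?thesis using profile_eq[of "tent i" j, OF tent_comp] tent_nonneg by simp
qed

lemma pile_mgf_ge_1: "0 \<le> \<theta> \<Longrightarrow> 1 \<le> pile_mgf \<theta> i x"
  using profile_tent_nonneg by (simp add: pile_mgf_def)

lemma pile_mgf_centre: "i < B \<Longrightarrow> exp \<theta> \<le> pile_mgf \<theta> i (centre i)" if "0 \<le> \<theta>"
proof -
  assume i: "i < B"
  have "profile (tent i) (s i) = tent i i (s i)"
    using i s_Suc[OF i] by (intro profile_eq tent_comp) auto
  also have "\<dots> = 1" using s_Suc[OF i] by (simp add: tent_def)
  finally show ?thesis using shift_centre[OF i] by (simp add: pile_mgf_def)
qed

lemma pile_mgf_harmonic:
  assumes "x \<in> sites_off_centre"
  shows "avg (\<lambda>k. pile_mgf \<theta> i (dest n x k)) = pile_mgf \<theta> i x"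
proof -
  obtain j t where j: "j < B" "s j < t" "t < s (Suc j)"
    and v: "profile (tent i) (shift x) = tent i j t"
      "profile (tent i) (shift (dest n x Rgt)) = tent i j (Suc t)"
      "profile (tent i) (shift (dest n x Lft)) = tent i j (t - 1)"
    using off_centre_nbrs[OF assms, of "tent i"] tent_comp by metis
  have t1: "real (t - 1) = real t - 1" using j by simp
  have "tent i j (Suc t) + tent i j (t - 1) = 2 * tent i j t"
    unfolding tent_def t1 by (simp add: add_divide_distrib[symmetric] algebra_simps)
  note sd = this
  have "pile_mgf \<theta> i (dest n x Rgt) + pile_mgf \<theta> i (dest n x Lft)
      = 2 + (exp \<theta> - 1) * (tent i j (Suc t) + tent i j (t - 1))"
    unfolding pile_mgf_def v by (simp add: algebra_simps)
  then have m: "pile_mgf \<theta> i (dest n x Rgt) + pile_mgf \<theta> i (dest n x Lft) = 2 * pile_mgf \<theta> i x"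
    unfolding sd by (simp add: pile_mgf_def v)
  have "avg (\<lambda>k. pile_mgf \<theta> i (dest n x k))
      = q * pile_mgf \<theta> i x + (1 - q) / 2 * (pile_mgf \<theta> i (dest n x Rgt) + pile_mgf \<theta> i (dest n x Lft))"
    unfolding avg_def dest.simps(3) distrib_left by simp
  then show ?thesis unfolding m by (simp add: field_simps)
qed

text \<open>The sum bounds the mean size of a pile, up to the factor \<mu>. A descending ramp over a
  block of length g contributes (g + 1) / 2 and the ascending ramp over the preceding block of
  length g' contributes (g' - 1) / 2, with lengths at most L + 1.\<close>

lemma sum_profile_tent:
  assumes i: "i < B"
  shows "(\<Sum>x<n. profile (tent i) (shift x)) \<le> real L + 1"
proof -
  have blocks: "(\<Sum>t<s k. profile (tent i) t) = (\<Sum>j<k. \<Sum>t=s j..<s (Suc j). tent i j t)" if "k \<le> B" for k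
    using that
  proof (induction k)
    case 0
    then show ?case by (simp add: s_0)
  next
    case (Suc k)
    have "(\<Sum>t<s (Suc k). profile (tent i) t)
        = (\<Sum>t<s k. profile (tent i) t) + (\<Sum>t=s k..<s (Suc k). profile (tent i) t)"
    proof -
      have u: "{..<s (Suc k)} = {..<s k} \<union> {s k..<s (Suc k)}"
        using s_Suc[of k] Suc.prems by auto
      have d: "{..<s k} \<inter> {s k..<s (Suc k)} = {}" by auto
      show ?thesis by (subst u) (rule sum.union_disjoint[OF finite_lessThan finite_atLeastLessThan d])
    qed
    also have "(\<Sum>t=s k..<s (Suc k). profile (tent i) t) = (\<Sum>t=s k..<s (Suc k). tent i k t)"
      using Suc.prems by (intro sum.cong profile_eq tent_comp) auto
    finally show ?case using Suc by simp
  qed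
  define P where "P j = (\<Sum>t=s j..<s (Suc j). (real (s (Suc j)) - real t) / (real (s (Suc j)) - real (s j)))" for j
  define R where "R j = (\<Sum>t=s j..<s (Suc j). (real t - real (s j)) / (real (s (Suc j)) - real (s j)))" for j
  have lin: "(\<Sum>p<g. real p) = real g * (real g - 1) / 2" for g :: nat
    by (induction g) (auto simp: field_simps)
  have R: "R j = (real (s (Suc j)) - real (s j) - 1) / 2" if "j < B" for j
  proof -
    define g where "g = s (Suc j) - s j"
    have g: "0 < g" "s (Suc j) = s j + g" using s_Suc[OF that] by (auto simp: g_def)
    have "R j = (\<Sum>p<g. real p / real g)"
      unfolding R_def g(2)
      by (rule sum.reindex_bij_witness[of _ "\<lambda>p. p + s j" "\<lambda>t. t - s j"]) auto
    also have "\<dots> = (\<Sum>p<g. real p) / real g" by (simp add: sum_divide_distrib)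
    also have "\<dots> = (real g - 1) / 2" using g by (simp add: lin)
    finally show ?thesis using g by simp
  qed
  have P: "P j = (real (s (Suc j)) - real (s j) + 1) / 2" if "j < B" for j
  proof -
    have "P j + R j = (\<Sum>t=s j..<s (Suc j). 1)"
      unfolding P_def R_def sum.distrib[symmetric]
      using s_Suc[OF that] by (intro sum.cong) (auto simp: add_divide_distrib[symmetric])
    also have "\<dots> = real (s (Suc j)) - real (s j)" using s_Suc[OF that] by simp
    finally show ?thesis using R[OF that] by (simp add: field_simps)
  qed
  \<comment> \<open>The cyclic predecessor of block \<open>i\<close>, the only block that can carry
    the ascending ramp.\<close>
  define i' where "i' = (i + (B - 1)) mod B"
  have i': "i' < B" using B_pos by (simp add: i'_def)
  have uniq: "j = i'" if "j < B" "Suc j mod B = i" for j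
  proof -
    have "i' = (Suc j mod B + (B - 1)) mod B" using that by (simp add: i'_def)
    also have "\<dots> = (Suc j + (B - 1)) mod B" by (rule mod_add_left_eq)
    also have "Suc j + (B - 1) = j + B" using B_pos by simp
    finally show ?thesis using that by simp
  qed
  have "(\<Sum>x<n. profile (tent i) (shift x)) = (\<Sum>t<n. profile (tent i) t)"
    using sum.reindex_bij_betw[OF shift_bij] .
  also have "\<dots> = (\<Sum>j<B. \<Sum>t=s j..<s (Suc j). tent i j t)" using blocks[of B] s_B by simp
  also have "\<dots> = (\<Sum>j<B. of_bool (j = i) * P j + of_bool (Suc j mod B = i) * R j)"
    unfolding P_def R_def tent_def by (simp add: add_divide_distrib sum.distrib sum_distrib_left)
  also have "\<dots> \<le> (\<Sum>j<B. of_bool (j = i) * P j + of_bool (j = i') * R j)"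
  proof (intro sum_mono add_left_mono)
    fix j assume "j \<in> {..<B}"
    then have j: "j < B" by simp
    then have R0: "0 \<le> R j" unfolding R_def using s_Suc[OF j] by (intro sum_nonneg divide_nonneg_nonneg) auto
    show "of_bool (Suc j mod B = i) * R j \<le> of_bool (j = i') * R j"
    proof (cases "Suc j mod B = i")
      case True
      then have "j = i'" by (rule uniq[OF j])
      with True show ?thesis by simp
    qed (simp add: R0)
  qed
  also have "\<dots> = P i + R i'"
  proof -
    have delta: "(\<Sum>j<B. of_bool (j = k) * F j) = F k" if "k < B" for k and F :: "nat \<Rightarrow> real"
    proof -
      have "(\<Sum>j<B. of_bool (j = k) * F j) = (\<Sum>j<B. if j = k then F j else 0)"
        by (intro sum.cong) auto
      then show ?thesis using that by simp
    qed
    show ?thesis unfolding sum.distrib using delta[OF i] delta[OF i'] by simp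
  qed
  also have "\<dots> \<le> (real L + 1 + 1) / 2 + (real L + 1 - 1) / 2"
    unfolding P[OF i] R[OF i'] using gap[OF i] gap[OF i'] by (intro add_mono divide_right_mono) auto
  finally show ?thesis by (simp add: field_simps)
qed

section \<open>Walks that must not leave their block\<close>

definition cut :: "nat \<Rightarrow> instr \<Rightarrow> bool" where
  "cut x i \<longleftrightarrow> i = Rgt \<and> (\<exists>j\<le>B. Suc x = s j) \<or> i = Lft \<and> (\<exists>j\<le>B. x = s j)"

lemma cut_Slp: "\<not> cut x Slp"
  by (simp add: cut_def)

lemma not_boundary:
  assumes "j < B" "s j < t" "t < s (Suc j)" "k \<le> B"
  shows "t \<noteq> s k"
proof (cases "k \<le> j")
  case True
  then show ?thesis using s_mono[of k j] assms by auto
next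
  case False
  then show ?thesis using s_mono[of "Suc j" k] assms by auto
qed

definition h2 :: "nat \<Rightarrow> real" where
  "h2 x = (if x < n then 2 - ((real x - real (s (blk x))) / width)\<^sup>2 else 1)"

lemma h2_block: "j < B \<Longrightarrow> s j \<le> x \<Longrightarrow> x < s (Suc j) \<Longrightarrow> h2 x = 2 - ((real x - real (s j)) / width)\<^sup>2"
  using blk_eq[of j x] s_le_n[of "Suc j"] by (auto simp: h2_def)

lemma h2_bounds: "1 \<le> h2 x" "h2 x \<le> 2"
proof -
  have "1 \<le> h2 x \<and> h2 x \<le> 2"
  proof (cases "x < n")
    case True
    obtain j where j: "j < B" "s j \<le> x" "x < s (Suc j)" by (rule blk_exists[OF True])
    then have "0 \<le> (real x - real (s j)) / width" "(real x - real (s j)) / width \<le> 1"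
      using gap[OF j(1)] width_ge by (auto simp: width_def divide_le_eq)
    then show ?thesis using h2_block[OF j] by (simp add: power_le_one)
  qed (simp add: h2_def)
  then show "1 \<le> h2 x" "h2 x \<le> 2" by auto
qed

text \<open>Inside a block \<open>h2\<close> is a concave parabola with second difference -2 /
  width^2. A jump across the block boundary counts as 0, which lies below the continuation of the
  parabola, so the same inequality holds at the end sites.\<close>

lemma h2_decay:
  assumes "x < n"
  shows "avg (\<lambda>i. if cut x i then 0 else h2 (dest n x i)) \<le> rate * h2 x"
proof -
  obtain j where j: "j < B" "s j \<le> x" "x < s (Suc j)" by (rule blk_exists[OF assms])
  define p where "p = real x - real (s j)"
  have p: "0 \<le> p" "p + 1 \<le> width" using j gap[OF j(1)] by (auto simp: p_def width_def)
  have sq1: "(y / width)\<^sup>2 \<le> 1" if "\<bar>y\<bar> \<le> width" for y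
    using that width_ge by (simp add: abs_square_le_1 abs_divide divide_le_eq)
  have R: "(if cut x Rgt then 0 else h2 (dest n x Rgt)) \<le> 2 - ((p + 1) / width)\<^sup>2"
  proof (cases "cut x Rgt")
    case True
    then show ?thesis using sq1[of "p + 1"] p by simp
  next
    case False
    then have "Suc x < s (Suc j)" using j by (auto simp: cut_def order_less_le)
    moreover have "Suc x < n" using calculation s_le_n[of "Suc j"] j by simp
    ultimately show ?thesis using False h2_block[of j "Suc x"] j by (simp add: p_def algebra_simps)
  qed
  have Lf: "(if cut x Lft then 0 else h2 (dest n x Lft)) \<le> 2 - ((p - 1) / width)\<^sup>2"
  proof (cases "cut x Lft")
    case True
    moreover have "\<bar>p - 1\<bar> \<le> width" using p width_ge by linarith
    ultimately show ?thesis using sq1[of "p - 1"] by simp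
  next
    case False
    then have "s j < x" using j by (auto simp: cut_def order_less_le)
    then obtain y where y: "x = Suc y" "s j \<le> y" by (cases x) auto
    moreover have "dest n x Lft = y" using dest_Lft[of y] y assms by simp
    ultimately show ?thesis using False h2_block[of j y] j by (simp add: p_def algebra_simps)
  qed
  have c: "h2 x = 2 - (p / width)\<^sup>2" using h2_block[OF j] by (simp add: p_def)
  have "(if cut x Rgt then 0 else h2 (dest n x Rgt)) + (if cut x Lft then 0 else h2 (dest n x Lft))
      \<le> (2 - ((p + 1) / width)\<^sup>2) + (2 - ((p - 1) / width)\<^sup>2)" by (rule add_mono[OF R Lf])
  also have "\<dots> = 2 * h2 x - 2 / width\<^sup>2"
    unfolding c using width_ge by (simp add: power_divide field_simps power2_eq_square)
  finally have "q * h2 x + (1 - q) / 2 * (if cut x Rgt then 0 else h2 (dest n x Rgt))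
      + (1 - q) / 2 * (if cut x Lft then 0 else h2 (dest n x Lft)) \<le> rate * h2 x"
    using h2_bounds(2) by (rule decay_if_second_difference)
  then show ?thesis by (simp only: avg_def cut_Slp if_False dest.simps(3))
qed

end

section \<open>Emptying all blocks of the cycle\<close>

context arw_blocks
begin

lemma centre_inj: "i < B \<Longrightarrow> j < B \<Longrightarrow> s j \<le> centre i \<Longrightarrow> centre i < s (Suc j) \<Longrightarrow> i = j"
  using blk_eq[of i "centre i"] blk_eq[of j "centre i"] centre_block[of i] by simp

text \<open>The blocks are emptied from left to right, and \<open>cut\<close> ensures that this does
  not disturb the piles still waiting. Failures add up as in a union bound. A pile larger than
  \<open>C\<close> has \<open>bad\<close> at least 1, which makes the claim trivial.\<close>

theorem piles_lower_bound:
  fixes \<Psi> :: "nat \<Rightarrow> nat \<Rightarrow> nat \<Rightarrow> real"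
  assumes nonneg: "\<And>N u v. 0 \<le> \<Psi> N u v"
    and bdry: "\<And>N u. 0 < u \<Longrightarrow> 1 \<le> \<Psi> N 0 u" "\<And>N u. 0 < u \<Longrightarrow> 1 \<le> \<Psi> N u 0"
    and step: "\<And>N k l. k + l < L + 1 \<Longrightarrow>
        (real l + 1) * gap_avg k (\<lambda>u. \<Psi> N u (Suc l)) + (real k + 1) * gap_avg l (\<lambda>v. \<Psi> N (Suc k) v)
          \<le> (real k + real l + 2) * \<Psi> (Suc N) (Suc k) (Suc l)"
    and start: "\<And>N k l. real N \<le> C \<Longrightarrow> L \<le> k + l + 1 \<Longrightarrow> k + l + 1 \<le> L + 1 \<Longrightarrow>
        \<bar>real k - real l\<bar> \<le> 1 \<Longrightarrow> \<Psi> N (Suc k) (Suc l) \<le> bad N"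
    and bad: "\<And>N. 0 \<le> bad N" "\<And>N. C < real N \<Longrightarrow> 1 \<le> bad N"
    and "j \<le> B"
    and "\<And>z. z < s j \<Longrightarrow> num_active (\<eta> z) = 0"
    and "\<And>i. j \<le> i \<Longrightarrow> i < B \<Longrightarrow> \<eta> (centre i) = Active (N i)"
    and "\<And>z. s j \<le> z \<Longrightarrow> z < n \<Longrightarrow> (\<And>i. i < B \<Longrightarrow> z \<noteq> centre i) \<Longrightarrow> \<eta> z = Active 0"
    and "\<And>z. s j \<le> z \<Longrightarrow> z < n \<Longrightarrow> Q z = []"
  shows "1 - (\<Sum>i=j..<B. bad (N i)) \<le> sval cut \<eta> Q"
  using assms(8-)
proof (induction arbitrary: \<eta> Q rule: inc_induct)
  case base
  have "all_asleep n \<eta>"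
    using base(1) s_B by (auto simp: all_asleep_iff active_def)
  then show ?case by (simp add: sval_stable)
next
  case (step j)
  note asleep = step.prems(1) and pile = step.prems(2) and vac = step.prems(3,4)
  have j: "j < B" by fact
  define c where "c = 1 - (\<Sum>i=Suc j..<B. bad (N i))"
  have c1: "c \<le> 1" using bad by (simp add: c_def sum_nonneg)
  have split: "1 - (\<Sum>i=j..<B. bad (N i)) = c - bad (N j)"
    using j by (simp add: c_def sum.atLeast_Suc_lessThan)
  define l where "l = s (Suc j) - 1 - centre j"
  have cb: "s j \<le> centre j" "centre j < s (Suc j)" using centre_block[OF j] by auto
  have Ml: "centre j + l = s (Suc j) - 1" "centre j + l < s (Suc j)" "centre j - half = s j"
    using cb by (auto simp: l_def centre_def)
  have inblk: "\<eta> z = Active 0" if "s j \<le> z" "z < s (Suc j)" "z \<noteq> centre j" for z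
    using that centre_inj[OF _ j] s_le_n[of "Suc j"] j by (intro vac(1)) auto
  show ?case
  proof (cases "C < real (N j)")
    case True
    then show ?thesis unfolding split using bad(2)[of "N j"] c1 sval_bounds(1)[of cut \<eta> Q] by linarith
  next
    case False
    have "c - \<Psi> (N j) (Suc half) (Suc l) \<le> sval cut \<eta> Q"
    proof (rule block_lower_bound[where a = "s j" and b = "s (Suc j)" and M = "centre j"
          and \<eta>\<^sub>0 = \<eta> and Q\<^sub>0 = Q])
      show "s (Suc j) \<le> n" using s_le_n[of "Suc j"] j by simp
      show "\<not> cut z Slp" for z by (rule cut_Slp)
      show "\<not> cut z Rgt" if "s j \<le> z" "Suc z < s (Suc j)" for z
        using not_boundary[OF j, of "Suc z"] that by (auto simp: cut_def)
      show "\<not> cut z Lft" if "s j < z" "z < s (Suc j)" for z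
        using not_boundary[OF j, of z] that by (auto simp: cut_def)
      show "(real l + 1) * gap_avg k (\<lambda>u. \<Psi> N u (Suc l)) + (real k + 1) * gap_avg l (\<lambda>v. \<Psi> N (Suc k) v)
          \<le> (real k + real l + 2) * \<Psi> (Suc N) (Suc k) (Suc l)" if "k + l < s (Suc j) - s j" for N k l
        using gap[OF j] that by (intro assms(4)) auto
      show "c \<le> sval cut \<eta>' Q'"
        if out: "\<And>z. z < s j \<or> s (Suc j) \<le> z \<Longrightarrow> \<eta>' z = \<eta> z \<and> Q' z = Q z"
          and "in": "\<And>z. s j \<le> z \<Longrightarrow> z < s (Suc j) \<Longrightarrow> num_active (\<eta>' z) = 0" for \<eta>' Q'
        unfolding c_def
      proof (rule step.IH)
        show "num_active (\<eta>' z) = 0" if "z < s (Suc j)" for z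
          using asleep[of z] out[of z] "in"[of z] that by (cases "z < s j") auto
        show "\<eta>' (centre i) = Active (N i)" if "Suc j \<le> i" "i < B" for i
        proof -
          have "s (Suc j) \<le> centre i" using s_mono[of "Suc j" i] that centre_block[of i] by simp
          then show ?thesis using out[of "centre i"] pile[of i] that by simp
        qed
        show "\<eta>' z = Active 0" if "s (Suc j) \<le> z" "z < n" "\<And>i. i < B \<Longrightarrow> z \<noteq> centre i" for z
          using out[of z] vac(1)[of z] that s_Suc[OF j] by simp
        show "Q' z = []" if "s (Suc j) \<le> z" "z < n" for z
          using out[of z] vac(2)[of z] that s_Suc[OF j] by simp
      qed
      show "\<eta> (centre j) = Active (N j)" using pile j by simp
      show "\<eta> z = Active 0" if "centre j - half \<le> z" "z \<le> centre j + l" "z \<noteq> centre j" for z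
        using that Ml by (intro inblk) auto
      show "Q z = []" if "centre j - half \<le> z" "z \<le> centre j + l" for z
        using that Ml s_le_n[of "Suc j"] j by (intro vac(2)) auto
      show "num_active (\<eta> z) = 0" if "s j \<le> z" "z < s (Suc j)" "z < centre j - half \<or> centre j + l < z" for z
        using that Ml by auto
    qed (use nonneg bdry c1 Ml cb in \<open>auto simp: centre_def\<close>)
    moreover have "\<Psi> (N j) (Suc half) (Suc l) \<le> bad (N j)"
    proof (rule start)
      have g: "s (Suc j) = half + l + 1 + s j" using cb by (auto simp: l_def centre_def)
      with gap[OF j] show "L \<le> half + l + 1" "half + l + 1 \<le> L + 1" by auto
      then show "\<bar>real half - real l\<bar> \<le> 1" by (auto simp: half_def)
    qed (use False in simp)
    ultimately show ?thesis unfolding split by linarith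
  qed
qed

lemma avg_weight_harmonic:
  assumes "active n x \<eta>" "\<And>z. 0 < h z" "avg (\<lambda>i. h (dest n x i)) = h x"
  shows "avg (\<lambda>i. weight h (if i = Slp then \<eta> else exec n i x \<eta>)) = weight h \<eta>"
proof -
  have nz: "h x \<noteq> 0" using assms(2)[of x] by simp
  have "(\<lambda>i. weight h (if i = Slp then \<eta> else exec n i x \<eta>)) = (\<lambda>i. weight h \<eta> / h x * h (dest n x i))"
    using weight_exec[OF assms(1) _ assms(2)] nz by (auto simp: fun_eq_iff)
  then show ?thesis using assms(3) nz by (simp only: avg_mult) simp
qed

lemma weight_ge_factor:
  assumes "\<And>z. 1 \<le> h z" "x < n"
  shows "h x ^ num_particles (\<eta> x) \<le> weight h \<eta>"
proof -
  have h0: "0 \<le> h x ^ num_particles (\<eta> x)"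
    using assms(1)[of x] by simp
  have "1 \<le> (\<Prod>y\<in>{..<n} - {x}. h y ^ num_particles (\<eta> y))"
    using assms(1) by (intro prod_ge_1) auto
  then have "h x ^ num_particles (\<eta> x) * 1 \<le> h x ^ num_particles (\<eta> x) * (\<Prod>y\<in>{..<n} - {x}. h y ^ num_particles (\<eta> y))"
    using h0 by (rule mult_left_mono)
  also have "\<dots> = weight h \<eta>"
    unfolding weight_def using assms(2) by (subst prod.remove[of "{..<n}" x]) auto
  finally show ?thesis by simp
qed

text \<open>Three losses: \<open>E\<close> for the emptying of each block, an exponential Markov
  bound for piles larger than \<open>C\<close>, and running out of the \<open>m\<close> topplings
  granted to each of the two phases. The weight with constant 2 is conserved and dominates those of
  \<open>h1\<close> and \<open>h2\<close>, so one term serves both phases.\<close>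

theorem blocks_lower_bound:
  fixes \<Psi> :: "nat \<Rightarrow> nat \<Rightarrow> nat \<Rightarrow> real"
  assumes nonneg: "\<And>N u v. 0 \<le> \<Psi> N u v"
    and bdry: "\<And>N u. 0 < u \<Longrightarrow> 1 \<le> \<Psi> N 0 u" "\<And>N u. 0 < u \<Longrightarrow> 1 \<le> \<Psi> N u 0"
    and step: "\<And>N k l. k + l < L + 1 \<Longrightarrow>
        (real l + 1) * gap_avg k (\<lambda>u. \<Psi> N u (Suc l)) + (real k + 1) * gap_avg l (\<lambda>v. \<Psi> N (Suc k) v)
          \<le> (real k + real l + 2) * \<Psi> (Suc N) (Suc k) (Suc l)"
    and start: "\<And>N k l. real N \<le> C \<Longrightarrow> L \<le> k + l + 1 \<Longrightarrow> k + l + 1 \<le> L + 1 \<Longrightarrow>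
        \<bar>real k - real l\<bar> \<le> 1 \<Longrightarrow> \<Psi> N (Suc k) (Suc l) \<le> E"
    and E: "0 \<le> E" and \<theta>: "0 \<le> \<theta>"
    and awake: "\<And>x. x < n \<Longrightarrow> \<eta> x \<noteq> Sleepy"
  shows "1 - real B * E - exp (- \<theta> * C) * (\<Sum>i<B. weight (pile_mgf \<theta> i) \<eta>) - 2 * rate ^ m * weight (\<lambda>_. 2) \<eta>
     \<le> val (\<lambda>_ _. False) (m + m) \<eta> (\<lambda>_. [])"
proof -
  define a where "a = exp (- \<theta> * C)"
  define b where "b = rate ^ m"
  \<comment> \<open>Affine in weights of harmonic functions, hence a martingale while off-centre
    sites are toppled: the bound needed at the end of the gathering phase can be evaluated at its
    beginning.\<close>
  define \<Phi> where "\<Phi> \<xi> = (1 - real B * E) + (- a * (\<Sum>i<B. weight (pile_mgf \<theta> i) \<xi>) + - b * weight (\<lambda>_. 2) \<xi>)" for \<xi>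
  have ab: "0 \<le> a" "0 \<le> b" using rate_nonneg by (auto simp: a_def b_def)
  have mgf1: "1 \<le> pile_mgf \<theta> i x" for i x using pile_mgf_ge_1[OF \<theta>] .
  then have mgf0: "0 < pile_mgf \<theta> i x" for i x by (rule less_le_trans[OF zero_less_one])
  have "\<Phi> \<eta> - rate ^ m * weight h1 \<eta> \<le> val (\<lambda>_ _. False) (m + m) \<eta> (\<lambda>_. [])"
  proof (rule run_lower_bound[where A = sites_off_centre and sl = "\<lambda>x \<eta>. \<eta>"
        and Inv = "\<lambda>\<eta>. \<forall>x<n. \<eta> x \<noteq> Sleepy"])
    show "avg (\<lambda>i. if False then 0 else h1 (dest n x i)) \<le> rate * h1 x" if "x \<in> sites_off_centre" for x
      using h1_decay[OF that] by simp
    show "\<forall>y<n. exec n i x \<xi> y \<noteq> Sleepy"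
      if "\<forall>x<n. \<xi> x \<noteq> Sleepy" "i \<noteq> Slp" for i x \<xi>
    proof -
      have "add_particle t \<noteq> Sleepy" for t by (cases t) auto
      moreover have "t \<noteq> Sleepy \<Longrightarrow> remove_active t \<noteq> Sleepy" for t by (cases t) auto
      ultimately show ?thesis using that by (auto simp: exec_def jump_def Let_def)
    qed
    show "\<Phi> \<xi> \<le> 1" for \<xi>
    proof -
      have w0: "0 \<le> weight (pile_mgf \<theta> i) \<xi>" "0 \<le> weight (\<lambda>_. 2) \<xi>" for i
        by (rule less_imp_le, rule weight_pos, use mgf0 in simp)+
      have "0 \<le> real B * E" "0 \<le> a * (\<Sum>i<B. weight (pile_mgf \<theta> i) \<xi>)" "0 \<le> b * weight (\<lambda>_. 2) \<xi>"
        using ab E w0 by (auto intro!: mult_nonneg_nonneg sum_nonneg)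
      then show ?thesis by (simp add: \<Phi>_def)
    qed
    show "\<Phi> \<xi> \<le> avg (\<lambda>i. if False then 0 else \<Phi> (if i = Slp then \<xi> else exec n i x \<xi>))"
      if x: "active n x \<xi>" "x \<in> sites_off_centre" for x \<xi>
    proof -
      have avg_sum: "avg (\<lambda>i. \<Sum>k<B. F k i) = (\<Sum>k<B. avg (F k))" for F :: "nat \<Rightarrow> instr \<Rightarrow> real"
        by (simp add: avg_def sum.distrib sum_distrib_left)
      have "avg (\<lambda>i. weight (pile_mgf \<theta> k) (if i = Slp then \<xi> else exec n i x \<xi>)) = weight (pile_mgf \<theta> k) \<xi>" for k
        by (rule avg_weight_harmonic[OF x(1) mgf0 pile_mgf_harmonic[OF x(2)]])
      moreover have "avg (\<lambda>i. weight (\<lambda>_. 2) (if i = Slp then \<xi> else exec n i x \<xi>)) = weight (\<lambda>_. 2) \<xi>"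
        by (rule avg_weight_harmonic[OF x(1)]) auto
      ultimately have "avg (\<lambda>i. \<Phi> (if i = Slp then \<xi> else exec n i x \<xi>)) = \<Phi> \<xi>"
        unfolding \<Phi>_def avg_add avg_mult avg_sum avg_const by simp
      then show ?thesis by simp
    qed
    show "\<Phi> \<xi> \<le> val (\<lambda>_ _. False) m \<xi> (\<lambda>_. [])"
      if awake: "\<forall>x<n. \<xi> x \<noteq> Sleepy" and quiet: "\<And>x. active n x \<xi> \<Longrightarrow> x \<notin> sites_off_centre" for \<xi>
    proof -
      define N where "N i = num_active (\<xi> (centre i))" for i
      \<comment> \<open>The exponential dominates the indicator of k > C and, for k =
        \<open>N i\<close>, is bounded by a multiple of
        \<open>weight (pile_mgf \<theta> i)\<close>.\<close>
      define bad where "bad k = E + exp (\<theta> * (real k - C))" for k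
      have cN: "\<xi> (centre i) = Active (N i)" if "i < B" for i
        using awake centre_less[OF that] by (cases "\<xi> (centre i)") (auto simp: N_def)
      have vac: "\<xi> z = Active 0" if z: "z < n" "\<And>i. i < B \<Longrightarrow> z \<noteq> centre i" for z
      proof -
        have "shift z \<noteq> s i" if "i < B" for i
        proof
          assume "shift z = s i"
          then have "shift z = shift (centre i)" using shift_centre[OF that] by simp
          then have "z = centre i"
            using shift_bij z(1) centre_less[OF that] by (auto simp: bij_betw_def inj_on_def)
          with z(2) that show False by blast
        qed
        with z(1) have "z \<in> sites_off_centre" by (simp add: sites_off_centre_def)
        then have "\<not> active n z \<xi>" using quiet by blast
        then show ?thesis using z(1) awake by (cases "\<xi> z") (auto simp: active_def)
      qed
      have "1 - (\<Sum>i=0..<B. bad (N i)) \<le> sval cut \<xi> (\<lambda>_. [])"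
      proof (rule piles_lower_bound[where C = C and \<Psi> = \<Psi>])
        show "\<Psi> k (Suc i) (Suc l) \<le> bad k"
          if "real k \<le> C" "L \<le> i + l + 1" "i + l + 1 \<le> L + 1" "\<bar>real i - real l\<bar> \<le> 1" for k i l
          using start[OF that] by (simp add: bad_def add_increasing2)
        show "1 \<le> bad k" if "C < real k" for k
          using that E \<theta> by (auto simp: bad_def intro!: add_increasing)
        show "0 \<le> bad k" for k using E by (simp add: bad_def)
      qed (use nonneg bdry step cN vac s_0 in auto)
      also have "\<dots> \<le> val cut m \<xi> (\<lambda>_. []) + rate ^ m * weight h2 \<xi>"
        using val_ge_sval[of h2 rate cut \<xi> m] h2_bounds rate_nonneg h2_decay cut_Slp by force
      also have "\<dots> \<le> val (\<lambda>_ _. False) m \<xi> (\<lambda>_. []) + b * weight (\<lambda>_. 2) \<xi>"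
      proof (intro add_mono)
        show "val cut m \<xi> (\<lambda>_. []) \<le> val (\<lambda>_ _. False) m \<xi> (\<lambda>_. [])" by (rule val_forb_mono) auto
        show "rate ^ m * weight h2 \<xi> \<le> b * weight (\<lambda>_. 2) \<xi>"
          unfolding b_def using rate_nonneg h2_bounds order_trans[OF zero_le_one h2_bounds(1)]
          by (intro mult_left_mono weight_mono) auto
      qed
      finally have 1: "1 - (\<Sum>i=0..<B. bad (N i)) \<le> val (\<lambda>_ _. False) m \<xi> (\<lambda>_. []) + b * weight (\<lambda>_. 2) \<xi>" .
      have "exp (\<theta> * (real (N i) - C)) \<le> a * weight (pile_mgf \<theta> i) \<xi>" if "i < B" for i
      proof -
        have "exp (\<theta> * (real (N i) - C)) = a * exp \<theta> ^ N i"
          by (simp add: a_def exp_add[symmetric] exp_of_nat_mult[symmetric] algebra_simps)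
        also have "\<dots> \<le> a * pile_mgf \<theta> i (centre i) ^ N i"
          using pile_mgf_centre[OF \<theta> that] ab by (intro mult_left_mono power_mono) auto
        also have "\<dots> \<le> a * weight (pile_mgf \<theta> i) \<xi>"
          using weight_ge_factor[of "pile_mgf \<theta> i" "centre i" \<xi>, OF mgf1 centre_less[OF that]] cN[OF that] ab
          by (intro mult_left_mono) auto
        finally show ?thesis .
      qed
      then have "(\<Sum>i=0..<B. bad (N i)) \<le> (\<Sum>i<B. E + a * weight (pile_mgf \<theta> i) \<xi>)"
        unfolding bad_def atLeast0LessThan by (intro sum_mono add_left_mono) auto
      also have "\<dots> = real B * E + a * (\<Sum>i<B. weight (pile_mgf \<theta> i) \<xi>)"
        by (simp add: sum.distrib sum_distrib_left)
      finally show ?thesis using 1 unfolding \<Phi>_def by linarith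
    qed
  qed (use h1_bounds rate_nonneg awake in auto)
  moreover have "weight h1 \<eta> \<le> weight (\<lambda>_. 2) \<eta>"
    using h1_bounds order_trans[OF zero_le_one h1_bounds(1)] by (intro weight_mono) auto
  then have "rate ^ m * weight h1 \<eta> \<le> b * weight (\<lambda>_. 2) \<eta>"
    unfolding b_def using rate_nonneg by (intro mult_left_mono) auto
  ultimately show ?thesis unfolding \<Phi>_def a_def b_def by (simp add: algebra_simps)
qed

end

section \<open>The law of the chain\<close>

text \<open>Taken with respect to the finite-dimensional law of the first t + 1 states, for which
  the Markov recursion follows from the construction of the kernels.\<close>

definition arw_expectation :: "real \<Rightarrow> real \<Rightarrow> nat \<Rightarrow> nat \<Rightarrow> (config \<Rightarrow> ennreal) \<Rightarrow> ennreal" where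
  "arw_expectation \<mu> lam n t g =
     (\<integral>\<^sup>+\<omega>. g (\<omega> t) \<partial>Ionescu_Tulcea.C (arw_kernel \<mu> lam n) (\<lambda>_. count_space UNIV) 0 (Suc t) (\<lambda>_. undefined))"

lemma arw_expectation_simps:
  "arw_expectation \<mu> lam n 0 g = (\<integral>\<^sup>+\<eta>. g \<eta> \<partial>arw_init \<mu> n)"
  "arw_expectation \<mu> lam n (Suc t) g = arw_expectation \<mu> lam n t (\<lambda>\<eta>. \<integral>\<^sup>+\<xi>. g \<xi> \<partial>arw_step lam n \<eta>)"
proof -
  interpret Ionescu_Tulcea "arw_kernel \<mu> lam n" "\<lambda>_. count_space UNIV"
    by (rule Ionescu_Tulcea_arw)
  let ?u = "\<lambda>_::nat. undefined :: config"
  have sp: "?u \<in> space (Pi\<^sub>M {0..<0::nat} (\<lambda>_. count_space UNIV))" by (simp add: space_PiM)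
  have meas: "(\<lambda>\<omega>. g (\<omega> t)) \<in> borel_measurable (Pi\<^sub>M {0..<Suc t} (\<lambda>_. count_space (UNIV :: config set)))"
    for t and g :: "config \<Rightarrow> ennreal"
    by (rule measurable_compose[OF measurable_component_singleton]) auto
  have step: "arw_expectation \<mu> lam n t g = (\<integral>\<^sup>+\<omega>. (\<integral>\<^sup>+\<xi>. g \<xi> \<partial>arw_kernel \<mu> lam n t \<omega>) \<partial>C 0 t ?u)" for t g
  proof -
    have spC: "space (C 0 t ?u) = space (Pi\<^sub>M {0..<t} (\<lambda>_. count_space UNIV))" using space_C[OF sp, of t] by simp
    have "arw_expectation \<mu> lam n t g = (\<integral>\<^sup>+\<omega>. (\<integral>\<^sup>+\<omega>'. g (\<omega>' t) \<partial>eP t \<omega>) \<partial>C 0 t ?u)"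
      unfolding arw_expectation_def C.simps(2) add_0
    proof (rule nn_integral_bind[where B = "Pi\<^sub>M {0..<Suc t} (\<lambda>_. count_space UNIV)"])
      show "(\<lambda>\<omega>. g (\<omega> t)) \<in> borel_measurable (Pi\<^sub>M {0..<Suc t} (\<lambda>_. count_space UNIV))" by (rule meas)
      have "eP t \<in> Pi\<^sub>M {0..<t} (\<lambda>_. count_space UNIV) \<rightarrow>\<^sub>M subprob_algebra (Pi\<^sub>M {0..<Suc t} (\<lambda>_. count_space UNIV))"
        by (rule measurable_eP)
      then show "eP t \<in> C 0 t ?u \<rightarrow>\<^sub>M subprob_algebra (Pi\<^sub>M {0..<Suc t} (\<lambda>_. count_space UNIV))"
        using sets_C[OF sp, of t] by (simp cong: measurable_cong_sets)
    qed
    also have "\<dots> = (\<integral>\<^sup>+\<omega>. (\<integral>\<^sup>+\<xi>. g \<xi> \<partial>arw_kernel \<mu> lam n t \<omega>) \<partial>C 0 t ?u)"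
      using spC by (intro nn_integral_cong) (simp add: nn_integral_eP meas)
    finally show ?thesis .
  qed
  show "arw_expectation \<mu> lam n 0 g = (\<integral>\<^sup>+\<eta>. g \<eta> \<partial>arw_init \<mu> n)"
    unfolding step by (subst C.simps(1), subst nn_integral_return) (auto simp: arw_kernel_def space_PiM)
  show "arw_expectation \<mu> lam n (Suc t) g = arw_expectation \<mu> lam n t (\<lambda>\<eta>. \<integral>\<^sup>+\<xi>. g \<xi> \<partial>arw_step lam n \<eta>)"
    unfolding step[of "Suc t"] by (simp add: arw_expectation_def arw_kernel_def)
qed

lemma absorption_time_tail:
  assumes "real t \<le> r"
  shows "measure (arw_law \<mu> lam n) {\<omega> \<in> space (arw_law \<mu> lam n). ereal_of_enat (absorption_time n \<omega>) > ereal r}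
    \<le> enn2real (arw_expectation \<mu> lam n t (\<lambda>\<eta>. of_bool (\<not> all_asleep n \<eta>)))"
proof -
  interpret prob_space "arw_law \<mu> lam n" by (rule prob_space_arw_law)
  let ?M = "arw_law \<mu> lam n" and ?g = "\<lambda>\<eta>. of_bool (\<not> all_asleep n \<eta>) :: ennreal"
  define E where "E = {\<omega> \<in> space ?M. \<not> all_asleep n (\<omega> t)}"
  have comp: "(\<lambda>\<omega>. \<omega> t) \<in> ?M \<rightarrow>\<^sub>M count_space UNIV"
    unfolding measurable_cong_sets[OF sets_arw_law refl] by (rule measurable_component_singleton) simp
  have E: "E \<in> sets ?M"
    unfolding E_def using measurable_sets[OF comp, of "{\<eta>. \<not> all_asleep n \<eta>}"]
    by (simp add: vimage_def Int_def conj_commute)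
  have "{\<omega> \<in> space ?M. ereal_of_enat (absorption_time n \<omega>) > ereal r} \<subseteq> E"
  proof
    fix \<omega> assume \<omega>: "\<omega> \<in> {\<omega> \<in> space ?M. ereal_of_enat (absorption_time n \<omega>) > ereal r}"
    have "\<not> all_asleep n (\<omega> t)"
    proof
      assume "all_asleep n (\<omega> t)"
      then have "absorption_time n \<omega> \<le> enat t"
        unfolding absorption_time_def by (intro INF_lower2[of t]) auto
      then have "ereal_of_enat (absorption_time n \<omega>) \<le> ereal_of_enat (enat t)"
        by (simp only: ereal_of_enat_le_iff)
      also have "\<dots> \<le> ereal r" using assms by simp
      finally have "ereal_of_enat (absorption_time n \<omega>) \<le> ereal r" .
      moreover have "ereal r < ereal_of_enat (absorption_time n \<omega>)" using \<omega> by blast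
      ultimately show False by (meson leD)
    qed
    then show "\<omega> \<in> E" using \<omega> by (simp add: E_def)
  qed
  then have "prob {\<omega> \<in> space ?M. ereal_of_enat (absorption_time n \<omega>) > ereal r} \<le> prob E"
    using E by (rule finite_measure_mono)
  also have "prob E = enn2real (\<integral>\<^sup>+\<omega>. indicator E \<omega> \<partial>?M)"
    using E by (simp add: measure_def)
  also have "(\<integral>\<^sup>+\<omega>. indicator E \<omega> \<partial>?M) = (\<integral>\<^sup>+\<omega>. ?g (restrict \<omega> {0..<Suc t} t) \<partial>?M)"
    by (intro nn_integral_cong) (auto simp: E_def indicator_def)
  also have "\<dots> = (\<integral>\<^sup>+\<omega>. ?g (\<omega> t) \<partial>distr ?M (Pi\<^sub>M {0..<Suc t} (\<lambda>_. count_space UNIV)) (\<lambda>\<omega>. restrict \<omega> {0..<Suc t}))"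
  proof -
    have 1: "(\<lambda>\<omega>. restrict \<omega> {0..<Suc t}) \<in> ?M \<rightarrow>\<^sub>M Pi\<^sub>M {0..<Suc t} (\<lambda>_. count_space UNIV)"
      unfolding measurable_cong_sets[OF sets_arw_law refl] by (rule measurable_restrict_subset) simp
    have 2: "(\<lambda>\<omega>. ?g (\<omega> t)) \<in> borel_measurable (Pi\<^sub>M {0..<Suc t} (\<lambda>_. count_space UNIV))"
      by (rule measurable_compose[OF measurable_component_singleton]) auto
    show ?thesis
      by (rule nn_integral_distr[OF 1, where f = "\<lambda>\<omega>. ?g (\<omega> t)", symmetric]) (use 2 in simp)
  qed
  finally show ?thesis unfolding arw_law_finite_dim arw_expectation_def .
qed

section \<open>From the chain to topplings in a chosen order\<close>

context arw_cycle
begin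

abbreviation free_val :: "nat \<Rightarrow> config \<Rightarrow> real" where
  "free_val m \<eta> \<equiv> val (\<lambda>_ _. False) m \<eta> (\<lambda>_. [])"

text \<open>An attempt by a particle at \<open>x\<close> is a toppling of \<open>x\<close>, and by
  \<open>val_topple\<close> its mean outcome is the same for every active site. The uniform choice
  of the particle thus averages a constant.\<close>

lemma nn_integral_arw_step:
  assumes lam: "0 < lam" "q = lam / (1 + lam)"
  shows "(\<integral>\<^sup>+\<xi>. ennreal (1 - free_val m \<xi>) \<partial>arw_step lam n \<eta>) = ennreal (1 - free_val (Suc m) \<eta>)"
proof (cases "all_asleep n \<eta>")
  case True
  then show ?thesis by (simp add: arw_step_def)
next
  case False
  let ?S = "active_particles n \<eta>"
  have nz: "0 \<le> 1 - free_val m \<xi>" for \<xi> using val_bounds(2) by simp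
  have attempt: "(\<integral>\<^sup>+\<xi>. ennreal (1 - free_val m \<xi>) \<partial>particle_attempt lam n x \<eta>) = ennreal (1 - free_val (Suc m) \<eta>)"
    if "(x, i) \<in> ?S" for x i
  proof -
    have x: "active n x \<eta>" using that by (auto simp: active_particles_def active_def)
    define a where "a = 1 - free_val m (try_sleep x \<eta>)"
    define b where "b = 1 - free_val m (jump x ((x + 1) mod n) \<eta>)"
    define c where "c = 1 - free_val m (jump x ((x + n - 1) mod n) \<eta>)"
    have abc: "0 \<le> a" "0 \<le> b" "0 \<le> c" using nz by (auto simp: a_def b_def c_def)
    have q: "0 \<le> q" "0 \<le> 1 - q" using q01 by auto
    have "(\<integral>\<^sup>+\<xi>. ennreal (1 - free_val m \<xi>) \<partial>particle_attempt lam n x \<eta>)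
        = ennreal a * ennreal q + (ennreal b * ennreal (1 / 2) + ennreal c * ennreal (1 / 2)) * ennreal (1 - q)"
      unfolding particle_attempt_def lam(2)[symmetric] nn_integral_bind_pmf
      using q01 by (simp add: a_def b_def c_def nn_integral_bernoulli_pmf)
    also have "\<dots> = ennreal (a * q + (b * (1 / 2) + c * (1 / 2)) * (1 - q))"
    proof -
      have "ennreal a * ennreal q = ennreal (a * q)"
        by (rule ennreal_mult[symmetric]) (use abc q in auto)
      moreover have "ennreal b * ennreal (1 / 2) = ennreal (b * (1 / 2))"
        by (rule ennreal_mult[symmetric]) (use abc in auto)
      moreover have "ennreal c * ennreal (1 / 2) = ennreal (c * (1 / 2))"
        by (rule ennreal_mult[symmetric]) (use abc in auto)
      moreover have "ennreal (b * (1 / 2)) + ennreal (c * (1 / 2)) = ennreal (b * (1 / 2) + c * (1 / 2))"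
        by (rule ennreal_plus[symmetric]) (use abc in auto)
      moreover have "ennreal (b * (1 / 2) + c * (1 / 2)) * ennreal (1 - q) = ennreal ((b * (1 / 2) + c * (1 / 2)) * (1 - q))"
        by (rule ennreal_mult[symmetric]) (use abc q in auto)
      moreover have "ennreal (a * q) + ennreal ((b * (1 / 2) + c * (1 / 2)) * (1 - q))
          = ennreal (a * q + (b * (1 / 2) + c * (1 / 2)) * (1 - q))"
        by (rule ennreal_plus[symmetric]) (use abc q in auto)
      ultimately show ?thesis by (simp only:)
    qed
    also have "a * q + (b * (1 / 2) + c * (1 / 2)) * (1 - q) = 1 - free_val (Suc m) \<eta>"
      unfolding val_topple[OF x] by (simp add: topple_Nil avg_def a_def b_def c_def exec_def field_simps)
    finally show ?thesis .
  qed
  have S: "?S \<noteq> {}" using False by (simp add: all_asleep_def)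
  have "(\<integral>\<^sup>+\<xi>. ennreal (1 - free_val m \<xi>) \<partial>arw_step lam n \<eta>)
      = (\<integral>\<^sup>+p. (\<integral>\<^sup>+\<xi>. ennreal (1 - free_val m \<xi>) \<partial>(case p of (x, i) \<Rightarrow> particle_attempt lam n x \<eta>)) \<partial>pmf_of_set ?S)"
    using False by (simp add: arw_step_def)
  also have "\<dots> = (\<integral>\<^sup>+p. ennreal (1 - free_val (Suc m) \<eta>) \<partial>pmf_of_set ?S)"
  proof (intro nn_integral_cong_AE, unfold AE_measure_pmf_iff, intro ballI)
    fix p assume "p \<in> set_pmf (pmf_of_set ?S)"
    then have "p \<in> ?S" unfolding set_pmf_of_set[OF S finite_active_particles] .
    moreover obtain x i where p: "p = (x, i)" by (cases p)
    ultimately have "(x, i) \<in> ?S" by (simp only:)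
    then show "(\<integral>\<^sup>+\<xi>. ennreal (1 - free_val m \<xi>) \<partial>(case p of (x, i) \<Rightarrow> particle_attempt lam n x \<eta>))
        = ennreal (1 - free_val (Suc m) \<eta>)"
      unfolding p prod.case by (rule attempt)
  qed
  also have "\<dots> = ennreal (1 - free_val (Suc m) \<eta>)" by (simp del: val.simps)
  finally show ?thesis .
qed

text \<open>\<open>free_val 0\<close> is the indicator of stability, and undoing one step of the
  chain grants one more toppling.\<close>

lemma arw_expectation_awake:
  assumes lam: "0 < lam" "q = lam / (1 + lam)"
  shows "arw_expectation \<mu> lam n t (\<lambda>\<eta>. of_bool (\<not> all_asleep n \<eta>))
    = (\<integral>\<^sup>+\<eta>. ennreal (1 - free_val t \<eta>) \<partial>arw_init \<mu> n)"
proof -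
  have "arw_expectation \<mu> lam n t (\<lambda>\<eta>. ennreal (1 - free_val m \<eta>))
      = (\<integral>\<^sup>+\<eta>. ennreal (1 - free_val (m + t) \<eta>) \<partial>arw_init \<mu> n)" for m
  proof (induction t arbitrary: m)
    case 0
    then show ?case by (simp add: arw_expectation_simps)
  next
    case (Suc t)
    then show ?case
      by (simp add: arw_expectation_simps nn_integral_arw_step[OF lam] del: val.simps)
  qed
  moreover have "(\<lambda>\<eta>. of_bool (\<not> all_asleep n \<eta>)) = (\<lambda>\<eta>. ennreal (1 - free_val 0 \<eta>))"
    by (auto simp: fun_eq_iff)
  ultimately show ?thesis by (simp only: add_0)
qed

lemma set_arw_init:
  assumes "\<eta> \<in> set_pmf (arw_init \<mu> n)"
  shows "\<eta> x \<in> {Active 0, Active 1}"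
proof -
  have "\<eta> \<in> PiE_dflt {..<n} (Active 0) (set_pmf \<circ> (\<lambda>_. map_pmf (\<lambda>b. Active (of_bool b)) (bernoulli_pmf \<mu>)))"
    using assms unfolding arw_init_def by (simp only: set_Pi_pmf finite_lessThan)
  then consider "\<eta> x = Active 0" | b where "\<eta> x = Active (of_bool b)"
    unfolding PiE_dflt_def set_map_pmf comp_def by blast
  then show ?thesis
  proof cases
    case 2
    then show ?thesis by (cases b) simp_all
  qed simp
qed

text \<open>Independence of the sites gives a product of factors 1 + \<mu> (h x - 1), each at most
  exp (\<mu> (h x - 1)).\<close>

lemma nn_integral_weight_init:
  assumes \<mu>: "0 \<le> \<mu>" "\<mu> \<le> 1" and h: "\<And>x. 1 \<le> h x" and le: "(\<Sum>x<n. h x - 1) \<le> S"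
  shows "(\<integral>\<^sup>+\<eta>. ennreal (weight h \<eta>) \<partial>arw_init \<mu> n) \<le> ennreal (exp (\<mu> * S))"
proof -
  have h0: "0 \<le> h x" for x using h[of x] by simp
  have "(\<integral>\<^sup>+\<eta>. ennreal (weight h \<eta>) \<partial>arw_init \<mu> n)
      = (\<integral>\<^sup>+\<eta>. (\<Prod>x<n. ennreal (h x ^ num_particles (\<eta> x))) \<partial>arw_init \<mu> n)"
    using h0 by (intro nn_integral_cong) (simp add: weight_def prod_ennreal)
  also have "\<dots> = (\<Prod>x<n. \<integral>\<^sup>+s. ennreal (h x ^ num_particles s)
      \<partial>map_pmf (\<lambda>b. Active (of_bool b)) (bernoulli_pmf \<mu>))"
    unfolding arw_init_def by (rule nn_integral_prod_Pi_pmf) simp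
  also have "\<dots> = (\<Prod>x<n. ennreal (1 + \<mu> * (h x - 1)))"
  proof (intro prod.cong refl)
    fix x
    have "(\<integral>\<^sup>+s. ennreal (h x ^ num_particles s) \<partial>map_pmf (\<lambda>b. Active (of_bool b)) (bernoulli_pmf \<mu>))
        = ennreal (h x) * ennreal \<mu> + ennreal 1 * ennreal (1 - \<mu>)"
      using \<mu> by (simp add: nn_integral_bernoulli_pmf)
    also have "\<dots> = ennreal (h x * \<mu> + 1 * (1 - \<mu>))"
      using \<mu> h0 by (simp add: ennreal_mult[symmetric] ennreal_plus[symmetric] del: ennreal_plus)
    also have "h x * \<mu> + 1 * (1 - \<mu>) = 1 + \<mu> * (h x - 1)" by (simp add: algebra_simps)
    finally show "(\<integral>\<^sup>+s. ennreal (h x ^ num_particles s) \<partial>map_pmf (\<lambda>b. Active (of_bool b)) (bernoulli_pmf \<mu>))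
        = ennreal (1 + \<mu> * (h x - 1))" .
  qed
  also have "\<dots> = ennreal (\<Prod>x<n. 1 + \<mu> * (h x - 1))"
    using \<mu> h by (intro prod_ennreal) simp
  also have "\<dots> \<le> ennreal (exp (\<mu> * S))"
  proof (rule ennreal_leI)
    have "(\<Prod>x<n. 1 + \<mu> * (h x - 1)) \<le> (\<Prod>x<n. exp (\<mu> * (h x - 1)))"
      using \<mu> h by (intro prod_mono) auto
    also have "\<dots> = exp (\<mu> * (\<Sum>x<n. h x - 1))" by (simp add: exp_sum sum_distrib_left)
    also have "\<dots> \<le> exp (\<mu> * S)" using le \<mu> by (simp add: mult_left_mono)
    finally show "(\<Prod>x<n. 1 + \<mu> * (h x - 1)) \<le> exp (\<mu> * S)" .
  qed
  finally show ?thesis .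
qed

end

theorem (in arw_blocks) survival_bound:
  fixes \<Psi> :: "nat \<Rightarrow> nat \<Rightarrow> nat \<Rightarrow> real"
  assumes lam: "0 < lam" "q = lam / (1 + lam)" and \<mu>: "0 \<le> \<mu>" "\<mu> \<le> 1"
    and nonneg: "\<And>N u v. 0 \<le> \<Psi> N u v"
    and bdry: "\<And>N u. 0 < u \<Longrightarrow> 1 \<le> \<Psi> N 0 u" "\<And>N u. 0 < u \<Longrightarrow> 1 \<le> \<Psi> N u 0"
    and step: "\<And>N k l. k + l < L + 1 \<Longrightarrow>
        (real l + 1) * gap_avg k (\<lambda>u. \<Psi> N u (Suc l)) + (real k + 1) * gap_avg l (\<lambda>v. \<Psi> N (Suc k) v)
          \<le> (real k + real l + 2) * \<Psi> (Suc N) (Suc k) (Suc l)"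
    and start: "\<And>N k l. real N \<le> C \<Longrightarrow> L \<le> k + l + 1 \<Longrightarrow> k + l + 1 \<le> L + 1 \<Longrightarrow>
        \<bar>real k - real l\<bar> \<le> 1 \<Longrightarrow> \<Psi> N (Suc k) (Suc l) \<le> E"
    and E: "0 \<le> E" and \<theta>: "0 \<le> \<theta>"
  shows "enn2real (arw_expectation \<mu> lam n (m + m) (\<lambda>\<eta>. of_bool (\<not> all_asleep n \<eta>)))
    \<le> real B * E + real B * exp (\<mu> * ((exp \<theta> - 1) * (real L + 1)) - \<theta> * C) + 2 * rate ^ m * exp (real n)"
proof -
  define a where "a = exp (- \<theta> * C)"
  define b where "b = 2 * rate ^ m"
  have ab: "0 \<le> a" "0 \<le> b" using rate_nonneg by (auto simp: a_def b_def)
  have mgf1: "1 \<le> pile_mgf \<theta> i x" for i x using pile_mgf_ge_1[OF \<theta>] .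
  have w0: "0 \<le> weight h \<eta>" if "\<And>z. 1 \<le> h z" for h \<eta>
    using weight_ge_1[of h \<eta>] that by (meson order_trans zero_le_one)
  note wm = w0[OF mgf1]
  have w2: "0 \<le> weight (\<lambda>_. 2) \<eta>" for \<eta> by (rule w0) simp
  have pt: "ennreal (1 - free_val (m + m) \<eta>) \<le> ennreal (real B * E)
      + (ennreal a * (\<Sum>i<B. ennreal (weight (pile_mgf \<theta> i) \<eta>)) + ennreal b * ennreal (weight (\<lambda>_. 2) \<eta>))"
    if "\<eta> \<in> set_pmf (arw_init \<mu> n)" for \<eta>
  proof -
    have "\<eta> x \<noteq> Sleepy" for x using set_arw_init[OF that, of x] by auto
    then have "1 - real B * E - a * (\<Sum>i<B. weight (pile_mgf \<theta> i) \<eta>) - b * weight (\<lambda>_. 2) \<eta> \<le> free_val (m + m) \<eta>"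
      unfolding a_def b_def by (intro blocks_lower_bound[where \<Psi> = \<Psi>] nonneg bdry step start E \<theta>)
    then have "ennreal (1 - free_val (m + m) \<eta>)
        \<le> ennreal (real B * E + (a * (\<Sum>i<B. weight (pile_mgf \<theta> i) \<eta>) + b * weight (\<lambda>_. 2) \<eta>))"
      by (intro ennreal_leI) linarith
    also have "\<dots> = ennreal (real B * E)
      + (ennreal a * (\<Sum>i<B. ennreal (weight (pile_mgf \<theta> i) \<eta>)) + ennreal b * ennreal (weight (\<lambda>_. 2) \<eta>))"
      using ab E wm w2 by (simp add: ennreal_plus ennreal_mult sum_nonneg)
    finally show ?thesis .
  qed
  have S: "(\<Sum>x<n. pile_mgf \<theta> i x - 1) \<le> (exp \<theta> - 1) * (real L + 1)" if "i < B" for i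
    using sum_profile_tent[OF that] \<theta> by (simp add: pile_mgf_def sum_distrib_left[symmetric] mult_left_mono)
  have "arw_expectation \<mu> lam n (m + m) (\<lambda>\<eta>. of_bool (\<not> all_asleep n \<eta>))
      \<le> (\<integral>\<^sup>+\<eta>. ennreal (real B * E)
      + (ennreal a * (\<Sum>i<B. ennreal (weight (pile_mgf \<theta> i) \<eta>)) + ennreal b * ennreal (weight (\<lambda>_. 2) \<eta>)) \<partial>arw_init \<mu> n)"
    unfolding arw_expectation_awake[OF lam] using pt
    by (intro nn_integral_mono_AE) (auto simp: AE_measure_pmf_iff)
  also have "\<dots> = ennreal (real B * E) + (ennreal a * (\<Sum>i<B. \<integral>\<^sup>+\<eta>. ennreal (weight (pile_mgf \<theta> i) \<eta>) \<partial>arw_init \<mu> n)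
      + ennreal b * (\<integral>\<^sup>+\<eta>. ennreal (weight (\<lambda>_. 2) \<eta>) \<partial>arw_init \<mu> n))"
    by (simp add: nn_integral_add nn_integral_cmult nn_integral_sum)
  also have "\<dots> \<le> ennreal (real B * E)
      + (ennreal a * (\<Sum>i<B. ennreal (exp (\<mu> * ((exp \<theta> - 1) * (real L + 1))))) + ennreal b * ennreal (exp (\<mu> * real n)))"
    using \<mu> mgf1 S by (intro add_mono mult_left_mono sum_mono nn_integral_weight_init order_refl) auto
  also have "\<dots> = ennreal (real B * E + (a * (real B * exp (\<mu> * ((exp \<theta> - 1) * (real L + 1)))) + b * exp (\<mu> * real n)))"
    using ab E by (simp add: ennreal_plus ennreal_mult ennreal_of_nat_eq_real_of_nat)
  finally have "enn2real (arw_expectation \<mu> lam n (m + m) (\<lambda>\<eta>. of_bool (\<not> all_asleep n \<eta>)))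
      \<le> real B * E + (a * (real B * exp (\<mu> * ((exp \<theta> - 1) * (real L + 1)))) + b * exp (\<mu> * real n))"
    using ab E by (intro enn2real_leI) auto
  also have "a * (real B * exp (\<mu> * ((exp \<theta> - 1) * (real L + 1))))
      = real B * exp (\<mu> * ((exp \<theta> - 1) * (real L + 1)) - \<theta> * C)"
  proof -
    have "exp (- \<theta> * C) * exp Z = exp (Z - \<theta> * C)" for Z
      by (simp add: exp_add[symmetric])
    then show ?thesis by (simp only: a_def mult.left_commute[of _ "real B"])
  qed
  also have "b * exp (\<mu> * real n) \<le> b * exp (real n)"
    using ab \<mu> mult_right_mono[of \<mu> 1 "real n"] by (intro mult_left_mono) auto
  finally show ?thesis by (simp add: b_def)
qed

section \<open>Choice of the block length and conclusion\<close>

lemma equal_division_gap: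
  fixes n B i :: nat
  assumes "0 < B"
  shows "Suc i * n div B = i * n div B + n div B \<or> Suc i * n div B = i * n div B + n div B + 1"
proof -
  have "i * n mod B + n mod B < B * 2"
    using mod_less_divisor[OF assms, of "i * n"] mod_less_divisor[OF assms, of n] by linarith
  then have "(i * n mod B + n mod B) div B < 2"
    by (simp add: less_mult_imp_div_less mult.commute)
  moreover have "Suc i * n div B = i * n div B + n div B + (i * n mod B + n mod B) div B"
    using div_add1_eq[of "i * n" n B] by (simp add: add.commute)
  ultimately show ?thesis by linarith
qed

theorem theorem1:
  fixes \<mu> lam :: real
  assumes "0 < lam" and "0 < \<mu>" and "\<mu> < lam / (1 + lam)"
  shows "\<exists>C\<^sub>0 b. 0 < C\<^sub>0 \<and> 0 < b \<and>
    (\<forall>\<^sub>F n in sequentially.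
      measure (arw_law \<mu> lam n)
        {\<omega> \<in> space (arw_law \<mu> lam n).
          ereal_of_enat (absorption_time n \<omega>) > ereal (C\<^sub>0 * real n * (ln (real n))\<^sup>2)}
      \<le> 1 / real n powr b)"
proof -
  define q where "q = lam / (1 + lam)"
  have q: "0 < q" "q < 1" using assms by (auto simp: q_def)
  interpret sleep_rate q by unfold_locales (use q in auto)
  have \<mu>: "0 < \<mu>" "\<mu> < q" using assms by (auto simp: q_def)
  with q have \<mu>1: "\<mu> < 1" by linarith
  \<comment> \<open>The density allowed for a pile: above \<mu>, so that larger piles are rare, and
    below \<open>q\<close>, so that a block can absorb it.\<close>
  define d where "d = (\<mu> + q) / 2"
  have d: "\<mu> < d" "d < q" "0 < d" using \<mu> by (auto simp: d_def)
  obtain K c where Kc: "0 < K" "0 < c" and pot: "\<And>L::nat. 1 \<le> L \<Longrightarrow> \<exists>\<Psi> :: nat \<Rightarrow> nat \<Rightarrow> nat \<Rightarrow> real.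
     (\<forall>N u v. 0 \<le> \<Psi> N u v) \<and>
     (\<forall>N u. 0 < u \<longrightarrow> 1 \<le> \<Psi> N 0 u \<and> 1 \<le> \<Psi> N u 0) \<and>
     (\<forall>N k l. k + l < L + 1 \<longrightarrow>
        (real l + 1) * gap_avg k (\<lambda>u. \<Psi> N u (Suc l)) + (real k + 1) * gap_avg l (\<lambda>v. \<Psi> N (Suc k) v)
          \<le> (real k + real l + 2) * \<Psi> (Suc N) (Suc k) (Suc l)) \<and>
     (\<forall>N k l. real N \<le> d * real L \<longrightarrow> L \<le> k + l + 1 \<longrightarrow> k + l + 1 \<le> L + 1 \<longrightarrow> \<bar>real k - real l\<bar> \<le> 1 \<longrightarrow>
        \<Psi> N (Suc k) (Suc l) \<le> K * exp (- c * real L))"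
    using block_potential_exists[OF d(3,2)] by blast
  \<comment> \<open>With exp \<theta> - 1 at most \<theta> + \<theta>^2, this choice gives \<mu> (1
    + \<theta>) at most (d + \<mu>) / 2, so the Chernoff exponent keeps the margin \<open>c2\<close>
    per site.\<close>
  define \<theta> where "\<theta> = min 1 ((d - \<mu>) / (2 * \<mu>))"
  have \<theta>: "0 < \<theta>" "\<theta> \<le> 1" using d \<mu> by (auto simp: \<theta>_def)
  have "\<theta> \<le> (d - \<mu>) / (2 * \<mu>)" by (simp add: \<theta>_def)
  then have "\<mu> * \<theta> \<le> (d - \<mu>) / 2" using \<mu> by (simp add: field_simps)
  then have "\<theta> * (\<mu> * (1 + \<theta>)) \<le> \<theta> * ((d + \<mu>) / 2)"
    using \<theta> by (intro mult_left_mono) (auto simp: field_simps)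
  moreover have "\<mu> * (exp \<theta> - 1) \<le> \<mu> * (\<theta> + \<theta>\<^sup>2)"
    using exp_bound[of \<theta>] \<theta> \<mu> by (intro mult_left_mono) auto
  ultimately have mgf: "\<mu> * (exp \<theta> - 1) \<le> \<theta> * ((d + \<mu>) / 2)"
    by (simp add: algebra_simps power2_eq_square)
  define c2 where "c2 = \<theta> * (d - \<mu>) / 2"
  have c2: "0 < c2" using \<theta> d by (simp add: c2_def)
  define c' where "c' = min c c2"
  have c': "0 < c'" "c' \<le> c" "c' \<le> c2" using Kc c2 by (auto simp: c'_def)
  define K' where "K' = K + exp \<theta>"
  have K': "0 < K'" using Kc by (simp add: K'_def add_pos_pos)
  \<comment> \<open>For L about a ln n the failure bound exp (-c' L) of a block is of order n^-3;
    with at most n blocks this leaves n^-2.\<close>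
  define a where "a = 3 / c'"
  have a: "0 < a" "c' * a = 3" using c' by (auto simp: a_def)
  define A where "A = K' * exp c' + 4"
  \<comment> \<open>Twice the bound 4 n width^2 / (1 - q) for the topplings of one phase, with width
    at most (2 a + 1) ln n; the final 2 pays for rounding up in both phases.\<close>
  define C\<^sub>0 where "C\<^sub>0 = 8 * (2 * a + 1)\<^sup>2 / (1 - q) + 2"
  have "0 \<le> 8 * (2 * a + 1)\<^sup>2 / (1 - q)" using q by simp
  then have C0: "0 < C\<^sub>0" by (simp add: C\<^sub>0_def)

  have main: "measure (arw_law \<mu> lam n)
        {\<omega> \<in> space (arw_law \<mu> lam n).
          ereal_of_enat (absorption_time n \<omega>) > ereal (C\<^sub>0 * real n * (ln (real n))\<^sup>2)}
      \<le> 1 / real n powr 1"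
    if n2: "2 \<le> n" and ln: "2 \<le> ln (real n)" "3 \<le> a * ln (real n)" "2 * a * ln (real n) \<le> real n"
      and nA: "A \<le> real n" for n :: nat
  proof -
    \<comment> \<open>The ideal number of blocks of length a ln n. Rounding it down makes the blocks
      longer by at most a factor 2, up to the rounding of \<open>L\<close>.\<close>
    define x where "x = real n / (a * ln (real n))"
    have al: "0 < a * ln (real n)" using ln by linarith
    have x2: "2 \<le> x" using ln al by (simp add: x_def le_divide_eq)
    have xn: "x \<le> real n"
      unfolding x_def using al ln by (simp add: divide_le_eq mult_le_cancel_left1)
    define B where "B = nat \<lfloor>x\<rfloor>"
    have B: "real B \<le> x" "x / 2 \<le> real B" "1 \<le> B" using x2 unfolding B_def by linarith+
    then have B0: "0 < real B" "0 < B" by auto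
    define L where "L = n div B"
    have "n < B * Suc L"
      unfolding L_def using dividend_less_times_div[of B n] B by simp
    then have "real n < real B * (real L + 1)" by (metis of_nat_less_iff of_nat_mult of_nat_Suc add.commute)
    also have "\<dots> \<le> x * (real L + 1)" using B by (intro mult_right_mono) auto
    finally have "real n * (a * ln (real n)) < real n * (real L + 1)"
      using al by (simp add: x_def less_divide_eq)
    then have "a * ln (real n) < real L + 1"
      by (rule mult_left_less_imp_less) simp
    then have L_ge: "a * ln (real n) - 1 \<le> real L" by simp
    then have L2: "2 \<le> L" using ln by simp
    have "real L * real B \<le> real n"
      unfolding L_def by (metis div_times_less_eq_dividend of_nat_le_iff of_nat_mult)
    then have "real L * (x / 2) \<le> real n" using B mult_left_mono[of "x / 2" "real B" "real L"] by linarith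
    then have "real n * real L \<le> real n * (2 * (a * ln (real n)))"
      using al by (simp add: x_def divide_le_eq mult_ac)
    moreover have "0 < real n" using n2 by simp
    ultimately have L_le: "real L \<le> 2 * a * ln (real n)"
      by (simp add: mult_le_cancel_left_pos)
    interpret arw_blocks q n "\<lambda>i. i * n div B" B L
    proof unfold_locales
      show "B * n div B = n" using B0 by simp
      show "Suc j * n div B = j * n div B + L \<or> Suc j * n div B = j * n div B + L + 1" for j
        unfolding L_def by (rule equal_division_gap[OF B0(2)])
    qed (use n2 L2 in auto)
    have "1 \<le> L" using L2 by simp
    from pot[OF this] obtain \<Psi> :: "nat \<Rightarrow> nat \<Rightarrow> nat \<Rightarrow> real" where \<Psi>: "\<forall>N u v. 0 \<le> \<Psi> N u v"
      "\<forall>N u. 0 < u \<longrightarrow> 1 \<le> \<Psi> N 0 u \<and> 1 \<le> \<Psi> N u 0"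
      "\<forall>N k l. k + l < L + 1 \<longrightarrow>
        (real l + 1) * gap_avg k (\<lambda>u. \<Psi> N u (Suc l)) + (real k + 1) * gap_avg l (\<lambda>v. \<Psi> N (Suc k) v)
          \<le> (real k + real l + 2) * \<Psi> (Suc N) (Suc k) (Suc l)"
      "\<forall>N k l. real N \<le> d * real L \<longrightarrow> L \<le> k + l + 1 \<longrightarrow> k + l + 1 \<le> L + 1 \<longrightarrow>
        \<bar>real k - real l\<bar> \<le> 1 \<longrightarrow> \<Psi> N (Suc k) (Suc l) \<le> K * exp (- c * real L)"
      by (elim exE conjE)
    \<comment> \<open>With \<open>z\<close> as the decay per toppling, w z = 2 n. Hence
      \<open>rate ^ m\<close> is at most exp (-2 n), which beats the mean weight exp (n) of the
      initial configuration.\<close>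
    define w where "w = 4 * real n * width\<^sup>2 / (1 - q)"
    define m where "m = nat \<lceil>w\<rceil>"
    have w0: "0 \<le> w" using q by (simp add: w_def)
    have m: "w \<le> real m" "real m \<le> w + 1" unfolding m_def using w0 by linarith+

    have "width \<le> (2 * a + 1) * ln (real n)"
      using L_le ln by (simp add: width_def algebra_simps)
    then have "width\<^sup>2 \<le> ((2 * a + 1) * ln (real n))\<^sup>2"
      using width_ge by (intro power_mono) auto
    then have "4 * real n * width\<^sup>2 \<le> 4 * real n * ((2 * a + 1)\<^sup>2 * (ln (real n))\<^sup>2)"
      by (intro mult_left_mono) (auto simp: power_mult_distrib)
    then have "w \<le> 4 * real n * ((2 * a + 1)\<^sup>2 * (ln (real n))\<^sup>2) / (1 - q)"
      unfolding w_def using q by (intro divide_right_mono) auto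
    moreover have "1 * 1 \<le> real n * (ln (real n))\<^sup>2"
      using n2 ln by (intro mult_mono one_le_power) auto
    ultimately have "real m + real m \<le> 2 * (4 * real n * ((2 * a + 1)\<^sup>2 * (ln (real n))\<^sup>2) / (1 - q))
        + 2 * (real n * (ln (real n))\<^sup>2)"
      using m by linarith
    also have "\<dots> = C\<^sub>0 * real n * (ln (real n))\<^sup>2"
      by (simp add: C\<^sub>0_def algebra_simps)
    finally have time: "real (m + m) \<le> C\<^sub>0 * real n * (ln (real n))\<^sup>2" by simp

    have "measure (arw_law \<mu> lam n)
        {\<omega> \<in> space (arw_law \<mu> lam n).
          ereal_of_enat (absorption_time n \<omega>) > ereal (C\<^sub>0 * real n * (ln (real n))\<^sup>2)}
      \<le> enn2real (arw_expectation \<mu> lam n (m + m) (\<lambda>\<eta>. of_bool (\<not> all_asleep n \<eta>)))"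
      by (rule absorption_time_tail[OF time])
    also have "\<dots> \<le> real B * (K * exp (- c * real L))
        + real B * exp (\<mu> * ((exp \<theta> - 1) * (real L + 1)) - \<theta> * (d * real L)) + 2 * rate ^ m * exp (real n)"
    proof (rule survival_bound[where \<Psi> = \<Psi>])
      show "0 < lam" "q = lam / (1 + lam)" by (fact, fact q_def)
      show "0 \<le> \<Psi> N u v" for N u v using \<Psi>(1) by blast
      show "1 \<le> \<Psi> N 0 u" "1 \<le> \<Psi> N u 0" if "0 < u" for N u using \<Psi>(2) that by blast+
      show "(real l + 1) * gap_avg k (\<lambda>u. \<Psi> N u (Suc l)) + (real k + 1) * gap_avg l (\<lambda>v. \<Psi> N (Suc k) v)
          \<le> (real k + real l + 2) * \<Psi> (Suc N) (Suc k) (Suc l)" if "k + l < L + 1" for N k l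
        using \<Psi>(3) that by blast
      show "\<Psi> N (Suc k) (Suc l) \<le> K * exp (- c * real L)"
        if "real N \<le> d * real L" "L \<le> k + l + 1" "k + l + 1 \<le> L + 1" "\<bar>real k - real l\<bar> \<le> 1" for N k l
        using \<Psi>(4) that by blast
    qed (use Kc \<theta> \<mu> \<mu>1 in auto)
    also have "\<dots> \<le> real n * (K' * (exp c' / real n ^ 3)) + 2 * exp (- real n)"
    proof (intro add_mono)
      have L_exp: "exp (- c' * real L) \<le> exp c' / real n ^ 3"
      proof -
        have "c' * (a * ln (real n) - 1) \<le> c' * real L" using L_ge c' by (intro mult_left_mono) auto
        moreover have "c' * (a * ln (real n) - 1) = 3 * ln (real n) - c'"
          using a by (simp add: algebra_simps mult.assoc[symmetric])
        ultimately have "- c' * real L \<le> c' - 3 * ln (real n)" by simp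
        then have "exp (- c' * real L) \<le> exp (c' - 3 * ln (real n))" by simp
        also have "exp (3 * ln (real n)) = real n ^ 3"
          using n2 exp_of_nat_mult[of 3 "ln (real n)"] by simp
        then have "exp (c' - 3 * ln (real n)) = exp c' / real n ^ 3" by (simp add: exp_diff)
        finally show ?thesis .
      qed
      have e1: "K * exp (- c * real L) \<le> K * exp (- c' * real L)"
        using c' Kc by (intro mult_left_mono) (auto intro: mult_right_mono)
      have "\<mu> * ((exp \<theta> - 1) * (real L + 1)) = (\<mu> * (exp \<theta> - 1)) * (real L + 1)" by simp
      also have "\<dots> \<le> (\<theta> * ((d + \<mu>) / 2)) * (real L + 1)" using mgf by (intro mult_right_mono) auto
      also have "\<dots> = \<theta> * ((d + \<mu>) / 2) + \<theta> * (d * real L) - c2 * real L"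
        by (simp add: c2_def field_simps)
      also have "\<theta> * ((d + \<mu>) / 2) \<le> \<theta> * 1" using \<theta> d \<mu> q by (intro mult_left_mono) auto
      finally have "\<mu> * ((exp \<theta> - 1) * (real L + 1)) - \<theta> * (d * real L) \<le> \<theta> - c2 * real L" by simp
      also have "\<dots> \<le> \<theta> + (- c' * real L)" using c' mult_right_mono[of c' c2 "real L"] by simp
      finally have e2: "exp (\<mu> * ((exp \<theta> - 1) * (real L + 1)) - \<theta> * (d * real L)) \<le> exp \<theta> * exp (- c' * real L)"
        unfolding exp_add[symmetric] by simp
      have "real B * (K * exp (- c * real L))
        + real B * exp (\<mu> * ((exp \<theta> - 1) * (real L + 1)) - \<theta> * (d * real L))
        = real B * (K * exp (- c * real L) + exp (\<mu> * ((exp \<theta> - 1) * (real L + 1)) - \<theta> * (d * real L)))"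
        by (simp add: algebra_simps)
      also have "\<dots> \<le> real B * (K * exp (- c' * real L) + exp \<theta> * exp (- c' * real L))"
        by (rule mult_left_mono[OF add_mono[OF e1 e2]]) simp
      also have "\<dots> = real B * (K' * exp (- c' * real L))" by (simp add: K'_def algebra_simps)
      also have "\<dots> \<le> real n * (K' * (exp c' / real n ^ 3))"
        using L_exp B xn K' by (intro mult_mono mult_left_mono) auto
      finally show "real B * (K * exp (- c * real L))
        + real B * exp (\<mu> * ((exp \<theta> - 1) * (real L + 1)) - \<theta> * (d * real L))
        \<le> real n * (K' * (exp c' / real n ^ 3))" .
      define z where "z = (1 - q) / (2 * width\<^sup>2)"
      have W: "0 < width\<^sup>2" using width_ge by simp
      have z: "0 \<le> z" using q W by (simp add: z_def)
      have "rate \<le> exp (- z)" using exp_ge_add_one_self[of "- z"] by (simp add: rate_def z_def)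
      then have "rate ^ m \<le> exp (- z) ^ m" using rate_nonneg by (intro power_mono)
      also have "\<dots> = exp (- (real m * z))" by (simp add: exp_of_nat_mult[symmetric])
      also have "\<dots> \<le> exp (- (2 * real n))"
      proof -
        have "2 * real n = w * z" using W q by (simp add: w_def z_def)
        also have "\<dots> \<le> real m * z" using m z by (intro mult_right_mono)
        finally show ?thesis by simp
      qed
      finally have "rate ^ m * exp (real n) \<le> exp (- (2 * real n)) * exp (real n)"
        by (intro mult_right_mono) auto
      also have "\<dots> = exp (- real n)" by (simp add: exp_add[symmetric])
      finally show "2 * rate ^ m * exp (real n) \<le> 2 * exp (- real n)" by simp
    qed
    also have "\<dots> \<le> A / (real n)\<^sup>2"
    proof -
      have n0: "0 < real n" using n2 by simp
      have "real n * (K' * (exp c' / real n ^ 3)) = K' * exp c' / (real n)\<^sup>2"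
        using n0 by (simp add: field_simps power2_eq_square power3_eq_cube)
      moreover have "(real n)\<^sup>2 / 2 \<le> exp (real n)"
        using exp_lower_Taylor_quadratic[of "real n"] by simp
      then have "2 * exp (- real n) \<le> 4 / (real n)\<^sup>2"
        using n0 by (simp add: exp_minus field_simps)
      ultimately show ?thesis by (simp add: A_def add_divide_distrib)
    qed
    \<comment> \<open>One of the two powers of n absorbs the constant \<open>A\<close>; this is why
      the exponent \<open>b = 1\<close> comes out.\<close>
    also have "\<dots> \<le> real n / (real n)\<^sup>2" using nA by (intro divide_right_mono) auto
    also have "\<dots> = 1 / real n powr 1" using n2 by (simp add: power2_eq_square)
    finally show ?thesis .
  qed
  have "\<forall>\<^sub>F n in sequentially. 2 \<le> n" by (rule eventually_ge_at_top)
  moreover have "\<forall>\<^sub>F n in sequentially. 2 \<le> ln (real n)" by real_asymp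
  moreover have "\<forall>\<^sub>F n in sequentially. 3 \<le> a * ln (real n)" using a(1) by real_asymp
  moreover have "\<forall>\<^sub>F n in sequentially. 2 * a * ln (real n) \<le> real n" using a(1) by real_asymp
  moreover have "\<forall>\<^sub>F n in sequentially. A \<le> real n" by real_asymp
  ultimately have "\<forall>\<^sub>F n in sequentially. measure (arw_law \<mu> lam n)
        {\<omega> \<in> space (arw_law \<mu> lam n).
          ereal_of_enat (absorption_time n \<omega>) > ereal (C\<^sub>0 * real n * (ln (real n))\<^sup>2)}
      \<le> 1 / real n powr 1"
    by eventually_elim (rule main)
  with C0 show ?thesis by (intro exI[of _ C\<^sub>0] exI[of _ 1]) simp
qed

end
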